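(* Let $\underline{\bm{\lambda}}$ be an $(r,d)$-partition of $n$ and let $\mathfrak{t}$ be a standard $(r,d)$-tableau of shape $\underline{\bm{\lambda}}$, and write $\mathrm{c}_i=\mathrm{c}_{\mathfrak{t}}(i)$, $\mathrm{p}_i=\mathrm{p}_{\mathfrak{t}}(i)$ for $1\le i\le n$. Then the idempotent $E_{\mathfrak{t}}$ of the (split semisimple) degenerate cyclotomic Yokonuma-Hecke algebra $Y_{r,n}^{d}$ corresponding to $\mathfrak{t}$ can be obtained by the following consecutive evaluations (performed from left to right: first $\underline{v_1}=\zeta_{\mathrm{p}_1}$, then $\ldots$, then $\underline{v_n}=\zeta_{\mathrm{p}_n}$, then $u_1=\mathrm{c}_1$, then $\ldots$, then $u_n=\mathrm{c}_n$): $$E_{\mathfrak{t}}=\frac{1}{\mathrm{F}_{\underline{\bm{\lambda}}}^{T}\,\mathrm{F}_{\underline{\bm{\lambda}}}}\,\Phi(u_1,\ldots,u_n,\underline{v_1},\ldots,\underline{v_n})\Big|_{\underline{v_1}=\zeta_{\mathrm{p}_1}}\cdots\Big|_{\underline{v_n}=\zeta_{\mathrm{p}_n}}\Big|_{u_1=\mathrm{c}_1}\cdots\Big|_{u_n=\mathrm{c}_n}.$$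
   Context: **The algebra.** Let $r,d,n\geq 1$ be integers and let $\mathbb{K}$ be an algebraically closed field of (positive) characteristic $p$ with $p\nmid r$, and let $v_1,\ldots,v_d\in\mathbb{K}$. The degenerate affine Yokonuma-Hecke algebra $\widehat{Y}_{r,n}$ is the associative unital $\mathbb{K}$-algebra generated by $t_1,\ldots,t_n,g_1,\ldots,g_{n-1},x_1,\ldots,x_n$ with relations: $g_ig_j=g_jg_i$ if $|i-j|\ge 2$; $g_ig_{i+1}g_i=g_{i+1}g_ig_{i+1}$; $t_it_j=t_jt_i$; $g_it_j=t_{s_i(j)}g_i$; $t_i^r=1$; $g_i^2=1$; $x_ix_j=x_jx_i$; $g_ix_{i+1}=x_ig_i+e_i$; $g_ix_j=x_jg_i$ for $j\neq i,i+1$; $t_jx_i=x_it_j$ for all $i,j$. Here $s_i=(i,i+1)$ and $e_i=\frac1r\sum_{s=0}^{r-1}t_i^st_{i+1}^{-s}$. The degenerate cyclotomic Yokonuma-Hecke algebra $Y_{r,n}^d$ is the quotient of $\widehat{Y}_{r,n}$ by the two-sided ideal generated by $(x_1-v_1)\cdots(x_1-v_d)$; images of generators are denoted by the same symbols. Standing assumption (split semisimple case): in $\mathbb{K}$, $$n!\prod_{1\leq i<j\leq d}\ \prod_{-n<l<n}(l+v_i-v_j)\neq 0.$$ Fix a primitive $r$-th root of unity $\zeta\in\mathbb{K}$, put $\zeta_k=\zeta^{k-1}$ for $1\le k\le r$, and $S=\{\zeta_1,\ldots,\zeta_r\}$. **Partitions and tableaux.** An $(r,d)$-partition of $n$ is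 an $r$-tuple $\underline{\bm{\lambda}}=((\lambda_1^{(1)},\ldots,\lambda_d^{(1)}),\ldots,(\lambda_1^{(r)},\ldots,\lambda_d^{(r)}))$ of $d$-tuples of partitions with $\sum_{k,l}|\lambda_l^{(k)}|=n$; $\mathcal{P}_{r,n}^d$ is the set of these. Its diagram is the set of $(r,d)$-nodes $\bm{\theta}=((x,y),k,l)$ with $(x,y)$ (row $x$, column $y$) in the Young diagram of $\lambda_l^{(k)}$. Put $\mathrm{p}^{(r)}(\bm{\theta})=k$, $\mathrm{p}^{(d)}(\bm{\theta})=l$, and $\mathrm{c}(\bm{\theta})=y-x+v_l\in\mathbb{K}$. A standard $(r,d)$-tableau of shape $\underline{\bm{\lambda}}$ is a bijective filling of the diagram by $1,\ldots,n$ with entries increasing along rows and down columns of each component; $\mathrm{Std}(\underline{\bm{\lambda}})$ is the set of these. If $i$ occupies the node $\bm{\theta}$ in $\mathfrak{t}$, put $\mathrm{c}_{\mathfrak{t}}(i)=\mathrm{c}(\bm{\theta})$ and $\mathrm{p}_{\mathfrak{t}}(i)=\mathrm{p}^{(r)}(\bm{\theta})$. **The idempotents.** For $1\le k\le n$, let $\mathcal{C}(k)=\{\mathrm{c}_{\mathfrak{s}}(k)\}$ and $\overline{\mathcal{C}(k)}=\{\zeta_{\mathrm{p}_{\mathfrak{s}}(k)}\}$, where $\mathfrak{s}$ runs over all standard $(r,d)$-tableaux of all shapes in $\mathcal{P}_{r,n}^d$. Then $$E_{\mathfrak{t}}=\prod_{k=1}^{n}\Bigg(\prod_{\substack{c\in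 \mathcal{C}(k)\\ c\neq \mathrm{c}_{\mathfrak{t}}(k)}}\frac{x_{k}-c}{\mathrm{c}_{\mathfrak{t}}(k)-c}\cdot \prod_{\substack{\bar{c}\in \overline{\mathcal{C}(k)}\\ \bar{c}\neq \zeta_{\mathrm{p}_{\mathfrak{t}}(k)}}}\frac{t_{k}-\bar{c}}{\zeta_{\mathrm{p}_{\mathfrak{t}}(k)}-\bar{c}}\Bigg).$$ **Hook lengths and the scalars.** For partitions $\lambda,\mu$ with conjugates $\lambda',\mu'$ and a node $(x,y)$ of $\lambda$, $h_\lambda(x,y)=\lambda_x+\lambda'_y-x-y+1$ and $h_\lambda^\mu(x,y)=\lambda_x+\mu'_y-x-y+1$. For $\bm{\theta}=((x,y),k,l)\in\underline{\bm{\lambda}}$, $h_{\underline{\bm{\lambda}}}(\bm{\theta})=h_{\lambda_l^{(k)}}(x,y)$ and $h_{\underline{\bm{\lambda}}}^{\mu}(\bm{\theta})=h_{\lambda_l^{(k)}}^{\mu}(x,y)$. Define $$\mathrm{F}_{\underline{\bm{\lambda}}}^{T}=\prod_{\bm{\theta}\in\underline{\bm{\lambda}}}\ \prod_{\substack{\xi\in S\\ \xi\ne\zeta_{\mathrm{p}^{(r)}(\bm{\theta})}}}(\zeta_{\mathrm{p}^{(r)}(\bm{\theta})}-\xi),\qquad \mathrm{F}_{\underline{\bm{\lambda}}}=\prod_{\bm{\theta}\in\underline{\bm{\lambda}}}\Bigg(h_{\underline{\bm{\lambda}}}(\bm{\theta})\prod_{\substack{1\le k\le d\\ k\ne \mathrm{p}^{(d)}(\bm{\theta})}}\Big(h_{\underline{\bm{\lambda}}}^{\lambda_k^{(\mathrm{p}^{(r)}(\bm{\theta}))}}(\bm{\theta})+v_{\mathrm{p}^{(d)}(\bm{\theta})}-v_k\Big)\Bigg).$$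 **The rational function.** Let $u_1,\ldots,u_n,\underline{v_1},\ldots,\underline{v_n}$ be commuting variables (the underlined $\underline{v_i}$ are unrelated to the parameters $v_1,\ldots,v_d$). In rational functions with values in $Y_{r,n}^d$, a denominator such as $u-x_1$ or $\underline{v_i}-t_i$ denotes multiplication by the inverse. Put $g_i(a,b)=g_i+\frac{e_i}{a-b}$ for $1\le i\le n-1$; $\phi_1(u)=\frac{(u-v_1)\cdots(u-v_d)}{u-x_1}$; for $k=2,\ldots,n$, $$\phi_k(u_1,\ldots,u_{k-1},u)=g_{k-1}(u,u_{k-1})\,\phi_{k-1}(u_1,\ldots,u_{k-2},u)\,g_{k-1};$$ $$\Gamma(\underline{v_1},\ldots,\underline{v_n})=\prod_{i=1}^n\frac{\prod_{\xi\in S}(\underline{v_i}-\xi)}{\underline{v_i}-t_i};$$ $$\Phi(u_1,\ldots,u_n,\underline{v_1},\ldots,\underline{v_n})=\phi_n(u_1,\ldots,u_n)\,\phi_{n-1}(u_1,\ldots,u_{n-1})\cdots\phi_1(u_1)\,\Gamma(\underline{v_1},\ldots,\underline{v_n}).$$ *)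

theory Defs
  imports
    "HOL-Library.Poly_Mapping"
    "HOL-Computational_Algebra.Fraction_Field"
    "HOL-Computational_Algebra.Polynomial"
    "HOL-Combinatorics.Transposition"
    "HOL-Algebra.QuotRing"
begin

section \<open>The algebras\<close>

subsection \<open>Free algebras\<close>

datatype gen = TGen nat | GGen nat | XGen nat

datatype fword = Word (letters: "gen list")

text \<open>
  Words form the free monoid, written additively because the convolution product of
  \<^type>\<open>poly_mapping\<close> is based on \<^class>\<open>monoid_add\<close>. Hence \<open>fword \<Rightarrow>\<^sub>0 'f\<close> is the free
  associative unital algebra over \<open>'f\<close> on all symbols of type \<^type>\<open>gen\<close>.
\<close>

instantiation fword :: monoid_add
begin

definition zero_fword :: fword where
  "zero_fword = Word []"

definition plus_fword :: "fword \<Rightarrow> fword \<Rightarrow> fword" where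
  "plus_fword a b = Word (letters a @ letters b)"

instance
  by standard (simp_all add: zero_fword_def plus_fword_def)

end

type_synonym 'f falg = "fword \<Rightarrow>\<^sub>0 'f"

definition fconst :: "'f::field \<Rightarrow> 'f falg" where
  "fconst a = Poly_Mapping.single 0 a"

definition fgen :: "gen \<Rightarrow> 'f::field falg" where
  "fgen a = Poly_Mapping.single (Word [a]) 1"

abbreviation ft :: "nat \<Rightarrow> 'f::field falg" where "ft i \<equiv> fgen (TGen i)"
abbreviation fg :: "nat \<Rightarrow> 'f::field falg" where "fg i \<equiv> fgen (GGen i)"
abbreviation fx :: "nat \<Rightarrow> 'f::field falg" where "fx i \<equiv> fgen (XGen i)"

definition generators :: "nat \<Rightarrow> gen set" where
  "generators n = TGen ` {1..n} \<union> GGen ` {1..<n} \<union> XGen ` {1..n}"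

text \<open>The free algebra on \<open>t\<^sub>1,\<dots>,t\<^sub>n, g\<^sub>1,\<dots>,g\<^sub>n\<^sub>-\<^sub>1, x\<^sub>1,\<dots>,x\<^sub>n\<close> only.\<close>

definition free_algebra :: "nat \<Rightarrow> 'f::field falg ring" where
  "free_algebra n =
     \<lparr>carrier = {P. \<forall>w\<in>Poly_Mapping.keys P. set (letters w) \<subseteq> generators n},
      mult = (*), one = 1, zero = 0, add = (+)\<rparr>"

subsection \<open>Degenerate affine and cyclotomic Yokonuma-Hecke algebras\<close>

text \<open>
  In the free algebra \<open>t\<^sub>j\<close> has no inverse; as \<open>t\<^sub>j\<^sup>r = 1\<close> is one of the relations, \<open>t\<^sub>j\<^sup>-\<^sup>s\<close> is
  represented by \<open>t\<^sub>j\<^sup>r\<^sup>-\<^sup>s\<close>.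
\<close>

definition fe :: "nat \<Rightarrow> nat \<Rightarrow> 'f::field falg" where
  "fe r i = fconst (1 / of_nat r) * (\<Sum>s\<in>{0..<r}. ft i ^ s * ft (i + 1) ^ (r - s))"

text \<open>A relation \<open>a = b\<close> is recorded as the element \<open>a - b\<close>.\<close>

definition affine_relations :: "nat \<Rightarrow> nat \<Rightarrow> 'f::field falg set" where
  "affine_relations r n =
     {fg i * fg j - fg j * fg i | i j. i \<in> {1..<n} \<and> j \<in> {1..<n} \<and> \<bar>int i - int j\<bar> \<ge> 2}
   \<union> {fg i * fg (i + 1) * fg i - fg (i + 1) * fg i * fg (i + 1) | i. i \<in> {1..<n} \<and> i + 1 \<in> {1..<n}}
   \<union> {ft i * ft j - ft j * ft i | i j. i \<in> {1..n} \<and> j \<in> {1..n}}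
   \<union> {fg i * ft j - ft (Transposition.transpose i (i + 1) j) * fg i | i j. i \<in> {1..<n} \<and> j \<in> {1..n}}
   \<union> {ft i ^ r - 1 | i. i \<in> {1..n}}
   \<union> {fg i ^ 2 - 1 | i. i \<in> {1..<n}}
   \<union> {fx i * fx j - fx j * fx i | i j. i \<in> {1..n} \<and> j \<in> {1..n}}
   \<union> {fg i * fx (i + 1) - (fx i * fg i + fe r i) | i. i \<in> {1..<n}}
   \<union> {fg i * fx j - fx j * fg i | i j. i \<in> {1..<n} \<and> j \<in> {1..n} \<and> j \<noteq> i \<and> j \<noteq> i + 1}
   \<union> {ft j * fx i - fx i * ft j | i j. i \<in> {1..n} \<and> j \<in> {1..n}}"

definition affine_ideal :: "nat \<Rightarrow> nat \<Rightarrow> 'f::field falg set" where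
  "affine_ideal r n = Idl\<^bsub>free_algebra n\<^esub> (affine_relations r n)"

definition affine_YH :: "nat \<Rightarrow> nat \<Rightarrow> 'f::field falg set ring" where
  "affine_YH r n = free_algebra n Quot affine_ideal r n"

definition affine_class :: "nat \<Rightarrow> nat \<Rightarrow> 'f::field falg \<Rightarrow> 'f falg set" where
  "affine_class r n P = affine_ideal r n +>\<^bsub>free_algebra n\<^esub> P"

text \<open>\<open>v l\<close> is the parameter \<open>v\<^sub>l\<close>, \<open>1 \<le> l \<le> d\<close>; other values of \<open>v\<close> are irrelevant.\<close>

definition cyclotomic_ideal :: "nat \<Rightarrow> nat \<Rightarrow> nat \<Rightarrow> (nat \<Rightarrow> 'f::field) \<Rightarrow> 'f falg set set" where
  "cyclotomic_ideal r n d v =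
     Idl\<^bsub>affine_YH r n\<^esub>
       {affine_class r n (prod_list (map (\<lambda>l. fx 1 - fconst (v l)) [1..<Suc d]))}"

definition YH :: "nat \<Rightarrow> nat \<Rightarrow> nat \<Rightarrow> (nat \<Rightarrow> 'f::field) \<Rightarrow> 'f falg set set ring" where
  "YH r n d v = affine_YH r n Quot cyclotomic_ideal r n d v"

text \<open>The image in \<^const>\<open>YH\<close> of an element of the free algebra.\<close>

definition YH_class :: "nat \<Rightarrow> nat \<Rightarrow> nat \<Rightarrow> (nat \<Rightarrow> 'f::field) \<Rightarrow> 'f falg \<Rightarrow> 'f falg set set" where
  "YH_class r n d v P = cyclotomic_ideal r n d v +>\<^bsub>affine_YH r n\<^esub> affine_class r n P"


section \<open>Partitions and tableaux\<close>

definition is_partition :: "nat list \<Rightarrow> bool" where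
  "is_partition la \<longleftrightarrow> sorted_wrt (\<ge>) la \<and> 0 \<notin> set la"

definition row_len :: "nat list \<Rightarrow> nat \<Rightarrow> nat" where
  "row_len la x = (if 1 \<le> x \<and> x \<le> length la then la ! (x - 1) else 0)"

definition young :: "nat list \<Rightarrow> (nat \<times> nat) set" where
  "young la = {(x, y). 1 \<le> x \<and> 1 \<le> y \<and> y \<le> row_len la x}"

definition col_len :: "nat list \<Rightarrow> nat \<Rightarrow> nat" where
  "col_len la y = card {x. (x, y) \<in> young la}"

type_synonym rd_partition = "nat \<Rightarrow> nat \<Rightarrow> nat list"

type_synonym node = "(nat \<times> nat) \<times> nat \<times> nat"

text \<open>
  The component \<open>lam k l\<close> is the partition with upper index \<open>k\<close> (\<open>1 \<le> k \<le> r\<close>) and lower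
  index \<open>l\<close> (\<open>1 \<le> l \<le> d\<close>).
\<close>

definition rd_partitions :: "nat \<Rightarrow> nat \<Rightarrow> nat \<Rightarrow> rd_partition set" where
  "rd_partitions r d n =
     {lam. (\<forall>k l. is_partition (lam k l)) \<and>
           (\<forall>k l. k \<notin> {1..r} \<or> l \<notin> {1..d} \<longrightarrow> lam k l = []) \<and>
           (\<Sum>k\<in>{1..r}. \<Sum>l\<in>{1..d}. sum_list (lam k l)) = n}"

definition diagram :: "rd_partition \<Rightarrow> node set" where
  "diagram lam = {((x, y), k, l). (x, y) \<in> young (lam k l)}"

definition node_pr :: "node \<Rightarrow> nat" where
  "node_pr = (\<lambda>((x, y), k, l). k)"

definition node_pd :: "node \<Rightarrow> nat" where
  "node_pd = (\<lambda>((x, y), k, l). l)"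

definition node_content :: "(nat \<Rightarrow> 'k::field) \<Rightarrow> node \<Rightarrow> 'k" where
  "node_content v = (\<lambda>((x, y), k, l). of_nat y - of_nat x + v l)"

definition std_tableaux :: "nat \<Rightarrow> rd_partition \<Rightarrow> (node \<Rightarrow> nat) set" where
  "std_tableaux n lam =
     {t. bij_betw t (diagram lam) {1..n} \<and>
         (\<forall>x y y' k l. ((x, y), k, l) \<in> diagram lam \<and> ((x, y'), k, l) \<in> diagram lam \<and> y < y'
            \<longrightarrow> t ((x, y), k, l) < t ((x, y'), k, l)) \<and>
         (\<forall>x x' y k l. ((x, y), k, l) \<in> diagram lam \<and> ((x', y), k, l) \<in> diagram lam \<and> x < x'
            \<longrightarrow> t ((x, y), k, l) < t ((x', y), k, l))}"

text \<open>The node of the diagram of \<open>lam\<close> occupied by \<open>i\<close>.\<close>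

definition node_of :: "rd_partition \<Rightarrow> (node \<Rightarrow> nat) \<Rightarrow> nat \<Rightarrow> node" where
  "node_of lam t i = inv_into (diagram lam) t i"

definition tab_content :: "(nat \<Rightarrow> 'k::field) \<Rightarrow> rd_partition \<Rightarrow> (node \<Rightarrow> nat) \<Rightarrow> nat \<Rightarrow> 'k" where
  "tab_content v lam t i = node_content v (node_of lam t i)"

definition tab_pos :: "rd_partition \<Rightarrow> (node \<Rightarrow> nat) \<Rightarrow> nat \<Rightarrow> nat" where
  "tab_pos lam t i = node_pr (node_of lam t i)"


section \<open>The idempotents\<close>

definition primitive_root_of_unity :: "nat \<Rightarrow> 'k::field \<Rightarrow> bool" where
  "primitive_root_of_unity r z \<longleftrightarrow> z ^ r = 1 \<and> (\<forall>m\<in>{1..<r}. z ^ m \<noteq> 1)"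

definition zeta_pow :: "'k::field \<Rightarrow> nat \<Rightarrow> 'k" where
  "zeta_pow z k = z ^ (k - 1)"

definition root_set :: "nat \<Rightarrow> 'k::field \<Rightarrow> 'k set" where
  "root_set r z = zeta_pow z ` {1..r}"

definition content_set :: "nat \<Rightarrow> nat \<Rightarrow> nat \<Rightarrow> (nat \<Rightarrow> 'k::field) \<Rightarrow> nat \<Rightarrow> 'k set" where
  "content_set r n d v k =
     {tab_content v mu s k | mu s. mu \<in> rd_partitions r d n \<and> s \<in> std_tableaux n mu}"

definition position_set :: "nat \<Rightarrow> nat \<Rightarrow> nat \<Rightarrow> 'k::field \<Rightarrow> nat \<Rightarrow> 'k set" where
  "position_set r n d z k =
     {zeta_pow z (tab_pos mu s k) | mu s. mu \<in> rd_partitions r d n \<and> s \<in> std_tableaux n mu}"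

definition ring_prod_list :: "('a, 'b) monoid_scheme \<Rightarrow> 'a list \<Rightarrow> 'a" where
  "ring_prod_list R xs = foldr (mult R) xs (one R)"

text \<open>
  Product over an unordered finite set of pairwise commuting elements of a ring that need
  not be commutative: the common value of the products in all possible orders.
\<close>

definition comm_prod :: "('a, 'b) monoid_scheme \<Rightarrow> ('i \<Rightarrow> 'a) \<Rightarrow> 'i set \<Rightarrow> 'a" where
  "comm_prod R f A =
     (THE y. \<forall>xs. distinct xs \<and> set xs = A \<longrightarrow> y = ring_prod_list R (map f xs))"

definition E_idem ::
  "nat \<Rightarrow> nat \<Rightarrow> nat \<Rightarrow> (nat \<Rightarrow> 'k::field) \<Rightarrow> 'k \<Rightarrow> rd_partition \<Rightarrow> (node \<Rightarrow> nat) \<Rightarrow> 'k falg set set" where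
  "E_idem r n d v z lam t =
     ring_prod_list (YH r n d v)
       (map (\<lambda>k.
          comm_prod (YH r n d v)
            (\<lambda>c. YH_class r n d v (fconst (1 / (tab_content v lam t k - c)) * (fx k - fconst c)))
            (content_set r n d v k - {tab_content v lam t k})
          \<otimes>\<^bsub>YH r n d v\<^esub>
          comm_prod (YH r n d v)
            (\<lambda>c. YH_class r n d v (fconst (1 / (zeta_pow z (tab_pos lam t k) - c)) * (ft k - fconst c)))
            (position_set r n d z k - {zeta_pow z (tab_pos lam t k)}))
        [1..<Suc n])"


section \<open>Hook lengths and the scalars\<close>

definition gen_hook :: "nat list \<Rightarrow> nat list \<Rightarrow> nat \<times> nat \<Rightarrow> int" where
  "gen_hook la mu = (\<lambda>(x, y). int (row_len la x) + int (col_len mu y) - int x - int y + 1)"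

definition hook :: "nat list \<Rightarrow> nat \<times> nat \<Rightarrow> int" where
  "hook la = gen_hook la la"

definition F_T :: "nat \<Rightarrow> 'k::field \<Rightarrow> rd_partition \<Rightarrow> 'k" where
  "F_T r z lam =
     (\<Prod>\<theta>\<in>diagram lam. \<Prod>\<xi>\<in>root_set r z - {zeta_pow z (node_pr \<theta>)}. zeta_pow z (node_pr \<theta>) - \<xi>)"

definition F_lam :: "nat \<Rightarrow> (nat \<Rightarrow> 'k::field) \<Rightarrow> rd_partition \<Rightarrow> 'k" where
  "F_lam d v lam =
     (\<Prod>\<theta>\<in>diagram lam.
        of_int (hook (lam (node_pr \<theta>) (node_pd \<theta>)) (fst \<theta>)) *
        (\<Prod>k\<in>{1..d} - {node_pd \<theta>}.
           of_int (gen_hook (lam (node_pr \<theta>) (node_pd \<theta>)) (lam (node_pr \<theta>) k) (fst \<theta>))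
           + v (node_pd \<theta>) - v k))"


section \<open>Rational functions\<close>

subsection \<open>Scalar rational functions\<close>

text \<open>\<open>UVar i\<close> is \<open>u\<^sub>i\<close> and \<open>VVar i\<close> is the underlined \<open>v\<^sub>i\<close>.\<close>

datatype var = UVar nat | VVar nat

text \<open>
  Some linear order on the variables is needed for multivariate polynomials to be an
  instance of \<^class>\<open>idom\<close>; it plays no other role.
\<close>

fun var_code :: "var \<Rightarrow> nat" where
  "var_code (UVar i) = 2 * i"
| "var_code (VVar i) = Suc (2 * i)"

lemma var_code_inject: "var_code a = var_code b \<Longrightarrow> a = b"
  by (cases a; cases b; simp; presburger)

instantiation var :: linorder
begin

definition less_eq_var :: "var \<Rightarrow> var \<Rightarrow> bool" where
  "less_eq_var a b \<longleftrightarrow> var_code a \<le> var_code b"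

definition less_var :: "var \<Rightarrow> var \<Rightarrow> bool" where
  "less_var a b \<longleftrightarrow> var_code a < var_code b"

instance
  by standard (auto simp: less_eq_var_def less_var_def intro: var_code_inject)

end

type_synonym 'k multipoly = "(var \<Rightarrow>\<^sub>0 nat) \<Rightarrow>\<^sub>0 'k"

type_synonym 'k ratfun = "'k multipoly fract"

definition rconst :: "'k::field \<Rightarrow> 'k ratfun" where
  "rconst a = Fraction_Field.Fract (Poly_Mapping.single 0 a) 1"

definition rvar :: "var \<Rightarrow> 'k::field ratfun" where
  "rvar z = Fraction_Field.Fract (Poly_Mapping.single (Poly_Mapping.single z 1) 1) 1"

text \<open>Substitution of the scalar \<open>a\<close> for the variable \<open>z\<close> in a polynomial.\<close>

definition poly_subst :: "var \<Rightarrow> 'k::field \<Rightarrow> 'k multipoly \<Rightarrow> 'k multipoly" where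
  "poly_subst z a p =
     (\<Sum>m\<in>Poly_Mapping.keys p. Poly_Mapping.single (Poly_Mapping.update z 0 m) (Poly_Mapping.lookup p m * a ^ Poly_Mapping.lookup m z))"

definition regular_at :: "var \<Rightarrow> 'k::field \<Rightarrow> 'k ratfun \<Rightarrow> bool" where
  "regular_at z a f \<longleftrightarrow> (\<exists>p q. f = Fraction_Field.Fract p q \<and> poly_subst z a q \<noteq> 0)"

definition value_at :: "var \<Rightarrow> 'k::field \<Rightarrow> 'k ratfun \<Rightarrow> 'k ratfun" where
  "value_at z a f =
     (THE h. \<exists>p q. f = Fraction_Field.Fract p q \<and> poly_subst z a q \<noteq> 0 \<and>
                   h = Fraction_Field.Fract (poly_subst z a p) (poly_subst z a q))"

subsection \<open>Rational functions with values in the cyclotomic algebra\<close>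

text \<open>
  Rational functions with values in \<open>Y\<close> are the elements of the scalar extension of \<open>Y\<close> from
  the field \<open>'k\<close> to the field \<open>'k ratfun\<close>, that is, of the algebra over \<open>'k ratfun\<close> with the
  same presentation (and parameters \<open>v\<^sub>1,\<dots>,v\<^sub>d\<close> regarded as constant functions).
\<close>

definition YH_rat :: "nat \<Rightarrow> nat \<Rightarrow> nat \<Rightarrow> (nat \<Rightarrow> 'k::field) \<Rightarrow> 'k ratfun falg set set ring" where
  "YH_rat r n d v = YH r n d (\<lambda>l. rconst (v l))"

definition YH_rat_class ::
  "nat \<Rightarrow> nat \<Rightarrow> nat \<Rightarrow> (nat \<Rightarrow> 'k::field) \<Rightarrow> 'k ratfun falg \<Rightarrow> 'k ratfun falg set set" where
  "YH_rat_class r n d v P = YH_class r n d (\<lambda>l. rconst (v l)) P"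

text \<open>An element of \<open>Y\<close> as a constant rational function.\<close>

definition YH_const ::
  "nat \<Rightarrow> nat \<Rightarrow> nat \<Rightarrow> (nat \<Rightarrow> 'k::field) \<Rightarrow> 'k falg set set \<Rightarrow> 'k ratfun falg set set" where
  "YH_const r n d v y =
     (THE h. \<exists>P\<in>carrier (free_algebra n).
        y = YH_class r n d v P \<and> h = YH_rat_class r n d v (Poly_Mapping.map rconst P))"

text \<open>
  Evaluation of a \<open>Y\<close>-valued rational function at \<open>z = a\<close>: write it as a combination of words
  in the generators with coefficients regular at \<open>z = a\<close> and evaluate the coefficients.
  It is undefined (\<^const>\<open>None\<close>) if there is no such expression, or if the value depended on
  the expression chosen. The result is a rational function in the remaining variables.
\<close>

definition is_value_at ::
  "nat \<Rightarrow> nat \<Rightarrow> nat \<Rightarrow> (nat \<Rightarrow> 'k::field) \<Rightarrow> var \<Rightarrow> 'k \<Rightarrow>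
     'k ratfun falg set set \<Rightarrow> 'k ratfun falg set set \<Rightarrow> bool" where
  "is_value_at r n d v z a f h \<longleftrightarrow>
     (\<exists>P\<in>carrier (free_algebra n).
        f = YH_rat_class r n d v P \<and>
        (\<forall>w. regular_at z a (Poly_Mapping.lookup P w)) \<and>
        h = YH_rat_class r n d v (Poly_Mapping.map (value_at z a) P))"

definition YH_eval ::
  "nat \<Rightarrow> nat \<Rightarrow> nat \<Rightarrow> (nat \<Rightarrow> 'k::field) \<Rightarrow> var \<times> 'k \<Rightarrow>
     'k ratfun falg set set \<Rightarrow> 'k ratfun falg set set option" where
  "YH_eval r n d v za f =
     (if \<exists>!h. is_value_at r n d v (fst za) (snd za) f h
      then Some (THE h. is_value_at r n d v (fst za) (snd za) f h) else None)"

text \<open>Consecutive evaluations, the head of the list being performed first.\<close>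

fun YH_evals ::
  "nat \<Rightarrow> nat \<Rightarrow> nat \<Rightarrow> (nat \<Rightarrow> 'k::field) \<Rightarrow> (var \<times> 'k) list \<Rightarrow>
     'k ratfun falg set set \<Rightarrow> 'k ratfun falg set set option" where
  "YH_evals r n d v [] f = Some f"
| "YH_evals r n d v (za # zas) f = Option.bind (YH_eval r n d v za f) (YH_evals r n d v zas)"

subsection \<open>The fusion function\<close>

text \<open>The element \<open>g\<^sub>i(a,b)\<close>.\<close>

definition g_rat ::
  "nat \<Rightarrow> nat \<Rightarrow> nat \<Rightarrow> (nat \<Rightarrow> 'k::field) \<Rightarrow> nat \<Rightarrow> 'k ratfun \<Rightarrow> 'k ratfun \<Rightarrow> 'k ratfun falg set set" where
  "g_rat r n d v i a b = YH_rat_class r n d v (fg i + fconst (1 / (a - b)) * fe r i)"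

text \<open>
  \<open>phi r n d v us k u\<close> is \<open>\<phi>\<^sub>k(us 1, \<dots>, us (k - 1), u)\<close>; the value at \<open>k = 0\<close> is not used.
\<close>

fun phi ::
  "nat \<Rightarrow> nat \<Rightarrow> nat \<Rightarrow> (nat \<Rightarrow> 'k::field) \<Rightarrow> (nat \<Rightarrow> 'k ratfun) \<Rightarrow> nat \<Rightarrow> 'k ratfun \<Rightarrow>
     'k ratfun falg set set" where
  "phi r n d v us 0 u = \<one>\<^bsub>YH_rat r n d v\<^esub>"
| "phi r n d v us (Suc 0) u =
     YH_rat_class r n d v (fconst (\<Prod>l\<in>{1..d}. u - rconst (v l)))
     \<otimes>\<^bsub>YH_rat r n d v\<^esub> inv\<^bsub>YH_rat r n d v\<^esub> (YH_rat_class r n d v (fconst u - fx 1))"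
| "phi r n d v us (Suc (Suc k)) u =
     g_rat r n d v (Suc k) u (us (Suc k))
     \<otimes>\<^bsub>YH_rat r n d v\<^esub> phi r n d v us (Suc k) u
     \<otimes>\<^bsub>YH_rat r n d v\<^esub> YH_rat_class r n d v (fg (Suc k))"

definition Gamma_fun ::
  "nat \<Rightarrow> nat \<Rightarrow> nat \<Rightarrow> (nat \<Rightarrow> 'k::field) \<Rightarrow> 'k \<Rightarrow> 'k ratfun falg set set" where
  "Gamma_fun r n d v z =
     ring_prod_list (YH_rat r n d v)
       (map (\<lambda>i.
          YH_rat_class r n d v (fconst (\<Prod>\<xi>\<in>root_set r z. rvar (VVar i) - rconst \<xi>))
          \<otimes>\<^bsub>YH_rat r n d v\<^esub>
          inv\<^bsub>YH_rat r n d v\<^esub> (YH_rat_class r n d v (fconst (rvar (VVar i)) - ft i)))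
        [1..<Suc n])"

definition Phi_fun ::
  "nat \<Rightarrow> nat \<Rightarrow> nat \<Rightarrow> (nat \<Rightarrow> 'k::field) \<Rightarrow> 'k \<Rightarrow> 'k ratfun falg set set" where
  "Phi_fun r n d v z =
     ring_prod_list (YH_rat r n d v)
       (map (\<lambda>k. phi r n d v (\<lambda>i. rvar (UVar i)) k (rvar (UVar k))) (rev [1..<Suc n]))
     \<otimes>\<^bsub>YH_rat r n d v\<^esub> Gamma_fun r n d v z"

end

theory Submission
  imports Defs
begin

text \<open>
  Let \<open>c\<^sub>i\<close> be the content and \<open>p\<^sub>i\<close> the position of \<open>i\<close> in the given tableau, and call a vector of
  the algebra (on which the algebra acts from the left) a weight vector if it is a joint
  eigenvector of all \<open>t\<^sub>j\<close> and of \<open>x\<^sub>1, \<dots>, x\<^sub>k\<close>. The theorem rests on three facts.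

  First, the fusion function \<open>\<phi>\<^sub>k\<close> acts on a weight vector by a scalar: if the eigenvalues of
  \<open>x\<^sub>1, \<dots>, x\<^sub>k\<^sub>-\<^sub>1\<close> are \<open>c\<^sub>1, \<dots>, c\<^sub>k\<^sub>-\<^sub>1\<close>, these values are substituted for \<open>u\<^sub>1, \<dots>, u\<^sub>k\<^sub>-\<^sub>1\<close>, and \<open>a\<close> is the
  eigenvalue of \<open>x\<^sub>k\<close>, then the scalar is \<open>G(u) / (u - a)\<close>, where \<open>G(u)\<close> is the product of all \<open>u - v\<^sub>l\<close>
  and of all \<open>1 - 1 / (u - c\<^sub>i)\<^sup>2\<close> with \<open>i < k\<close> and \<open>p\<^sub>i = p\<^sub>k\<close>. This is an induction on \<open>k\<close>, because
  \<open>g\<^sub>k\<^sub>-\<^sub>1\<close>, corrected by a scalar, turns weight vectors into weight vectors for the sequence with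
  the last two entries exchanged (\<open>fusion_eig\<close>).

  Secondly, let \<open>E\<^sub>k\<^sub>-\<^sub>1\<close> be the product of the Lagrange factors of all \<open>t\<^sub>j\<close> and of \<open>x\<^sub>1, \<dots>, x\<^sub>k\<^sub>-\<^sub>1\<close>. It
  is the sum of eigenvectors \<open>w\<^sub>a\<close> of \<open>x\<^sub>k\<close> to distinct eigenvalues \<open>a\<close>, each of them the content of a
  node that can be added to the first \<open>k - 1\<close> nodes of the tableau, and \<open>E\<^sub>k\<close> is the summand for
  \<open>a = c\<^sub>k\<close> (\<open>partial_idem_splits\<close>, \<open>partial_idem_Suc\<close>). For this it is shown that the eigenvalues of
  every weight vector are the contents of a standard tableau (\<open>weights_are_tabular\<close>), in the
  style of Okounkov and Vershik: equal neighbours would produce a Jordan block of a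
  diagonalisable \<open>x\<^sub>i\<close>, the sequence \<open>a, a \<plusminus> 1, a\<close> contradicts the braid relation, and all other
  neighbours may be exchanged. In the same induction, a polynomial that annihilates \<open>g\<^sub>k z\<close> under
  \<open>x\<^sub>k\<close> yields one that annihilates \<open>z\<close> under \<open>x\<^sub>k\<^sub>+\<^sub>1\<close>, with distinct roots because contents are
  separated.

  Thirdly, \<open>G(u) = (u - c\<^sub>k) H(u)\<close> where \<open>H\<close> is regular at \<open>c\<^sub>k\<close> and \<open>H(c\<^sub>k)\<close> is the quotient of the hook
  products of the diagrams with \<open>k\<close> and \<open>k - 1\<close> nodes (\<open>content_product_hook_ratio\<close>,
  \<open>hook_product_insert\<close>).

  Therefore \<open>\<phi>\<^sub>k E\<^sub>k\<^sub>-\<^sub>1\<close> is the sum of all \<open>(u - c\<^sub>k) / (u - a) H(u) w\<^sub>a\<close>, and at \<open>u = c\<^sub>k\<close> only the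
  summand \<open>H(c\<^sub>k) E\<^sub>k\<close> survives (\<open>fusion_step\<close>). The evaluations of the underlined variables turn \<open>\<Gamma>\<close>
  into the product of the Lagrange factors of the \<open>t\<^sub>i\<close> times \<open>F\<^sup>T\<close>; then the evaluations of
  \<open>u\<^sub>1, \<dots>, u\<^sub>n\<close> replace the factors \<open>\<phi>\<^sub>1, \<dots>, \<phi>\<^sub>n\<close>, from right to left, by \<open>x\<close>-parts of the idempotent,
  and the scalars multiply up to the hook product of the whole diagram.

  An evaluation is performed on the coefficients of an expression in the generators. It does
  not depend on the expression: it extends to a map on all rational functions that is linear
  over the constants (\<open>value_linear_extension\<close>), and the ideal of relations is stable under such
  maps because the relations have constant coefficients (\<open>const_linear_total_ideal\<close>).
\<close>

section \<open>Calculating modulo an ideal\<close>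

text \<open>
  All computations in a quotient algebra are carried out as congruences between
  representatives, so that they remain equational reasoning in a ring type. The function \<open>kap\<close>
  embeds the scalars.
\<close>

locale ideal_mod =
  fixes J :: "'a::ring_1 set" and kap :: "'f::field \<Rightarrow> 'a"
  assumes J_zero: "0 \<in> J"
    and J_add: "a \<in> J \<Longrightarrow> b \<in> J \<Longrightarrow> a + b \<in> J"
    and J_left: "a \<in> J \<Longrightarrow> c * a \<in> J"
    and J_right: "a \<in> J \<Longrightarrow> a * c \<in> J"
    and kap_add: "kap (s + s1) = kap s + kap s1"
    and kap_mult: "kap (s * s1) = kap s * kap s1"
    and kap_one [simp]: "kap 1 = 1"
    and kap_central: "kap s * z = z * kap s"
begin

definition cg :: "'a \<Rightarrow> 'a \<Rightarrow> bool" (infix "\<approx>" 50) where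
  "a \<approx> b \<longleftrightarrow> a - b \<in> J"

lemma J_minus: "a \<in> J \<Longrightarrow> - a \<in> J"
  using J_left[of a "- 1"] by simp

lemma cg_refl [simp, intro]: "a \<approx> a"
  by (simp add: cg_def J_zero)

lemma cg_sym: "a \<approx> b \<Longrightarrow> b \<approx> a"
  using J_minus[of "a - b"] by (simp add: cg_def)

lemma cg_trans [trans]: "a \<approx> b \<Longrightarrow> b \<approx> c \<Longrightarrow> a \<approx> c"
  using J_add[of "a - b" "b - c"] by (simp add: cg_def)

lemma cg_add: "a \<approx> b \<Longrightarrow> c \<approx> e \<Longrightarrow> a + c \<approx> b + e"
  using J_add[of "a - b" "c - e"] by (simp add: cg_def algebra_simps)

lemma cg_minus: "a \<approx> b \<Longrightarrow> - a \<approx> - b"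
  using J_minus[of "a - b"] by (simp add: cg_def)

lemma cg_diff: "a \<approx> b \<Longrightarrow> c \<approx> e \<Longrightarrow> a - c \<approx> b - e"
  using cg_add[of a b "- c" "- e"] cg_minus[of c e] by simp

lemma cg_left: "a \<approx> b \<Longrightarrow> c * a \<approx> c * b"
  using J_left[of "a - b" c] by (simp add: cg_def algebra_simps)

lemma cg_right: "a \<approx> b \<Longrightarrow> a * c \<approx> b * c"
  using J_right[of "a - b" c] by (simp add: cg_def algebra_simps)

lemma cg_mult: "a \<approx> b \<Longrightarrow> c \<approx> e \<Longrightarrow> a * c \<approx> b * e"
  using cg_left[of c e a] cg_right[of a b e] cg_trans by blast

lemma cg_sum: "(\<And>i. i \<in> I \<Longrightarrow> a i \<approx> b i) \<Longrightarrow> sum a I \<approx> sum b I"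
  by (induction I rule: infinite_finite_induct) (auto intro: cg_add)

lemma cg_zero_iff: "a - b \<approx> 0 \<longleftrightarrow> a \<approx> b"
  by (simp add: cg_def)

lemma kap_zero [simp]: "kap 0 = 0"
  using kap_add[of 0 0] by simp

lemma kap_minus: "kap (- a) = - kap a"
  using kap_add[of a "- a"] by (simp add: eq_neg_iff_add_eq_0 add.commute)

lemma kap_diff: "kap (a - b) = kap a - kap b"
  using kap_add[of a "- b"] by (simp add: kap_minus)

lemma kap_kap: "kap a * (kap b * z) = kap (a * b) * z"
  by (simp add: kap_mult mult.assoc)

lemma kap_left_commute: "y * (kap a * z) = kap a * (y * z)"
  by (metis kap_central mult.assoc)

lemma kap_sum: "kap (sum f I) = (\<Sum>i\<in>I. kap (f i))"
  by (induction I rule: infinite_finite_induct) (auto simp: kap_add)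

lemma kap_cancel: "a \<noteq> 0 \<Longrightarrow> kap a * z \<approx> 0 \<Longrightarrow> z \<approx> 0"
  using cg_left[of "kap a * z" 0 "kap (1 / a)"] by (simp add: kap_kap)

lemma two_cancel: "(2 :: 'f) \<noteq> 0 \<Longrightarrow> z + z \<approx> 0 \<Longrightarrow> z \<approx> 0"
  using kap_cancel[of 2 z] kap_add[of 1 1] by (simp add: algebra_simps mult_2)

section \<open>Polynomials in one element given by their roots\<close>

definition pl :: "'a \<Rightarrow> 'f list \<Rightarrow> 'a" where
  "pl y as = prod_list (map (\<lambda>a. y - kap a) as)"

definition pv :: "'f \<Rightarrow> 'f list \<Rightarrow> 'f" where
  "pv c as = prod_list (map (\<lambda>a. c - a) as)"

lemma pl_simps [simp]: "pl y [] = 1" "pl y (a # as) = (y - kap a) * pl y as"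
  by (simp_all add: pl_def)

lemma pv_simps [simp]: "pv y [] = 1" "pv y (a # as) = (y - a) * pv y as"
  by (simp_all add: pv_def)

lemma pv_nonzero: "c \<notin> set as \<Longrightarrow> pv c as \<noteq> 0"
  by (induction as) auto

lemma pv_zero: "c \<in> set as \<Longrightarrow> pv c as = 0"
  by (induction as) auto

lemma pl_commute: assumes "u * y = y * u" shows "u * pl y as = pl y as * u"
proof (induction as)
  case (Cons a as)
  have "u * pl y (a # as) = (u * (y - kap a)) * pl y as" by (simp add: mult.assoc)
  also have "u * (y - kap a) = (y - kap a) * u"
    using assms by (simp add: algebra_simps kap_central)
  finally show ?case using Cons by (simp add: mult.assoc)
qed simp

lemma pl_commute_self: "(y - kap b) * pl y as = pl y as * (y - kap b)"
  by (rule pl_commute) (simp add: algebra_simps kap_central)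

lemma pl_commute_cg: assumes "u * y \<approx> y * u" shows "u * pl y as \<approx> pl y as * u"
proof (induction as)
  case (Cons a as)
  have "u * (y - kap a) \<approx> (y - kap a) * u"
    using cg_diff[OF assms, of "u * kap a" "kap a * u"] by (simp add: algebra_simps kap_central)
  from cg_right[OF this, of "pl y as"] cg_left[OF Cons, of "y - kap a"]
  show ?case by (simp add: mult.assoc) (metis cg_trans mult.assoc)
qed simp

text \<open>
  A root without repetition can be split off, at the right end because the factors commute.
\<close>

lemma pl_removeAll:
  assumes "distinct as" "pl y as * z \<approx> 0"
  shows "pl y (removeAll c as) * ((y - kap c) * z) \<approx> 0"
proof (cases "c \<in> set as")
  case True
  have "pl y as = pl y (removeAll c as) * (y - kap c)"
    using assms(1) True
  proof (induction as)
    case (Cons a as)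
    show ?case
    proof (cases "a = c")
      case True
      then show ?thesis using Cons by (simp add: pl_commute_self)
    next
      case False
      then show ?thesis using Cons by (simp add: mult.assoc)
    qed
  qed simp
  then show ?thesis using assms by (simp add: mult.assoc)
next
  case False
  then have "pl y (removeAll c as) * ((y - kap c) * z) = (y - kap c) * (pl y as * z)"
    by (simp add: pl_commute_self mult.assoc[symmetric])
  then show ?thesis using cg_left[OF assms(2), of "y - kap c"] by simp
qed

lemma eig_diff:
  assumes "y * z \<approx> kap c * z"
  shows "(y - kap a) * z \<approx> kap (c - a) * z"
  using cg_diff[OF assms, of "kap a * z" "kap a * z"] by (simp add: algebra_simps kap_diff)

lemma pl_eig:
  assumes "y * z \<approx> kap c * z"
  shows "pl y as * z \<approx> kap (pv c as) * z"
proof (induction as)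
  case (Cons a as)
  have "(y - kap a) * (pl y as * z) \<approx> (y - kap a) * (kap (pv c as) * z)"
    using cg_left[OF Cons] by simp
  also have "\<dots> = kap (pv c as) * ((y - kap a) * z)" by (rule kap_left_commute)
  also have "\<dots> \<approx> kap (pv c as) * (kap (c - a) * z)"
    by (rule cg_left) (rule eig_diff[OF assms])
  finally show ?case by (simp add: kap_kap mult.assoc mult.commute)
qed simp

text \<open>
  An element that is killed by a polynomial in \<open>y\<close> with distinct roots is a sum of eigenvectors
  of \<open>y\<close>. The summands lie in any additively closed set \<open>V\<close> that is stable under \<open>y\<close> and under a set
  \<open>C\<close> of scalars containing the roots; \<open>V\<close> will express that the summands are weight vectors or
  that they are defined over the constants.
\<close>

lemma eigenvector_decomposition:
  assumes "distinct as" "pl y as * z \<approx> 0" "z \<in> V"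
    and add: "\<And>u w. u \<in> V \<Longrightarrow> w \<in> V \<Longrightarrow> u + w \<in> V"
    and zero: "0 \<in> V"
    and scal: "\<And>s w. s \<in> C \<Longrightarrow> w \<in> V \<Longrightarrow> kap s * w \<in> V"
    and act: "\<And>w. w \<in> V \<Longrightarrow> y * w \<in> V"
    and C: "\<And>a b. a \<in> C \<Longrightarrow> b \<in> C \<Longrightarrow> a - b \<in> C" "\<And>a. a \<in> C \<Longrightarrow> 1 / a \<in> C" "1 \<in> C"
    and "set as \<subseteq> C"
  shows "\<exists>w. z \<approx> (\<Sum>a\<in>set as. w a) \<and> (\<forall>a\<in>set as. w a \<in> V \<and> y * w a \<approx> kap a * w a)"
  using assms(1-3,11)
proof (induction as arbitrary: z)
  case Nil
  then show ?case by simp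
next
  case (Cons a as)
  have C0: "0 \<in> C" using C(1)[OF C(3) C(3)] by simp
  have Cm: "s \<in> C \<Longrightarrow> - s \<in> C" for s using C(1)[OF C0, of s] by simp
  have diff: "u \<in> V \<Longrightarrow> w \<in> V \<Longrightarrow> u - w \<in> V" for u w
    using add[of u "kap (- 1) * w"] scal[OF Cm[OF C(3)]] by (simp add: kap_minus)
  let ?z = "(y - kap a) * z"
  have zV: "?z \<in> V"
    using diff[OF act[OF Cons.prems(3)] scal[of a z]] Cons.prems by (simp add: algebra_simps)
  have "pl y as * ?z \<approx> 0"
    using Cons.prems(2) by (simp add: mult.assoc[symmetric] pl_commute_self)
  then have "\<exists>w. ?z \<approx> (\<Sum>a\<in>set as. w a) \<and> (\<forall>a\<in>set as. w a \<in> V \<and> y * w a \<approx> kap a * w a)"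
    using Cons.prems by (intro Cons.IH zV) auto
  then obtain w where w: "?z \<approx> (\<Sum>a\<in>set as. w a)"
    and wV: "\<And>a. a \<in> set as \<Longrightarrow> w a \<in> V \<and> y * w a \<approx> kap a * w a" by blast
  \<comment> \<open>The component for \<open>a\<close> is what remains after \<open>(y - a) z\<close> has been divided by \<open>b - a\<close> on
    the \<open>b\<close>-components.\<close>
  define w' where "w' b = (if b = a then z - (\<Sum>b\<in>set as. kap (1 / (b - a)) * w b)
                           else kap (1 / (b - a)) * w b)" for b
  have a: "a \<notin> set as" using Cons by simp
  then have ne: "b \<noteq> a" if "b \<in> set as" for b using that by blast
  have sub: "(\<Sum>b\<in>A. kap (1 / (b - a)) * w b) \<in> V" if "A \<subseteq> set as" for A
    using finite_subset[OF that finite_set] that Cons.prems(4) C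
    by (induction A rule: finite_induct) (auto intro!: add zero scal simp: wV)
  have sum: "(\<Sum>b\<in>set (a # as). w' b) = z"
  proof -
    have "(\<Sum>b\<in>set as. w' b) = (\<Sum>b\<in>set as. kap (1 / (b - a)) * w b)"
      by (rule sum.cong) (auto simp: w'_def a)
    then show ?thesis using a by (simp add: w'_def)
  qed
  have eig: "y * w' b \<approx> kap b * w' b" if "b \<in> set as" for b
  proof -
    have "y * (kap (1 / (b - a)) * w b) \<approx> kap (1 / (b - a)) * (kap b * w b)"
      unfolding kap_left_commute[of y] using wV[OF that] by (intro cg_left) auto
    also have "\<dots> = kap b * (kap (1 / (b - a)) * w b)" by (rule kap_left_commute)
    finally show ?thesis using ne[OF that] by (simp add: w'_def)
  qed
  have "(y - kap a) * (\<Sum>b\<in>set as. w' b) \<approx> (\<Sum>b\<in>set as. w b)"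
    unfolding sum_distrib_left
  proof (rule cg_sum)
    fix b assume b: "b \<in> set as"
    have "(y - kap a) * w' b \<approx> kap (b - a) * w' b" by (rule eig_diff[OF eig[OF b]])
    also have "\<dots> = w b" using ne[OF b] by (simp add: w'_def kap_kap)
    finally show "(y - kap a) * w' b \<approx> w b" .
  qed
  from cg_trans[OF this cg_sym[OF w]]
  have *: "(y - kap a) * (\<Sum>b\<in>set as. w' b) \<approx> ?z" .
  have "w' a = z - (\<Sum>b\<in>set as. w' b)" using sum a by (simp add: algebra_simps)
  then have "(y - kap a) * w' a = ?z - (y - kap a) * (\<Sum>b\<in>set as. w' b)"
    by (simp only: right_diff_distrib)
  also have "\<dots> \<approx> 0" using cg_sym[OF *] by (simp only: cg_zero_iff)
  finally have "(y - kap a) * w' a \<approx> 0" .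
  then have eiga: "y * w' a \<approx> kap a * w' a" by (simp add: left_diff_distrib cg_zero_iff)
  have aV: "w' a \<in> V" using diff[OF Cons.prems(3) sub[of "set as"]] by (simp add: w'_def)
  have bV: "w' b \<in> V" if "b \<in> set as" for b
    using sub[of "{b}"] that ne[OF that] by (simp add: w'_def)
  show ?case
    by (rule exI[of _ w']) (use sum eig eiga aV bV in auto)
qed

end

section \<open>Weight vectors\<close>

text \<open>
  The presentation of the cyclotomic algebra as congruences, over an arbitrary field of
  scalars. The \<open>r\<close>-th roots of unity are \<open>zt 1, \<dots>, zt r\<close>; the exponent \<open>r - s\<close> in \<open>e\<^sub>i\<close> stands for \<open>- s\<close>.
\<close>

locale yokonuma = ideal_mod J kap
  for J :: "'a::ring_1 set" and kap :: "'f::field \<Rightarrow> 'a" +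
  fixes x t g e :: "nat \<Rightarrow> 'a" and n r d :: nat and v zt :: "nat \<Rightarrow> 'f"
  assumes e_def: "e i = kap (1 / of_nat r) * (\<Sum>s\<in>{0..<r}. t i ^ s * t (i + 1) ^ (r - s))"
    and gg: "i \<in> {1..<n} \<Longrightarrow> g i * g i \<approx> 1"
    and g_far: "i \<in> {1..<n} \<Longrightarrow> j \<in> {1..<n} \<Longrightarrow> \<bar>int i - int j\<bar> \<ge> 2 \<Longrightarrow> g i * g j \<approx> g j * g i"
    and braid: "i \<in> {1..<n} \<Longrightarrow> i + 1 \<in> {1..<n} \<Longrightarrow> g i * g (i + 1) * g i \<approx> g (i + 1) * g i * g (i + 1)"
    and t_t: "i \<in> {1..n} \<Longrightarrow> j \<in> {1..n} \<Longrightarrow> t i * t j \<approx> t j * t i"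
    and g_t: "i \<in> {1..<n} \<Longrightarrow> j \<in> {1..n} \<Longrightarrow> g i * t j \<approx> t (Transposition.transpose i (i + 1) j) * g i"
    and t_r: "i \<in> {1..n} \<Longrightarrow> t i ^ r \<approx> 1"
    and x_x: "i \<in> {1..n} \<Longrightarrow> j \<in> {1..n} \<Longrightarrow> x i * x j \<approx> x j * x i"
    and g_x_Suc: "i \<in> {1..<n} \<Longrightarrow> g i * x (i + 1) \<approx> x i * g i + e i"
    and g_x: "i \<in> {1..<n} \<Longrightarrow> j \<in> {1..n} \<Longrightarrow> j \<noteq> i \<Longrightarrow> j \<noteq> i + 1 \<Longrightarrow> g i * x j \<approx> x j * g i"
    and t_x: "i \<in> {1..n} \<Longrightarrow> j \<in> {1..n} \<Longrightarrow> t j * x i \<approx> x i * t j"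
    and cyclotomic: "n \<ge> 1 \<Longrightarrow> pl (x 1) (map v [1..<Suc d]) \<approx> 0"
    and zt_r: "p \<in> {1..r} \<Longrightarrow> zt p ^ r = 1"
    and zt_inj: "inj_on zt {1..r}"
    and r_nonzero: "of_nat r \<noteq> (0::'f)"
begin

text \<open>
  A sequence \<open>s\<close> assigns to each index a pair of an eigenvalue of \<open>x\<^sub>j\<close> and the index of a root of
  unity, which is the eigenvalue of \<open>t\<^sub>j\<close>. All the \<open>t\<^sub>j\<close> are diagonalised at once, the \<open>x\<^sub>j\<close> one after
  the other.
\<close>

definition twt :: "(nat \<Rightarrow> 'f \<times> nat) \<Rightarrow> 'a \<Rightarrow> bool" where
  "twt s z \<longleftrightarrow> (\<forall>j\<in>{1..n}. snd (s j) \<in> {1..r} \<and> t j * z \<approx> kap (zt (snd (s j))) * z)"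

definition wt :: "nat \<Rightarrow> (nat \<Rightarrow> 'f \<times> nat) \<Rightarrow> 'a \<Rightarrow> bool" where
  "wt k s z \<longleftrightarrow> twt s z \<and> (\<forall>j\<in>{1..k}. x j * z \<approx> kap (fst (s j)) * z)"

abbreviation sw :: "nat \<Rightarrow> nat \<Rightarrow> nat" where
  "sw i \<equiv> Transposition.transpose i (Suc i)"

definition same :: "(nat \<Rightarrow> 'f \<times> nat) \<Rightarrow> nat \<Rightarrow> 'f" where
  "same s i = (if snd (s i) = snd (s (Suc i)) then 1 else 0)"

lemma eig_add: "y * z \<approx> kap c * z \<Longrightarrow> y * w \<approx> kap c * w \<Longrightarrow> y * (z + w) \<approx> kap c * (z + w)"
  by (simp add: distrib_left cg_add)

lemma eig_scale: "y * z \<approx> kap c * z \<Longrightarrow> y * (kap a * z) \<approx> kap c * (kap a * z)"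
proof -
  assume "y * z \<approx> kap c * z"
  from cg_left[OF this, of "kap a"] show ?thesis
    by (simp only: kap_left_commute[of y a] kap_kap mult.commute)
qed

lemma eig_commute: "y * u \<approx> u * y \<Longrightarrow> y * z \<approx> kap c * z \<Longrightarrow> y * (u * z) \<approx> kap c * (u * z)"
proof -
  assume a: "y * u \<approx> u * y" "y * z \<approx> kap c * z"
  have "y * (u * z) \<approx> u * (y * z)" using cg_right[OF a(1), of z] by (simp only: mult.assoc)
  also have "\<dots> \<approx> u * (kap c * z)" by (rule cg_left[OF a(2)])
  also have "\<dots> = kap c * (u * z)" by (rule kap_left_commute)
  finally show ?thesis .
qed

lemma eig_cong: "z \<approx> z' \<Longrightarrow> y * z \<approx> kap c * z \<Longrightarrow> y * z' \<approx> kap c * z'"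
  by (rule cg_trans[OF cg_trans[OF cg_sym[OF cg_left] _] cg_left])

lemma twt_add: "twt s z \<Longrightarrow> twt s w \<Longrightarrow> twt s (z + w)"
  by (auto simp: twt_def intro: eig_add)

lemma twt_scale: "twt s z \<Longrightarrow> twt s (kap a * z)"
  by (auto simp: twt_def intro: eig_scale)

lemma wt_add: "wt k s z \<Longrightarrow> wt k s w \<Longrightarrow> wt k s (z + w)"
  by (auto simp: wt_def intro: eig_add twt_add)

lemma wt_scale: "wt k s z \<Longrightarrow> wt k s (kap a * z)"
  by (auto simp: wt_def intro: eig_scale twt_scale)

lemma wt_cong: "z \<approx> z' \<Longrightarrow> wt k s z \<Longrightarrow> wt k s z'"
  by (auto simp: wt_def twt_def intro: eig_cong)

lemma wt_mono: "wt k s z \<Longrightarrow> l \<le> k \<Longrightarrow> wt l s z"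
  by (auto simp: wt_def)

lemma wt_x:
  assumes "wt k s z" "k \<le> n" "j \<in> {1..n}"
  shows "wt k s (x j * z)"
  unfolding wt_def twt_def
proof (intro conjI ballI)
  fix i assume i: "i \<in> {1..n}"
  show "snd (s i) \<in> {1..r}" using assms(1) i by (auto simp: wt_def twt_def)
  show "t i * (x j * z) \<approx> kap (zt (snd (s i))) * (x j * z)"
    using assms(1) i by (intro eig_commute t_x assms) (auto simp: wt_def twt_def)
next
  fix i assume i: "i \<in> {1..k}"
  then have "i \<in> {1..n}" using assms(2) by auto
  then show "x i * (x j * z) \<approx> kap (fst (s i)) * (x j * z)"
    using assms(1) i by (intro eig_commute x_x assms) (auto simp: wt_def)
qed

lemma wt_pl:
  assumes "wt k s z" "k \<le> n" "j \<in> {1..n}"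
  shows "wt k s (pl (x j) bs * z)"
proof (induction bs)
  case (Cons b bs)
  have "wt k s (x j * (pl (x j) bs * z) + kap (- b) * (pl (x j) bs * z))"
    using assms by (intro wt_add wt_scale wt_x Cons)
  then show ?case by (simp add: algebra_simps kap_minus)
qed (simp add: assms)

lemma sw_range: "i \<in> {1..<n} \<Longrightarrow> j \<in> {1..n} \<Longrightarrow> sw i j \<in> {1..n}"
  by (auto simp: Transposition.transpose_def)

lemma gen_kap:
  "g i * (kap a * z) = kap a * (g i * z)" "x i * (kap a * z) = kap a * (x i * z)"
  by (rule kap_left_commute)+

lemma twt_g:
  assumes "twt s z" "i \<in> {1..<n}"
  shows "twt (s \<circ> sw i) (g i * z)"
  unfolding twt_def o_def
proof (intro ballI conjI)
  fix j assume j: "j \<in> {1..n}"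
  note j' = sw_range[OF assms(2) j]
  show "snd (s (sw i j)) \<in> {1..r}" using assms(1) j' by (simp add: twt_def)
  have "t j * g i \<approx> g i * t (sw i j)"
    using cg_sym[OF g_t[OF assms(2) j']] by simp
  from cg_right[OF this, of z] have "t j * (g i * z) \<approx> g i * (t (sw i j) * z)"
    by (simp add: mult.assoc)
  also have "\<dots> \<approx> g i * (kap (zt (snd (s (sw i j)))) * z)"
    using assms(1) j' by (intro cg_left) (auto simp: twt_def)
  finally show "t j * (g i * z) \<approx> kap (zt (snd (s (sw i j)))) * (g i * z)"
    by (simp add: gen_kap)
qed

lemma pow_eig:
  assumes "y * z \<approx> kap c * z" shows "y ^ m * z \<approx> kap (c ^ m) * z"
proof (induction m)
  case (Suc m)
  have "y * (y ^ m * z) \<approx> y * (kap (c ^ m) * z)" by (rule cg_left[OF Suc])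
  also have "\<dots> \<approx> kap (c ^ m) * (kap c * z)"
    unfolding kap_left_commute[of y] by (rule cg_left[OF assms])
  finally show ?case by (simp add: kap_kap mult.assoc mult.commute)
qed simp

text \<open>
  The element \<open>e\<^sub>i\<close> projects onto the vectors on which \<open>t\<^sub>i\<close> and \<open>t\<^sub>i\<^sub>+\<^sub>1\<close> agree: its eigenvalue is a
  geometric sum of powers of a root of unity.
\<close>

lemma e_act:
  assumes "twt s z" "i \<in> {1..<n}"
  shows "e i * z \<approx> kap (same s i) * z"
proof -
  define a b where "a = zt (snd (s i))" and "b = zt (snd (s (Suc i)))"
  have pos: "snd (s i) \<in> {1..r}" "snd (s (Suc i)) \<in> {1..r}"
    using assms by (auto simp: twt_def)
  then have ab: "a ^ r = 1" "b ^ r = 1" by (auto simp: a_def b_def intro: zt_r)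
  have r: "r > 0" using r_nonzero by (cases r) auto
  have b0: "b \<noteq> 0" using ab r by (auto simp: zero_power)
  have eig: "t i * z \<approx> kap a * z" "t (Suc i) * z \<approx> kap b * z"
    using assms by (auto simp: twt_def a_def b_def)
  have "(\<Sum>s\<in>{0..<r}. t i ^ s * t (i + 1) ^ (r - s)) * z \<approx> kap (\<Sum>s\<in>{0..<r}. a ^ s * b ^ (r - s)) * z"
    unfolding sum_distrib_right kap_sum
  proof (rule cg_sum)
    fix m assume "m \<in> {0..<r}"
    have "t i ^ m * (t (Suc i) ^ (r - m) * z) \<approx> t i ^ m * (kap (b ^ (r - m)) * z)"
      by (rule cg_left[OF pow_eig[OF eig(2)]])
    also have "\<dots> \<approx> kap (b ^ (r - m)) * (kap (a ^ m) * z)"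
      unfolding kap_left_commute[of "t i ^ m"] by (rule cg_left[OF pow_eig[OF eig(1)]])
    finally show "t i ^ m * t (i + 1) ^ (r - m) * z \<approx> kap (a ^ m * b ^ (r - m)) * z"
      by (simp add: kap_kap mult.assoc mult.commute)
  qed
  also have "(\<Sum>s\<in>{0..<r}. a ^ s * b ^ (r - s)) = of_nat r * same s i"
  proof -
    have "(\<Sum>s\<in>{0..<r}. a ^ s * b ^ (r - s)) = (\<Sum>s<r. (a / b) ^ s)"
      using b0 ab by (auto intro!: sum.cong simp: lessThan_atLeast0 power_diff power_divide)
    moreover have "(a / b) ^ r = 1" using ab by (simp add: power_divide)
    moreover have "a = b \<longleftrightarrow> snd (s i) = snd (s (Suc i))"
      using inj_on_eq_iff[OF zt_inj pos] by (simp add: a_def b_def)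
    moreover have "(\<Sum>s<r. (a / b) ^ s) = of_nat r * same s i"
    proof (cases "a = b")
      case False
      then have "a / b \<noteq> 1" using b0 by simp
      then show ?thesis using False calculation by (simp add: same_def geometric_sum)
    qed (use calculation b0 in \<open>simp add: same_def\<close>)
    ultimately show ?thesis by simp
  qed
  finally have "(\<Sum>s\<in>{0..<r}. t i ^ s * t (i + 1) ^ (r - s)) * z \<approx> kap (of_nat r * same s i) * z" .
  from cg_left[OF this, of "kap (1 / of_nat r)"] show ?thesis
    unfolding e_def mult.assoc kap_kap using r_nonzero by simp
qed

lemma same_sw: "same (s \<circ> sw i) i = same s i"
  by (auto simp: same_def)

lemma gg_act: "i \<in> {1..<n} \<Longrightarrow> g i * (g i * z) \<approx> z"
  using cg_right[OF gg, of i z] by (simp add: mult.assoc)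

lemma g_cancel: "i \<in> {1..<n} \<Longrightarrow> g i * z \<approx> 0 \<Longrightarrow> z \<approx> 0"
  using cg_left[of "g i * z" 0 "g i"] cg_trans[OF cg_sym[OF gg_act[of i z]]] by simp

lemma g_x_act:
  assumes "twt s z" "i \<in> {1..<n}"
  shows "g i * (x (Suc i) * z) \<approx> x i * (g i * z) + kap (same s i) * z"
proof -
  have "g i * (x (Suc i) * z) \<approx> x i * (g i * z) + e i * z"
    using cg_right[OF g_x_Suc[OF assms(2)], of z] by (simp add: algebra_simps)
  also have "\<dots> \<approx> x i * (g i * z) + kap (same s i) * z"
    by (intro cg_add cg_refl e_act assms)
  finally show ?thesis .
qed

lemma x_g_act:
  assumes "twt s z" "i \<in> {1..<n}"
  shows "x (Suc i) * (g i * z) \<approx> g i * (x i * z) + kap (same s i) * z"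
proof -
  have "x (Suc i) * (g i * z) \<approx> g i * (g i * (x (Suc i) * (g i * z)))"
    by (rule cg_sym[OF gg_act[OF assms(2)]])
  also have "\<dots> \<approx> g i * (x i * (g i * (g i * z)) + kap (same s i) * (g i * z))"
    using cg_left[OF g_x_act[OF twt_g[OF assms] assms(2)]] by (simp add: same_sw)
  also have "\<dots> = g i * (x i * (g i * (g i * z))) + kap (same s i) * (g i * (g i * z))"
    by (simp add: distrib_left gen_kap)
  also have "\<dots> \<approx> g i * (x i * z) + kap (same s i) * z"
    by (intro cg_add cg_left gg_act assms)
  finally show ?thesis .
qed

lemma wt_g_far:
  assumes "wt k s z" "i \<in> {1..<n}" "j \<in> {1..k}" "k \<le> n" "j \<noteq> i" "j \<noteq> Suc i"
  shows "x j * (g i * z) \<approx> kap (fst (s j)) * (g i * z)"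
  using assms by (intro eig_commute cg_sym[OF g_x]) (auto simp: wt_def)

text \<open>Below \<open>i\<close> the element \<open>g\<^sub>i\<close> only exchanges the roots of unity.\<close>

lemma wt_g_below:
  assumes "wt k s z" "i \<in> {1..<n}" "k < i"
  shows "wt k (s \<circ> sw i) (g i * z)"
  unfolding wt_def
proof (intro conjI ballI)
  show "twt (s \<circ> sw i) (g i * z)" using assms by (intro twt_g) (auto simp: wt_def)
  fix j assume j: "j \<in> {1..k}"
  then have "x j * (g i * z) \<approx> kap (fst (s j)) * (g i * z)"
    using assms by (intro wt_g_far[of k]) auto
  then show "x j * (g i * z) \<approx> kap (fst ((s \<circ> sw i) j)) * (g i * z)"
    using j assms by (simp add: Transposition.transpose_def)
qed

text \<open>
  Intertwiners: since \<open>x\<^sub>i\<^sub>+\<^sub>1 g\<^sub>i = g\<^sub>i x\<^sub>i + e\<^sub>i\<close>, the element \<open>g\<^sub>i\<close> exchanges the eigenvalues of \<open>x\<^sub>i\<close> and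
  \<open>x\<^sub>i\<^sub>+\<^sub>1\<close> on a weight vector up to \<open>e\<^sub>i\<close>, which vanishes if the roots of unity differ. If they
  agree, \<open>e\<^sub>i\<close> is the identity and a scalar correction of \<open>g\<^sub>i\<close> absorbs it; the corrected element is
  invertible unless the two eigenvalues of \<open>x\<close> differ by \<open>\<plusminus> 1\<close>.
\<close>

lemma wt_swap_different_position:
  assumes "wt k s z" "k \<le> n" "Suc i \<le> k" "1 \<le> i" "snd (s i) \<noteq> snd (s (Suc i))"
  shows "wt k (s \<circ> sw i) (g i * z)"
  unfolding wt_def
proof (intro conjI ballI)
  have i: "i \<in> {1..<n}" using assms by auto
  have T: "twt s z" using assms by (simp add: wt_def)
  have d: "same s i = 0" using assms by (simp add: same_def)
  show "twt (s \<circ> sw i) (g i * z)" by (intro twt_g T i)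
  have xi: "x i * z \<approx> kap (fst (s i)) * z" "x (Suc i) * z \<approx> kap (fst (s (Suc i))) * z"
    using assms i by (auto simp: wt_def)
  fix j assume j: "j \<in> {1..k}"
  consider "j = i" | "j = Suc i" | "j \<noteq> i" "j \<noteq> Suc i" by blast
  then show "x j * (g i * z) \<approx> kap (fst ((s \<circ> sw i) j)) * (g i * z)"
  proof cases
    case 1
    show ?thesis
      using cg_trans[OF cg_sym[OF g_x_act[OF T i, unfolded d, simplified]] cg_left[OF xi(2)]] 1
      by (simp add: gen_kap)
  next
    case 2
    show ?thesis
      using cg_trans[OF x_g_act[OF T i, unfolded d, simplified] cg_left[OF xi(1)]] 2
      by (simp add: gen_kap)
  next
    case 3
    then show ?thesis using wt_g_far[OF assms(1) i j assms(2)] by (simp add: Transposition.transpose_def)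
  qed
qed

lemma wt_swap_same_position:
  assumes "wt k s z" "k \<le> n" "Suc i \<le> k" "1 \<le> i" "snd (s i) = snd (s (Suc i))"
    and ne: "fst (s i) \<noteq> fst (s (Suc i))"
  defines "\<beta> \<equiv> 1 / (fst (s i) - fst (s (Suc i)))"
  shows "wt k (s \<circ> sw i) (g i * z + kap \<beta> * z)"
    and "g i * (g i * z + kap \<beta> * z) - kap \<beta> * (g i * z + kap \<beta> * z) \<approx> kap (1 - \<beta>\<^sup>2) * z"
proof -
  have i: "i \<in> {1..<n}" using assms by auto
  have T: "twt s z" using assms by (simp add: wt_def)
  have d: "same s i = 1" using assms by (simp add: same_def)
  let ?c = "fst (s i)" and ?c' = "fst (s (Suc i))"
  have xi: "x i * z \<approx> kap ?c * z" "x (Suc i) * z \<approx> kap ?c' * z"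
    using assms i by (auto simp: wt_def)
  have beta: "\<beta> * ?c = 1 + \<beta> * ?c'" using ne by (simp add: \<beta>_def field_simps)
  have "snd ((s \<circ> sw i) j) = snd (s j)" for j
    using assms(5) by (simp add: Transposition.transpose_def)
  then have T': "twt (s \<circ> sw i) z" using T by (simp add: twt_def)
  show "wt k (s \<circ> sw i) (g i * z + kap \<beta> * z)"
    unfolding wt_def
  proof (intro conjI ballI)
    show "twt (s \<circ> sw i) (g i * z + kap \<beta> * z)" by (intro twt_add twt_g twt_scale T T' i)
    fix j assume j: "j \<in> {1..k}"
    consider "j = i" | "j = Suc i" | "j \<noteq> i" "j \<noteq> Suc i" by blast
    then show "x j * (g i * z + kap \<beta> * z) \<approx> kap (fst ((s \<circ> sw i) j)) * (g i * z + kap \<beta> * z)"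
    proof cases
      case 1
      have "x i * (g i * z) + kap 1 * z \<approx> g i * (x (Suc i) * z)"
        using cg_sym[OF g_x_act[OF T i]] d by simp
      also have "\<dots> \<approx> kap ?c' * (g i * z)"
        using cg_left[OF xi(2), of "g i"] by (simp add: gen_kap)
      finally have *: "x i * (g i * z) \<approx> kap ?c' * (g i * z) - z"
        using cg_diff[of "x i * (g i * z) + kap 1 * z" _ z z] by simp
      have "x i * (g i * z + kap \<beta> * z) \<approx> (kap ?c' * (g i * z) - z) + kap \<beta> * (kap ?c * z)"
        unfolding distrib_left kap_left_commute[of "x i"] by (intro cg_add * cg_left xi)
      also have "\<dots> = kap ?c' * (g i * z + kap \<beta> * z)"
        using beta by (simp add: kap_kap kap_add algebra_simps)
      finally show ?thesis using 1 by simp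
    next
      case 2
      have "x (Suc i) * (g i * z) \<approx> g i * (x i * z) + z"
        using x_g_act[OF T i] d by simp
      also have "\<dots> \<approx> kap ?c * (g i * z) + z"
        using cg_left[OF xi(1), of "g i"] by (intro cg_add cg_refl) (simp add: gen_kap)
      finally have *: "x (Suc i) * (g i * z) \<approx> kap ?c * (g i * z) + z" .
      have "x (Suc i) * (g i * z + kap \<beta> * z) \<approx> (kap ?c * (g i * z) + z) + kap \<beta> * (kap ?c' * z)"
        unfolding distrib_left kap_left_commute[of "x (Suc i)"] by (intro cg_add * cg_left xi)
      also have "\<dots> = kap ?c * (g i * z + kap \<beta> * z)"
        using beta by (simp add: kap_kap kap_add algebra_simps)
      finally show ?thesis using 2 by simp
    next
      case 3
      then show ?thesis
        using eig_add[OF wt_g_far[OF assms(1) i j assms(2)] eig_scale] assms(1) j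
        by (simp add: Transposition.transpose_def wt_def)
    qed
  qed
  have "g i * (g i * z + kap \<beta> * z) - kap \<beta> * (g i * z + kap \<beta> * z) = g i * (g i * z) - kap (\<beta>\<^sup>2) * z"
    by (simp add: distrib_left gen_kap kap_kap power2_eq_square)
  also have "\<dots> \<approx> z - kap (\<beta>\<^sup>2) * z" by (intro cg_diff gg_act i cg_refl)
  finally show "g i * (g i * z + kap \<beta> * z) - kap \<beta> * (g i * z + kap \<beta> * z) \<approx> kap (1 - \<beta>\<^sup>2) * z"
    by (simp add: algebra_simps kap_diff)
qed

text \<open>
  Two equal neighbours would make \<open>x\<^sub>i\<close> act on \<open>z\<close> and \<open>g\<^sub>i z\<close> by a Jordan block, whereas a polynomial
  in \<open>x\<^sub>i\<close> with distinct roots kills \<open>g\<^sub>i z\<close>.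
\<close>

lemma wt_equal_neighbours:
  assumes "wt k s z" "k \<le> n" "Suc i \<le> k" "1 \<le> i" "s i = s (Suc i)"
    and "distinct as" "pl (x i) as * (g i * z) \<approx> 0"
  shows "z \<approx> 0"
proof -
  have i: "i \<in> {1..<n}" using assms by auto
  have T: "twt s z" using assms by (simp add: wt_def)
  have d: "same s i = 1" using assms by (simp add: same_def)
  define c where "c = fst (s i)"
  have xi: "x i * z \<approx> kap c * z" "x (Suc i) * z \<approx> kap c * z"
    using assms(1,3,4) unfolding c_def by (auto simp: wt_def) (simp add: assms(5))
  have "x i * (g i * z) + z \<approx> g i * (x (Suc i) * z)"
    using cg_sym[OF g_x_act[OF T i]] d by simp
  also have "\<dots> \<approx> kap c * (g i * z)"
    using cg_left[OF xi(2), of "g i"] by (simp add: gen_kap)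
  finally have "x i * (g i * z) + z - (kap c * (g i * z) + z) \<approx> kap c * (g i * z) - (kap c * (g i * z) + z)"
    by (rule cg_diff) simp
  then have *: "(x i - kap c) * (g i * z) \<approx> - z" by (simp add: algebra_simps)
  let ?bs = "removeAll c as"
  have "0 \<approx> pl (x i) ?bs * ((x i - kap c) * (g i * z))"
    by (rule cg_sym[OF pl_removeAll[OF assms(6,7)]])
  also have "\<dots> \<approx> - (pl (x i) ?bs * z)" using cg_left[OF *, of "pl (x i) ?bs"] by simp
  finally have "pl (x i) ?bs * z \<approx> 0" using cg_minus[of 0 "- (pl (x i) ?bs * z)"] by (simp add: cg_sym)
  then have "kap (pv c ?bs) * z \<approx> 0"
    by (rule cg_trans[OF cg_sym[OF pl_eig[OF xi(1)]]])
  then show ?thesis using kap_cancel[of "pv c ?bs" z] pv_nonzero[of c ?bs] by simp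
qed

text \<open>
  In the situation \<open>a, a \<plusminus> 1, a\<close> both intertwiners vanish, so that \<open>g\<^sub>i\<close> and \<open>g\<^sub>i\<^sub>+\<^sub>1\<close> act by opposite
  signs, against the braid relation.
\<close>

lemma braid_signs:
  assumes "i \<in> {1..<n}" "Suc i \<in> {1..<n}" "(2::'f) \<noteq> 0" "b * b = 1"
    and "g i * z + kap b * z \<approx> 0" "g (Suc i) * z - kap b * z \<approx> 0"
  shows "z \<approx> 0"
proof -
  have 1: "g i * z \<approx> kap (- b) * z"
    using cg_diff[OF assms(5) cg_refl[of "kap b * z"]] by (simp add: kap_minus)
  have 2: "g (Suc i) * z \<approx> kap b * z"
    using assms(6) by (simp add: cg_zero_iff)
  have step: "g j * (kap a * z) \<approx> kap (a * c) * z" if "g j * z \<approx> kap c * z" for j a c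
    using cg_left[OF that, of "kap a"] by (simp add: gen_kap kap_kap)
  have "g i * (g (Suc i) * (g i * z)) \<approx> g i * (g (Suc i) * (kap (- b) * z))"
    by (intro cg_left 1)
  also have "\<dots> \<approx> g i * (kap (- b * b) * z)" by (intro cg_left step 2)
  also have "\<dots> \<approx> kap (- b * b * - b) * z" by (intro step 1)
  finally have A: "g i * (g (Suc i) * (g i * z)) \<approx> kap (- b * b * - b) * z" .
  have "g (Suc i) * (g i * (g (Suc i) * z)) \<approx> g (Suc i) * (g i * (kap b * z))"
    by (intro cg_left 2)
  also have "\<dots> \<approx> g (Suc i) * (kap (b * - b) * z)" by (intro cg_left step 1)
  also have "\<dots> \<approx> kap (b * - b * b) * z" by (intro step 2)
  finally have B: "g (Suc i) * (g i * (g (Suc i) * z)) \<approx> kap (b * - b * b) * z" .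
  have "kap (- b * b * - b) * z \<approx> kap (b * - b * b) * z"
  proof -
    have "g i * (g (Suc i) * (g i * z)) \<approx> g (Suc i) * (g i * (g (Suc i) * z))"
      using cg_right[OF braid[of i], of z] assms(1,2) by (simp add: mult.assoc)
    from cg_trans[OF cg_trans[OF cg_sym[OF A] this] B] show ?thesis .
  qed
  moreover have "- b * b * - b = b" "b * - b * b = - b"
    using assms(4) by (simp_all add: mult.assoc)
  ultimately have "kap b * z \<approx> kap (- b) * z" by (simp only:)
  then have "kap b * z \<approx> - (kap b * z)" by (simp only: kap_minus mult_minus_left)
  from cg_add[OF this cg_refl[of "kap b * z"]]
  have "kap b * z + kap b * z \<approx> 0" by simp
  then have "kap b * z \<approx> 0" by (rule two_cancel[OF assms(3)])
  then show ?thesis using assms(4) by (intro kap_cancel[of b z]) auto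
qed

text \<open>
  For \<open>x\<^sub>i z = c z\<close> one has \<open>g\<^sub>i f(x\<^sub>i\<^sub>+\<^sub>1) z = f(x\<^sub>i) g\<^sub>i z + D f(x\<^sub>i\<^sub>+\<^sub>1, c) z\<close> with the divided
  difference \<open>D f\<close>. The last term is recorded only as a vector in the \<open>c\<close>-eigenspace of \<open>x\<^sub>i\<close>.
\<close>

lemma g_pl_act:
  assumes "wt i s z" "i \<in> {1..<n}" "same s i = 1"
  shows "\<exists>q. g i * (pl (x (Suc i)) as * z) \<approx> pl (x i) as * (g i * z) + q \<and> x i * q \<approx> kap (fst (s i)) * q"
proof (induction as)
  case Nil
  show ?case by (rule exI[of _ 0]) simp
next
  case (Cons a as)
  let ?c = "fst (s i)"
  let ?w = "pl (x (Suc i)) as * z"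
  have wtpl: "wt i s (pl (x (Suc i)) bs * z)" for bs
    using assms(2) by (intro wt_pl[OF assms(1)]) auto
  have i1: "1 \<le> i" using assms by auto
  obtain q where q: "g i * ?w \<approx> pl (x i) as * (g i * z) + q" "x i * q \<approx> kap ?c * q"
    using Cons by blast
  have "g i * (x (Suc i) * ?w) \<approx> x i * (g i * ?w) + ?w"
    using g_x_act[of s ?w i] wtpl[of as] assms by (simp add: wt_def)
  from cg_diff[OF this cg_refl[of "kap a * (g i * ?w)"]]
  have "g i * (pl (x (Suc i)) (a # as) * z) \<approx> (x i - kap a) * (g i * ?w) + ?w"
    by (simp add: algebra_simps gen_kap)
  also have "\<dots> \<approx> (x i - kap a) * (pl (x i) as * (g i * z) + q) + ?w"
    by (intro cg_add cg_left q cg_refl)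
  also have "\<dots> = pl (x i) (a # as) * (g i * z) + ((x i - kap a) * q + ?w)"
    by (simp add: distrib_left mult.assoc)
  finally have "g i * (pl (x (Suc i)) (a # as) * z) \<approx> pl (x i) (a # as) * (g i * z) + ((x i - kap a) * q + ?w)" .
  moreover have "x i * ((x i - kap a) * q + ?w) \<approx> kap ?c * ((x i - kap a) * q + ?w)"
  proof (rule eig_add[OF eig_commute[OF _ q(2)]])
    show "x i * (x i - kap a) \<approx> (x i - kap a) * x i" by (simp add: algebra_simps kap_central)
    show "x i * ?w \<approx> kap ?c * ?w" using wtpl[of as] i1 by (auto simp: wt_def)
  qed
  ultimately show ?case by blast
qed

text \<open>
  With \<open>f\<close> the polynomial whose roots are those of \<open>as\<close> except \<open>c\<close>, put \<open>w = f(x\<^sub>i\<^sub>+\<^sub>1) z\<close>. By the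
  previous lemma \<open>g\<^sub>i w\<close> lies in the \<open>c\<close>-eigenspace of \<open>x\<^sub>i\<close>. Hence \<open>(x\<^sub>i\<^sub>+\<^sub>1 - c) w = g\<^sub>i w\<close> and
  \<open>(x\<^sub>i\<^sub>+\<^sub>1 - c) g\<^sub>i w = w\<close>, so \<open>(x\<^sub>i\<^sub>+\<^sub>1 - c)\<^sup>2 - 1\<close> kills \<open>w\<close>.
\<close>

lemma kills_next_same_position:
  assumes "wt i s z" "i \<in> {1..<n}" "same s i = 1" "distinct as"
    and "pl (x i) as * (g i * z) \<approx> 0"
  defines "c \<equiv> fst (s i)"
  shows "pl (x (Suc i)) ((c + 1) # (c - 1) # removeAll c as) * z \<approx> 0"
proof -
  let ?bs = "removeAll c as"
  let ?w = "pl (x (Suc i)) ?bs * z"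
  let ?y = "x (Suc i)"
  have wtpl: "wt i s (pl ?y bs * z)" for bs
    using assms(2) by (intro wt_pl[OF assms(1)]) auto
  have T: "twt s ?w" using wtpl by (auto simp: wt_def)
  obtain q where q: "g i * ?w \<approx> pl (x i) ?bs * (g i * z) + q" "x i * q \<approx> kap c * q"
    using g_pl_act[OF assms(1-3), of ?bs] by (auto simp: c_def)
  have "(x i - kap c) * (g i * ?w) \<approx> (x i - kap c) * (pl (x i) ?bs * (g i * z) + q)"
    by (intro cg_left q)
  also have "\<dots> = pl (x i) ?bs * ((x i - kap c) * (g i * z)) + (x i - kap c) * q"
    by (simp add: distrib_left pl_commute_self mult.assoc[symmetric])
  also have "\<dots> \<approx> 0 + kap 0 * q"
    using eig_diff[OF q(2), of c] by (intro cg_add pl_removeAll assms) auto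
  finally have k: "(x i - kap c) * (g i * ?w) \<approx> 0" by simp
  have gx: "g i * (?y * ?w) \<approx> x i * (g i * ?w) + ?w"
    using g_x_act[OF T assms(2)] assms(3) by simp
  have xg: "?y * (g i * ?w) \<approx> g i * (x i * ?w) + ?w"
    using x_g_act[OF T assms(2)] assms(3) by simp
  have "g i * ((?y - kap c) * ?w) = g i * (?y * ?w) - kap c * (g i * ?w)"
    by (simp add: algebra_simps gen_kap)
  also have "\<dots> \<approx> (x i * (g i * ?w) + ?w) - kap c * (g i * ?w)" by (intro cg_diff gx cg_refl)
  also have "\<dots> = (x i - kap c) * (g i * ?w) + ?w" by (simp add: algebra_simps)
  also have "\<dots> \<approx> 0 + ?w" by (intro cg_add k cg_refl)
  finally have 1: "g i * ((?y - kap c) * ?w) \<approx> ?w" by simp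
  from cg_left[OF this, of "g i"] have 2: "(?y - kap c) * ?w \<approx> g i * ?w"
    by (rule cg_trans[OF cg_sym[OF gg_act[OF assms(2)]]])
  have "(?y - kap c) * ((?y - kap c) * ?w) \<approx> (?y - kap c) * (g i * ?w)"
    by (rule cg_left[OF 2])
  also have "\<dots> = ?y * (g i * ?w) - kap c * (g i * ?w)" by (simp add: algebra_simps)
  also have "\<dots> \<approx> (g i * (x i * ?w) + ?w) - kap c * (g i * ?w)" by (intro cg_diff xg cg_refl)
  also have "\<dots> \<approx> (g i * (kap c * ?w) + ?w) - kap c * (g i * ?w)"
    using wtpl[of ?bs] assms(2)
    by (intro cg_diff cg_add cg_left cg_refl) (auto simp: wt_def c_def)
  also have "\<dots> = ?w" by (simp add: gen_kap)
  finally have sq: "(?y - kap c) * ((?y - kap c) * ?w) - ?w \<approx> 0" by (simp add: cg_zero_iff)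
  have "pl ?y ((c + 1) # (c - 1) # ?bs) * z = (?y - kap (c + 1)) * ((?y - kap (c - 1)) * ?w)"
    by (simp add: mult.assoc)
  also have "\<dots> = (?y - kap c) * ((?y - kap c) * ?w) - ?w"
    by (simp add: kap_add kap_diff algebra_simps)
  finally show ?thesis using sq by simp
qed

text \<open>Here \<open>e\<^sub>i\<close> vanishes, and \<open>g\<^sub>i f(x\<^sub>i\<^sub>+\<^sub>1) z = f(x\<^sub>i) g\<^sub>i z\<close>.\<close>

lemma kills_next_different_position:
  assumes "wt i s z" "i \<in> {1..<n}" "same s i = 0"
    and "pl (x i) as * (g i * z) \<approx> 0"
  shows "pl (x (Suc i)) as * z \<approx> 0"
proof -
  let ?y = "x (Suc i)"
  have T: "twt s (pl ?y bs * z)" for bs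
    using wt_pl[OF assms(1), of "Suc i" bs] assms(2) by (auto simp: wt_def)
  have "g i * (pl ?y as * z) \<approx> pl (x i) as * (g i * z)"
  proof (induction as)
    case (Cons a as)
    let ?w = "pl ?y as * z"
    have "g i * (?y * ?w) \<approx> x i * (g i * ?w)"
      using g_x_act[OF T assms(2)] assms(3) by simp
    from cg_diff[OF this cg_refl[of "kap a * (g i * ?w)"]]
    have "g i * (pl ?y (a # as) * z) \<approx> (x i - kap a) * (g i * ?w)"
      by (simp add: algebra_simps gen_kap)
    also have "\<dots> \<approx> (x i - kap a) * (pl (x i) as * (g i * z))" by (intro cg_left Cons)
    finally show ?case by (simp add: mult.assoc)
  qed simp
  from cg_trans[OF this assms(4)] have "g i * (pl ?y as * z) \<approx> 0" .
  then show ?thesis by (rule g_cancel[OF assms(2)])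
qed

end

section \<open>Shapes\<close>

text \<open>
  A multipartition is replaced by its diagram, and a standard tableau by the sequence in which
  the nodes are added; every initial segment is then a shape again.
\<close>

definition shape :: "nat \<Rightarrow> nat \<Rightarrow> node set \<Rightarrow> bool" where
  "shape r d D \<longleftrightarrow> finite D \<and>
     (\<forall>x y p l. ((x, y), p, l) \<in> D \<longrightarrow>
        1 \<le> x \<and> 1 \<le> y \<and> p \<in> {1..r} \<and> l \<in> {1..d} \<and>
        (\<forall>x'\<in>{1..x}. \<forall>y'\<in>{1..y}. ((x', y'), p, l) \<in> D))"

definition growth :: "nat \<Rightarrow> nat \<Rightarrow> nat \<Rightarrow> (nat \<Rightarrow> node) \<Rightarrow> bool" where
  "growth r d k \<theta> \<longleftrightarrow> inj_on \<theta> {1..k} \<and> (\<forall>j\<le>k. shape r d (\<theta> ` {1..j}))"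

definition addable :: "nat \<Rightarrow> nat \<Rightarrow> node set \<Rightarrow> nat \<Rightarrow> node set" where
  "addable r d D p = {\<nu>. \<nu> \<notin> D \<and> shape r d (insert \<nu> D) \<and> node_pr \<nu> = p}"

definition row :: "node set \<Rightarrow> nat \<Rightarrow> nat \<Rightarrow> nat \<Rightarrow> nat" where
  "row D p l x = card {y. ((x, y), p, l) \<in> D}"

definition col :: "node set \<Rightarrow> nat \<Rightarrow> nat \<Rightarrow> nat \<Rightarrow> nat" where
  "col D p l y = card {x. ((x, y), p, l) \<in> D}"

definition diagonal :: "node \<Rightarrow> int" where
  "diagonal = (\<lambda>((x, y), p, l). int y - int x)"

lemma node_simps [simp]:
  "node_pr ((x, y), p, l) = p" "node_pd ((x, y), p, l) = l"
  "diagonal ((x, y), p, l) = int y - int x"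
  by (simp_all add: node_pr_def node_pd_def diagonal_def)

lemma node_content_diagonal: "node_content v \<theta> = of_int (diagonal \<theta>) + v (node_pd \<theta>)"
  by (cases \<theta>) (auto simp: node_content_def)

lemma shapeD:
  assumes "shape r d D" "((x, y), p, l) \<in> D"
  shows "1 \<le> x" "1 \<le> y" "p \<in> {1..r}" "l \<in> {1..d}"
    and "1 \<le> x' \<Longrightarrow> x' \<le> x \<Longrightarrow> 1 \<le> y' \<Longrightarrow> y' \<le> y \<Longrightarrow> ((x', y'), p, l) \<in> D"
proof -
  have *: "1 \<le> x \<and> 1 \<le> y \<and> p \<in> {1..r} \<and> l \<in> {1..d} \<and> (\<forall>x'\<in>{1..x}. \<forall>y'\<in>{1..y}. ((x', y'), p, l) \<in> D)"
    using assms unfolding shape_def by blast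
  then show "1 \<le> x" "1 \<le> y" "p \<in> {1..r}" "l \<in> {1..d}" by simp_all
  show "((x', y'), p, l) \<in> D" if "1 \<le> x'" "x' \<le> x" "1 \<le> y'" "y' \<le> y"
    using * that by simp
qed

lemma shape_node:
  assumes "shape r d D" "\<theta> \<in> D"
  shows "node_pr \<theta> \<in> {1..r}" "node_pd \<theta> \<in> {1..d}"
proof -
  obtain x y p l where "\<theta> = ((x, y), p, l)" by (metis surj_pair)
  then show "node_pr \<theta> \<in> {1..r}" "node_pd \<theta> \<in> {1..d}"
    using shapeD(3,4)[OF assms(1), of x y p l] assms(2) by auto
qed

lemma shape_finite: "shape r d D \<Longrightarrow> finite D"
  by (simp add: shape_def)

lemma shape_empty [simp]: "shape r d {}"
  by (simp add: shape_def)

lemma initial_segment: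
  assumes "finite A" "\<And>a b. a \<in> A \<Longrightarrow> 1 \<le> b \<Longrightarrow> b \<le> a \<Longrightarrow> b \<in> A" "\<And>a. a \<in> A \<Longrightarrow> (1::nat) \<le> a"
  shows "A = {1..card A}"
proof (cases "A = {}")
  case False
  have "A = {1..Max A}"
  proof (intro equalityI subsetI)
    fix b assume "b \<in> {1..Max A}"
    then show "b \<in> A" using assms(2)[OF Max_in[OF assms(1) False]] by auto
  next
    fix b assume "b \<in> A"
    then show "b \<in> {1..Max A}" using assms(1,3) by simp
  qed
  moreover from arg_cong[OF this, of card] have "card A = Max A" by simp
  ultimately show ?thesis by simp
qed simp

lemma row_set:
  assumes "shape r d D" shows "{y. ((x, y), p, l) \<in> D} = {1..row D p l x}"
  unfolding row_def
proof (rule initial_segment)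
  have "{y. ((x, y), p, l) \<in> D} \<subseteq> (\<lambda>\<theta>. snd (fst \<theta>)) ` D" by force
  then show "finite {y. ((x, y), p, l) \<in> D}"
    using shape_finite[OF assms] finite_surj by blast
next
  fix a b assume a: "a \<in> {y. ((x, y), p, l) \<in> D}" "1 \<le> b" "b \<le> a"
  then show "b \<in> {y. ((x, y), p, l) \<in> D}"
    using shapeD(1)[OF assms, of x a p l] shapeD(5)[OF assms, of x a p l x b] by auto
qed (use shapeD(2)[OF assms] in blast)

lemma col_set:
  assumes "shape r d D" shows "{x. ((x, y), p, l) \<in> D} = {1..col D p l y}"
  unfolding col_def
proof (rule initial_segment)
  have "{x. ((x, y), p, l) \<in> D} \<subseteq> (\<lambda>\<theta>. fst (fst \<theta>)) ` D" by force
  then show "finite {x. ((x, y), p, l) \<in> D}"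
    using shape_finite[OF assms] finite_surj by blast
next
  fix a b assume a: "a \<in> {x. ((x, y), p, l) \<in> D}" "1 \<le> b" "b \<le> a"
  then show "b \<in> {x. ((x, y), p, l) \<in> D}"
    using shapeD(2)[OF assms, of a y p l] shapeD(5)[OF assms, of a y p l b y] by auto
qed (use shapeD(1)[OF assms] in blast)

lemma mem_row: "shape r d D \<Longrightarrow> ((x, y), p, l) \<in> D \<longleftrightarrow> 1 \<le> y \<and> y \<le> row D p l x"
  using eqset_imp_iff[OF row_set[of r d D x p l], of y] by simp

lemma mem_col: "shape r d D \<Longrightarrow> ((x, y), p, l) \<in> D \<longleftrightarrow> 1 \<le> x \<and> x \<le> col D p l y"
  using eqset_imp_iff[OF col_set[of r d D y p l], of x] by simp

definition comp_size :: "node set \<Rightarrow> nat \<Rightarrow> nat \<Rightarrow> nat" where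
  "comp_size D p l = card {\<theta>\<in>D. node_pr \<theta> = p \<and> node_pd \<theta> = l}"

lemma comp_size_add: "finite D \<Longrightarrow> l \<noteq> l' \<Longrightarrow> comp_size D p l + comp_size D p l' \<le> card D"
  unfolding comp_size_def by (subst card_Un_disjoint[symmetric]) (auto intro!: card_mono)

lemma comp_size_le: "finite D \<Longrightarrow> comp_size D p l \<le> card D"
  unfolding comp_size_def by (auto intro!: card_mono)

text \<open>
  The left side counts the nodes of a hook, which lies in one component. This and the next
  bounds show that all differences of contents that matter lie in the range of the
  semisimplicity condition.
\<close>

lemma hook_le_comp_size:
  assumes S: "shape r d D" and "((x, y), p, l) \<in> D"
  shows "row D p l x + col D p l y + 1 \<le> comp_size D p l + x + y"
proof -
  let ?A = "(\<lambda>b. ((x, b), p, l)) ` {y..row D p l x}" and ?B = "(\<lambda>a. ((a, y), p, l)) ` {x<..col D p l y}"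
  have xy: "1 \<le> x" "1 \<le> y" "x \<le> col D p l y" "y \<le> row D p l x"
    using assms mem_row[OF S] mem_col[OF S] shapeD(1,2)[OF assms] by auto
  have "card ?A + card ?B = card (?A \<union> ?B)" by (rule card_Un_disjoint[symmetric]) auto
  also have "\<dots> \<le> comp_size D p l"
    unfolding comp_size_def
  proof (rule card_mono)
    show "?A \<union> ?B \<subseteq> {\<theta> \<in> D. node_pr \<theta> = p \<and> node_pd \<theta> = l}"
    proof (intro Un_least)
      show "?A \<subseteq> {\<theta> \<in> D. node_pr \<theta> = p \<and> node_pd \<theta> = l}"
        using xy by (auto simp: mem_row[OF S])
      show "?B \<subseteq> {\<theta> \<in> D. node_pr \<theta> = p \<and> node_pd \<theta> = l}"
        using xy by (auto simp: mem_col[OF S])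
    qed
  qed (use shape_finite[OF S] in auto)
  finally have "card {y..row D p l x} + card {x<..col D p l y} \<le> comp_size D p l"
    by (simp add: card_image inj_on_def)
  then show "row D p l x + col D p l y + 1 \<le> comp_size D p l + x + y" using xy by simp
qed

lemma corner_le_comp_size:
  assumes S: "shape r d D" shows "row D p l 1 + col D p l 1 \<le> comp_size D p l + 1"
    and "row D p l 1 \<le> comp_size D p l" "col D p l 1 \<le> comp_size D p l"
proof -
  have 0: "row D p l 1 = 0 \<and> col D p l 1 = 0 \<or> ((1, 1), p, l) \<in> D"
    using mem_row[OF S, of 1 1 p l] mem_col[OF S, of 1 1 p l] by auto
  then show A: "row D p l 1 + col D p l 1 \<le> comp_size D p l + 1"
    using hook_le_comp_size[OF S, of 1 1 p l] by auto
  have "1 \<le> row D p l 1" "1 \<le> col D p l 1" if "((1, 1), p, l) \<in> D"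
    using that mem_row[OF S, of 1 1 p l] mem_col[OF S, of 1 1 p l] by auto
  then show "row D p l 1 \<le> comp_size D p l" "col D p l 1 \<le> comp_size D p l"
    using 0 A by auto
qed

lemma diagonal_bounds:
  assumes S: "shape r d D" and "\<theta> \<in> D"
  shows "diagonal \<theta> < int (row D (node_pr \<theta>) (node_pd \<theta>) 1)"
    "- int (col D (node_pr \<theta>) (node_pd \<theta>) 1) < diagonal \<theta>"
proof -
  obtain x y p l where \<theta>: "\<theta> = ((x, y), p, l)" by (metis surj_pair)
  note D = assms(2)[unfolded \<theta>]
  have "((1, y), p, l) \<in> D" "((x, 1), p, l) \<in> D"
    using shapeD(5)[OF S D, of 1 y] shapeD(5)[OF S D, of x 1] shapeD(1,2)[OF S D] by auto
  then show "diagonal \<theta> < int (row D (node_pr \<theta>) (node_pd \<theta>) 1)"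
    "- int (col D (node_pr \<theta>) (node_pd \<theta>) 1) < diagonal \<theta>"
    using mem_row[OF S, of 1 y p l] mem_col[OF S, of x 1 p l] shapeD(1,2)[OF S D] by (simp_all add: \<theta>)
qed

lemma shape_insert:
  assumes S: "shape r d D" and "1 \<le> x" "1 \<le> y" "p \<in> {1..r}" "l \<in> {1..d}"
    and left: "y = 1 \<or> ((x, y - 1), p, l) \<in> D" and up: "x = 1 \<or> ((x - 1, y), p, l) \<in> D"
  shows "shape r d (insert ((x, y), p, l) D)"
  unfolding shape_def
proof (intro conjI allI impI ballI)
  show "finite (insert ((x, y), p, l) D)" using shape_finite[OF S] by simp
  fix x1 y1 p1 l1 assume a: "((x1, y1), p1, l1) \<in> insert ((x, y), p, l) D"
  then show "1 \<le> x1" "1 \<le> y1" "p1 \<in> {1..r}" "l1 \<in> {1..d}"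
    using assms(2-5) shapeD(1-4)[OF S, of x1 y1 p1 l1] by auto
  fix x' y' assume b: "x' \<in> {1..x1}" "y' \<in> {1..y1}"
  show "((x', y'), p1, l1) \<in> insert ((x, y), p, l) D"
  proof (cases "((x1, y1), p1, l1) \<in> D")
    case True
    then show ?thesis using shapeD(5)[OF S True, of x' y'] b by auto
  next
    case False
    then have e: "x1 = x" "y1 = y" "p1 = p" "l1 = l" using a by auto
    consider "x' = x" "y' = y" | "x' = x" "y' < y" | "x' < x" using b e by fastforce
    then show ?thesis
    proof cases
      case 2
      then show ?thesis using left b e shapeD(5)[OF S, of x "y - 1" p l x' y'] by auto
    next
      case 3
      then show ?thesis using up b e shapeD(5)[OF S, of "x - 1" y p l x' y'] by auto
    qed (simp add: e)
  qed
qed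

lemma addableD:
  assumes S: "shape r d D" and "\<nu> \<in> addable r d D p"
  obtains x y l where "\<nu> = ((x, y), p, l)" "1 \<le> x" "1 \<le> y" "p \<in> {1..r}" "l \<in> {1..d}"
    "((x, y), p, l) \<notin> D"
    "\<And>x' y'. 1 \<le> x' \<Longrightarrow> x' \<le> x \<Longrightarrow> 1 \<le> y' \<Longrightarrow> y' \<le> y \<Longrightarrow> (x', y') \<noteq> (x, y) \<Longrightarrow> ((x', y'), p, l) \<in> D"
proof -
  obtain x y p' l where \<nu>: "\<nu> = ((x, y), p', l)" by (metis surj_pair)
  have p: "p' = p" and S': "shape r d (insert ((x, y), p, l) D)" and "((x, y), p, l) \<notin> D"
    using assms(2) by (auto simp: addable_def \<nu>)
  have i: "((x, y), p, l) \<in> insert ((x, y), p, l) D" by simp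
  show ?thesis
    by (rule that[of x y l])
      (use \<nu> p shapeD[OF S' i] \<open>((x, y), p, l) \<notin> D\<close> in auto)
qed

lemma addable_row_col:
  assumes S: "shape r d D" and "((x, y), p, l) \<in> addable r d D p"
  shows "row D p l x = y - 1" "col D p l y = x - 1" "1 \<le> x" "1 \<le> y"
proof -
  obtain x1 y1 l1 where e: "((x, y), p, l) = ((x1, y1), p, l1)" and xy: "1 \<le> x" "1 \<le> y" "((x, y), p, l) \<notin> D"
    "\<And>x' y'. 1 \<le> x' \<Longrightarrow> x' \<le> x \<Longrightarrow> 1 \<le> y' \<Longrightarrow> y' \<le> y \<Longrightarrow> (x', y') \<noteq> (x, y) \<Longrightarrow> ((x', y'), p, l) \<in> D"
    by (rule addableD[OF S assms(2)]) auto
  have left: "y = 1 \<or> ((x, y - 1), p, l) \<in> D" using xy(1,2) by (cases "y = 1") (auto intro!: xy(4))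
  have up: "x = 1 \<or> ((x - 1, y), p, l) \<in> D" using xy(1,2) by (cases "x = 1") (auto intro!: xy(4))
  show "row D p l x = y - 1"
    using xy(1-3) left mem_row[OF S, of x y p l] mem_row[OF S, of x "y - 1" p l] by auto
  show "col D p l y = x - 1"
    using xy(1-3) up mem_col[OF S, of x y p l] mem_col[OF S, of "x - 1" y p l] by auto
  show "1 \<le> x" "1 \<le> y" by (fact xy)+
qed

lemma addable_diagonal_bounds:
  assumes S: "shape r d D" and "\<nu> \<in> addable r d D p"
  shows "diagonal \<nu> \<le> int (row D p (node_pd \<nu>) 1)" "- int (col D p (node_pd \<nu>) 1) \<le> diagonal \<nu>"
proof -
  obtain x y l where \<nu>: "\<nu> = ((x, y), p, l)" and xy: "1 \<le> x" "1 \<le> y"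
    "\<And>x' y'. 1 \<le> x' \<Longrightarrow> x' \<le> x \<Longrightarrow> 1 \<le> y' \<Longrightarrow> y' \<le> y \<Longrightarrow> (x', y') \<noteq> (x, y) \<Longrightarrow> ((x', y'), p, l) \<in> D"
    by (rule addableD[OF assms]) auto
  have "y = 1 \<or> ((1, y - 1), p, l) \<in> D" using xy(1,2) by (cases "y = 1") (auto intro!: xy(3))
  moreover have "x = 1 \<or> ((x - 1, 1), p, l) \<in> D" using xy(1,2) by (cases "x = 1") (auto intro!: xy(3))
  ultimately have "y = 1 \<or> y - 1 \<le> row D p l 1" "x = 1 \<or> x - 1 \<le> col D p l 1"
    using mem_row[OF S, of 1 "y - 1" p l] mem_col[OF S, of "x - 1" 1 p l] by auto
  then show "diagonal \<nu> \<le> int (row D p (node_pd \<nu>) 1)" "- int (col D p (node_pd \<nu>) 1) \<le> diagonal \<nu>"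
    using xy(1,2) by (auto simp: \<nu>)
qed

section \<open>Separation of contents\<close>

text \<open>The semisimplicity condition in the form in which it is used.\<close>

definition separated :: "nat \<Rightarrow> nat \<Rightarrow> (nat \<Rightarrow> 'k::field) \<Rightarrow> bool" where
  "separated n d v \<longleftrightarrow>
     (\<forall>m::int. m \<noteq> 0 \<and> \<bar>m\<bar> \<le> int n \<longrightarrow> of_int m \<noteq> (0::'k)) \<and>
     (\<forall>l\<in>{1..d}. \<forall>l'\<in>{1..d}. \<forall>m::int. l \<noteq> l' \<and> \<bar>m\<bar> < int n \<longrightarrow> of_int m + v l - v l' \<noteq> 0)"

lemma content_eq_imp:
  assumes "separated n d v" "node_content v \<theta>' = node_content v \<theta> + of_int c"
    and "node_pd \<theta> \<in> {1..d}" "node_pd \<theta>' \<in> {1..d}"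
    and "node_pd \<theta> = node_pd \<theta>' \<Longrightarrow> \<bar>diagonal \<theta> + c - diagonal \<theta>'\<bar> \<le> int n"
    and "node_pd \<theta> \<noteq> node_pd \<theta>' \<Longrightarrow> \<bar>diagonal \<theta> + c - diagonal \<theta>'\<bar> < int n"
  shows "node_pd \<theta> = node_pd \<theta>' \<and> diagonal \<theta>' = diagonal \<theta> + c"
proof -
  have e: "of_int (diagonal \<theta> + c - diagonal \<theta>') + v (node_pd \<theta>) - v (node_pd \<theta>') = 0"
    using assms(2) by (simp add: node_content_diagonal algebra_simps)
  show ?thesis
  proof (cases "node_pd \<theta> = node_pd \<theta>'")
    case True
    have "diagonal \<theta> + c - diagonal \<theta>' = 0"
    proof (rule ccontr)
      assume "diagonal \<theta> + c - diagonal \<theta>' \<noteq> 0"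
      then have "of_int (diagonal \<theta> + c - diagonal \<theta>') \<noteq> (0::'a)"
        using assms(1,5) True unfolding separated_def by blast
      then show False using e True by simp
    qed
    then show ?thesis using True by simp
  next
    case False
    then have "of_int (diagonal \<theta> + c - diagonal \<theta>') + v (node_pd \<theta>) - v (node_pd \<theta>') \<noteq> 0"
      using assms(1,3,4,6) unfolding separated_def by blast
    then show ?thesis using e by simp
  qed
qed

lemma node_content_eq_imp:
  assumes S: "shape r d D" and sep: "separated n d v" and n: "card D < n"
    and \<theta>: "\<theta> \<in> D" "\<theta>' \<in> D" "node_pr \<theta> = node_pr \<theta>'"
    and e: "node_content v \<theta>' = node_content v \<theta> + of_int c" "\<bar>c\<bar> \<le> 1"
  shows "node_pd \<theta> = node_pd \<theta>' \<and> diagonal \<theta>' = diagonal \<theta> + c"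
proof (rule content_eq_imp[OF sep e(1)])
  let ?p = "node_pr \<theta>" and ?l = "node_pd \<theta>" and ?l' = "node_pd \<theta>'"
  show l: "?l \<in> {1..d}" "?l' \<in> {1..d}"
    using shape_node[OF S] \<theta> by blast+
  note b = diagonal_bounds[OF S \<theta>(1)] diagonal_bounds[OF S \<theta>(2), folded \<theta>(3)]
  note c = corner_le_comp_size[OF S, of ?p ?l] corner_le_comp_size[OF S, of ?p ?l']
  note f = shape_finite[OF S]
  show "\<bar>diagonal \<theta> + c - diagonal \<theta>'\<bar> \<le> int n" if "?l = ?l'"
    using b c e(2) that comp_size_le[OF f, of ?p ?l] n by simp
  show "\<bar>diagonal \<theta> + c - diagonal \<theta>'\<bar> < int n" if "?l \<noteq> ?l'"
    using b c e(2) comp_size_add[OF f that, of ?p] n by simp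
qed

lemma addable_content_eq_imp:
  assumes S: "shape r d D" and sep: "separated n d v" and n: "card D + nat \<bar>c\<bar> < n"
    and \<theta>: "\<theta> \<in> addable r d D p" "\<theta>' \<in> addable r d D p"
    and e: "node_content v \<theta>' = node_content v \<theta> + of_int c"
  shows "node_pd \<theta> = node_pd \<theta>' \<and> diagonal \<theta>' = diagonal \<theta> + c"
proof (rule content_eq_imp[OF sep e(1)])
  let ?l = "node_pd \<theta>" and ?l' = "node_pd \<theta>'"
  show l: "?l \<in> {1..d}" "?l' \<in> {1..d}"
    using shape_node(2)[of r d "insert \<theta> D" \<theta>] shape_node(2)[of r d "insert \<theta>' D" \<theta>'] \<theta>
    by (auto simp: addable_def)
  note b = addable_diagonal_bounds[OF S \<theta>(1)] addable_diagonal_bounds[OF S \<theta>(2)]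
  note c = corner_le_comp_size[OF S, of p ?l] corner_le_comp_size[OF S, of p ?l']
  note f = shape_finite[OF S]
  show "\<bar>diagonal \<theta> + c - diagonal \<theta>'\<bar> \<le> int n" if "?l = ?l'"
    using b c that comp_size_le[OF f, of p ?l] n by simp
  show "\<bar>diagonal \<theta> + c - diagonal \<theta>'\<bar> < int n" if "?l \<noteq> ?l'"
    using b c comp_size_add[OF f that, of p] n by simp
qed

text \<open>
  Of two addable nodes of one component, neither lies weakly to the right of and below the
  other, so their diagonals differ by at least 2.
\<close>

lemma addable_content_not_adjacent:
  assumes S: "shape r d D" and "separated n d v" "card D + 1 < n"
    and \<theta>: "\<theta> \<in> addable r d D p" "\<theta>' \<in> addable r d D p"
  shows "node_content v \<theta>' \<noteq> node_content v \<theta> + 1"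
proof
  assume "node_content v \<theta>' = node_content v \<theta> + 1"
  then have e: "node_pd \<theta> = node_pd \<theta>'" "diagonal \<theta>' = diagonal \<theta> + 1"
    using addable_content_eq_imp[OF S assms(2) _ \<theta>, of 1] assms by auto
  obtain x y l where 1: "\<theta> = ((x, y), p, l)" "1 \<le> x" "1 \<le> y" "((x, y), p, l) \<notin> D"
    "\<And>x' y'. 1 \<le> x' \<Longrightarrow> x' \<le> x \<Longrightarrow> 1 \<le> y' \<Longrightarrow> y' \<le> y \<Longrightarrow> (x', y') \<noteq> (x, y) \<Longrightarrow> ((x', y'), p, l) \<in> D"
    by (rule addableD[OF S \<theta>(1)]) (rule that; assumption)
  obtain x1 y1 l1 where 2: "\<theta>' = ((x1, y1), p, l1)" "1 \<le> x1" "1 \<le> y1" "((x1, y1), p, l1) \<notin> D"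
    "\<And>x' y'. 1 \<le> x' \<Longrightarrow> x' \<le> x1 \<Longrightarrow> 1 \<le> y' \<Longrightarrow> y' \<le> y1 \<Longrightarrow> (x', y') \<noteq> (x1, y1) \<Longrightarrow> ((x', y'), p, l1) \<in> D"
    by (rule addableD[OF S \<theta>(2)]) (rule that; assumption)
  have l: "l1 = l" "int y1 - int x1 = int y - int x + 1" using e 1(1) 2(1) by auto
  have "\<not> (x \<le> x1 \<and> y \<le> y1)" using 2(5)[of x y] 1 l by auto
  moreover have "\<not> (x1 \<le> x \<and> y1 \<le> y)" using 1(5)[of x1 y1] 2 l by auto
  ultimately show False using l by linarith
qed

section \<open>Growth sequences\<close>

lemma growth_mono: "growth r d k \<theta> \<Longrightarrow> j \<le> k \<Longrightarrow> growth r d j \<theta>"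
  unfolding growth_def by (meson atLeastatMost_subset_iff inj_on_subset le_refl le_trans)

lemma growth_shape: "growth r d k \<theta> \<Longrightarrow> shape r d (\<theta> ` {1..k})"
  by (simp add: growth_def)

lemma growth_card: "growth r d k \<theta> \<Longrightarrow> card (\<theta> ` {1..k}) = k"
  by (simp add: growth_def card_image)

lemma growth_cong: "(\<And>j. j \<in> {1..k} \<Longrightarrow> \<theta> j = \<theta>' j) \<Longrightarrow> growth r d k \<theta> = growth r d k \<theta>'"
proof -
  assume a: "\<And>j. j \<in> {1..k} \<Longrightarrow> \<theta> j = \<theta>' j"
  have "\<theta> ` {1..j} = \<theta>' ` {1..j}" if "j \<le> k" for j
    using a that by (intro image_cong) auto
  moreover have "inj_on \<theta> {1..k} = inj_on \<theta>' {1..k}" using a by (rule inj_on_cong)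
  ultimately show ?thesis by (simp add: growth_def)
qed

lemma growth_Suc:
  assumes "growth r d k \<theta>" "\<nu> \<in> addable r d (\<theta> ` {1..k}) p"
  shows "growth r d (Suc k) (\<theta>(Suc k := \<nu>))"
proof -
  let ?\<theta> = "\<theta>(Suc k := \<nu>)"
  have g: "growth r d k ?\<theta>" using assms(1) growth_cong[of k \<theta> ?\<theta>] by simp
  have i: "?\<theta> ` {1..k} = \<theta> ` {1..k}" by (intro image_cong) auto
  have "{1..Suc k} = insert (Suc k) {1..k}" by auto
  then have s: "?\<theta> ` {1..Suc k} = insert \<nu> (?\<theta> ` {1..k})"
    by (simp only: image_insert fun_upd_same)
  have "inj_on ?\<theta> {1..Suc k}"
    using g assms(2) i \<open>{1..Suc k} = _\<close> by (auto simp: growth_def addable_def)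
  moreover have "shape r d (?\<theta> ` {1..j})" if "j \<le> Suc k" for j
    using that g assms(2) s i by (cases "j = Suc k") (auto simp: growth_def addable_def)
  ultimately show ?thesis by (simp add: growth_def)
qed

lemma growth_last_addable:
  assumes "growth r d (Suc k) \<theta>"
  shows "\<theta> (Suc k) \<in> addable r d (\<theta> ` {1..k}) (node_pr (\<theta> (Suc k)))"
proof -
  have s: "{1..Suc k} = insert (Suc k) {1..k}" by auto
  have "\<theta> (Suc k) \<notin> \<theta> ` {1..k}" using assms unfolding growth_def s by (auto simp: inj_on_def)
  moreover have "shape r d (insert (\<theta> (Suc k)) (\<theta> ` {1..k}))"
    using growth_shape[OF assms] by (simp only: s image_insert)
  ultimately show ?thesis by (simp add: addable_def)
qed

text \<open>
  When the later node is added, the diagram already contains everything to the left of and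
  above it.
\<close>

lemma growth_order:
  assumes "growth r d k \<theta>" "i \<in> {1..k}" "j \<in> {1..k}" "\<theta> i = ((x, y), p, l)" "\<theta> j = ((x', y'), p, l)"
    and "x \<le> x'" "y \<le> y'"
  shows "i \<le> j"
proof -
  have S: "shape r d (\<theta> ` {1..j})" "shape r d (\<theta> ` {1..k})" using assms by (auto simp: growth_def)
  have jj: "((x', y'), p, l) \<in> \<theta> ` {1..j}" using assms by (metis atLeastAtMost_iff imageI le_refl)
  have ii: "((x, y), p, l) \<in> \<theta> ` {1..k}" using assms by (metis imageI)
  have "\<theta> i \<in> \<theta> ` {1..j}"
    using shapeD(5)[OF S(1) jj, of x y] shapeD(1,2)[OF S(2) ii] assms by simp
  then obtain m where "m \<in> {1..j}" "\<theta> i = \<theta> m" by auto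
  moreover have "i = m"
    using calculation assms(1-3) inj_onD[of \<theta> "{1..k}" i m] by (simp add: growth_def)
  ultimately show ?thesis by simp
qed

text \<open>
  The local characterisation of contents of standard tableaux. If \<open>a\<close> occurred before, let
  \<open>(x, y)\<close> be the last node with this content: both neighbouring contents occur after it,
  necessarily at \<open>(x, y + 1)\<close> and \<open>(x + 1, y)\<close> or further out, so that \<open>(x + 1, y + 1)\<close> is addable.
  If \<open>a\<close> is new, the diagonal of content \<open>a\<close> is empty although the component is empty or reaches a
  neighbouring diagonal; then the first node of the diagonal is addable.
\<close>

lemma content_addable:
  assumes G: "growth r d m \<theta>" and sep: "separated n d v" and "m < n" and p: "p \<in> {1..r}"
    and between: "\<And>i c. i \<in> {1..m} \<Longrightarrow> node_pr (\<theta> i) = p \<Longrightarrow> node_content v (\<theta> i) = a \<Longrightarrow> c \<in> {-1, 1} \<Longrightarrow>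
       \<exists>j\<in>{i<..m}. node_pr (\<theta> j) = p \<and> node_content v (\<theta> j) = a + of_int c"
    and first: "(\<exists>l\<in>{1..d}. a = v l) \<or>
       (\<exists>j\<in>{1..m}. \<exists>c\<in>{-1, 0, 1}. node_pr (\<theta> j) = p \<and> node_content v (\<theta> j) = a + of_int c)"
  shows "\<exists>\<nu>\<in>addable r d (\<theta> ` {1..m}) p. node_content v \<nu> = a"
proof -
  let ?D = "\<theta> ` {1..m}"
  note S = growth_shape[OF G]
  have card: "card ?D < n" using growth_card[OF G] assms(3) by simp
  have eq: "node_pd \<theta>1 = node_pd \<theta>2 \<and> diagonal \<theta>2 = diagonal \<theta>1 + c"
    if "\<theta>1 \<in> ?D" "\<theta>2 \<in> ?D" "node_pr \<theta>1 = p" "node_pr \<theta>2 = p"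
      "node_content v \<theta>2 = node_content v \<theta>1 + of_int c" "\<bar>c\<bar> \<le> 1" for \<theta>1 \<theta>2 c
    using node_content_eq_imp[OF S sep card that(1,2)] that by simp
  have new: ?thesis if "((x, y), p, l) \<notin> ?D" "1 \<le> x" "1 \<le> y" "l \<in> {1..d}"
      "y = 1 \<or> ((x, y - 1), p, l) \<in> ?D" "x = 1 \<or> ((x - 1, y), p, l) \<in> ?D"
      "of_int (int y - int x) + v l = a" for x y l
    using that shape_insert[OF S that(2,3) p that(4-6)]
    by (intro bexI[of _ "((x, y), p, l)"]) (auto simp: addable_def node_content_diagonal)
  show ?thesis
  proof (cases "\<exists>i\<in>{1..m}. node_pr (\<theta> i) = p \<and> node_content v (\<theta> i) = a")
    case True
    \<comment> \<open>The last node with content \<open>a\<close>.\<close>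
    define I where "I = {i \<in> {1..m}. node_pr (\<theta> i) = p \<and> node_content v (\<theta> i) = a}"
    define i where "i = Max I"
    have fI: "finite I" "I \<noteq> {}" using True by (auto simp: I_def)
    have i: "i \<in> {1..m}" "node_pr (\<theta> i) = p" "node_content v (\<theta> i) = a"
      using Max_in[OF fI] by (auto simp: i_def I_def)
    have imax: "j \<le> i" if "j \<in> {1..m}" "node_pr (\<theta> j) = p" "node_content v (\<theta> j) = a" for j
      using Max_ge[OF fI(1), of j] that by (auto simp: i_def I_def)
    obtain x y l where xy: "\<theta> i = ((x, y), p, l)" using i(2) by (metis node_simps(1) surj_pair)
    have iD: "((x, y), p, l) \<in> ?D" using i(1) xy by (metis imageI)
    note r = shapeD[OF S iD]
    have nb: "((x + nat (- c), y + nat c), p, l) \<in> ?D" if c: "c \<in> {-1, 1}" for c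
    proof -
      obtain j where j: "j \<in> {i<..m}" "node_pr (\<theta> j) = p" "node_content v (\<theta> j) = a + of_int c"
        using between[OF i c] by blast
      have jm: "j \<in> {1..m}" using j i by auto
      obtain x' y' l' where xy': "\<theta> j = ((x', y'), p, l')" using j(2) by (metis node_simps(1) surj_pair)
      have "node_pd (\<theta> i) = node_pd (\<theta> j) \<and> diagonal (\<theta> j) = diagonal (\<theta> i) + c"
        using i j jm c by (intro eq) auto
      then have "l' = l" and dg: "int y' - int x' = int y - int x + c"
        by (simp_all add: xy xy')
      have "\<not> (x' \<le> x \<and> y' \<le> y)"
        using growth_order[OF G jm i(1), of x' y' p l x y] xy xy' \<open>l' = l\<close> j(1) by auto
      then have "x + nat (- c) \<le> x'" "y + nat c \<le> y'" using dg c by auto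
      moreover have "((x', y'), p, l) \<in> ?D" using jm xy' \<open>l' = l\<close> by (metis imageI)
      ultimately show ?thesis
        using shapeD(5)[OF S, of x' y' p l "x + nat (- c)" "y + nat c"] r by auto
    qed
    have "((Suc x, Suc y), p, l) \<notin> ?D"
    proof
      assume "((Suc x, Suc y), p, l) \<in> ?D"
      then obtain j where j: "j \<in> {1..m}" "\<theta> j = ((Suc x, Suc y), p, l)" by auto
      have "i \<le> j" using growth_order[OF G i(1) j(1) xy j(2)] by simp
      moreover have "node_content v (\<theta> j) = a"
        using i(3) by (simp add: j(2) xy node_content_diagonal)
      then have "j \<le> i" using imax[OF j(1)] j(2) by simp
      ultimately show False using xy j(2) by simp
    qed
    moreover have "of_int (int (Suc y) - int (Suc x)) + v l = a"
      using i(3) by (simp add: xy node_content_diagonal)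
    ultimately show ?thesis
      using new[of "Suc x" "Suc y" l] nb[of 1] nb[of "-1"] r by simp
  next
    case False
    then have none: "node_content v \<theta>' \<noteq> a" if "\<theta>' \<in> ?D" "node_pr \<theta>' = p" for \<theta>'
      using that by auto
    from first consider l where "l \<in> {1..d}" "a = v l"
      | j c where "j \<in> {1..m}" "c \<in> {-1, 1}" "node_pr (\<theta> j) = p" "node_content v (\<theta> j) = a + of_int c"
      using False by (metis (no_types, lifting) add.right_neutral insert_iff of_int_0 singletonD)
    then show ?thesis
    proof cases
      case 1
      have "((1, 1), p, l) \<notin> ?D" using none[of "((1, 1), p, l)"] 1 by (auto simp: node_content_diagonal)
      then show ?thesis using new[of 1 1 l] 1 by simp
    next
      case 2
      obtain x y l where xy: "\<theta> j = ((x, y), p, l)" using 2(3) by (metis node_simps(1) surj_pair)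
      have jD: "\<theta> j \<in> ?D" using 2(1) by simp
      note r = shapeD[OF S jD[unfolded xy]]
      note bd = diagonal_bounds[OF S jD, unfolded xy, simplified]
      have a: "a = of_int (int y - int x - c) + v l"
        using 2(4) by (simp add: xy node_content_diagonal algebra_simps)
      have none': "((x', y'), p, l) \<notin> ?D" if "int y' - int x' = int y - int x - c" for x' y'
        using none[of "((x', y'), p, l)"] that by (auto simp: node_content_diagonal a)
      have inrow: "((1, y'), p, l) \<in> ?D \<longleftrightarrow> 1 \<le> y' \<and> y' \<le> row ?D p l 1" for y' using mem_row[OF S] .
      have incol: "((x', 1), p, l) \<in> ?D \<longleftrightarrow> 1 \<le> x' \<and> x' \<le> col ?D p l 1" for x' using mem_col[OF S] .
      show ?thesis
      proof (cases "int y - int x - c \<ge> 0")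
        case True
        define y' where "y' = nat (int y - int x - c) + 1"
        have y': "int y' = int y - int x - c + 1" "y' \<ge> 1" using True by (auto simp: y'_def)
        have 1: "\<not> y' \<le> row ?D p l 1" using none'[of y' 1] inrow[of y'] y' by auto
        have "y' = 1 \<or> ((1, y' - 1), p, l) \<in> ?D"
          using inrow[of "y' - 1"] y' bd 2(2) 1 by auto
        then show ?thesis using new[of 1 y' l] 1 inrow[of y'] y' r a by auto
      next
        case False
        define x' where "x' = nat (- (int y - int x - c)) + 1"
        have x': "int x' = - (int y - int x - c) + 1" "x' \<ge> 1" using False by (auto simp: x'_def)
        have 1: "\<not> x' \<le> col ?D p l 1" using none'[of 1 x'] incol[of x'] x' by auto
        have "x' = 1 \<or> ((x' - 1, 1), p, l) \<in> ?D"
          using incol[of "x' - 1"] x' bd 2(2) 1 by auto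
        then show ?thesis using new[of x' 1 l] 1 incol[of x'] x' r a by auto
      qed
    qed
  qed
qed

text \<open>By nodes at the end of the first row of the first component.\<close>

lemma growth_extend:
  assumes "growth r d k \<theta>" "k \<le> n" "1 \<le> r" "1 \<le> d"
  shows "\<exists>\<theta>'. growth r d n \<theta>' \<and> (\<forall>j\<in>{1..k}. \<theta>' j = \<theta> j)"
  using assms(2)
proof (induction n rule: dec_induct)
  case base
  then show ?case using assms(1) by blast
next
  case (step n)
  then obtain \<theta>' where \<theta>': "growth r d n \<theta>'" "\<forall>j\<in>{1..k}. \<theta>' j = \<theta> j" by blast
  note S = growth_shape[OF \<theta>'(1)]
  let ?D = "\<theta>' ` {1..n}"
  let ?\<nu> = "((1, Suc (row ?D 1 1 1)), 1, 1)"
  have "?\<nu> \<notin> ?D" using mem_row[OF S, of 1 "Suc (row ?D 1 1 1)" 1 1] by simp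
  moreover have "shape r d (insert ?\<nu> ?D)"
    using mem_row[OF S, of 1 "row ?D 1 1 1" 1 1] assms by (intro shape_insert S) auto
  ultimately have "?\<nu> \<in> addable r d ?D 1" by (simp add: addable_def)
  from growth_Suc[OF \<theta>'(1) this] have "growth r d (Suc n) (\<theta>'(Suc n := ?\<nu>))" .
  moreover have "\<forall>j\<in>{1..k}. (\<theta>'(Suc n := ?\<nu>)) j = \<theta> j" using \<theta>'(2) step.hyps by auto
  ultimately show ?case by blast
qed

lemma growth_row:
  assumes "q \<in> {1..r}" "1 \<le> d"
  shows "growth r d n (\<lambda>j. ((1, j), q, 1))"
  unfolding growth_def shape_def using assms by (auto simp: inj_on_def)

section \<open>Standard tableaux as growth sequences\<close>

text \<open>
  A standard tableau is the same as the sequence in which its nodes are filled: the order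
  conditions say that each initial segment is a diagram.
\<close>

lemma tableau_growth:
  assumes lam: "lam \<in> rd_partitions r d n" and t: "t \<in> std_tableaux n lam"
  shows "growth r d n (node_of lam t)" "node_of lam t ` {1..n} = diagram lam"
proof -
  let ?\<theta> = "node_of lam t"
  have bij: "bij_betw t (diagram lam) {1..n}" using t by (simp add: std_tableaux_def)
  have bij': "bij_betw ?\<theta> {1..n} (diagram lam)"
    unfolding node_of_def using bij_betw_inv_into[OF bij] .
  then show im: "?\<theta> ` {1..n} = diagram lam" by (rule bij_betw_imp_surj_on)
  have t\<theta>: "t (?\<theta> i) = i" if "i \<in> {1..n}" for i
    unfolding node_of_def using bij that by (simp add: bij_betw_inv_into_right)
  have \<theta>t: "?\<theta> (t b) = b" if "b \<in> diagram lam" for b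
    unfolding node_of_def using bij that by (simp add: bij_betw_inv_into_left)
  have tn: "t b \<in> {1..n}" if "b \<in> diagram lam" for b using bij that by (auto simp: bij_betw_def)
  have mono: "row_len (lam k l) x \<le> row_len (lam k l) x'" if "1 \<le> x'" "x' \<le> x" for k l x x'
  proof -
    have "sorted_wrt (\<ge>) (lam k l)" using lam by (simp add: rd_partitions_def is_partition_def)
    then show ?thesis
      using that unfolding row_len_def by (cases "x = x'") (auto simp: sorted_wrt_iff_nth_less)
  qed
  have closed: "((x', y'), k, l) \<in> diagram lam"
    if "((x, y), k, l) \<in> diagram lam" "1 \<le> x'" "x' \<le> x" "1 \<le> y'" "y' \<le> y" for x y k l x' y'
    using that mono[of x' x k l] by (auto simp: diagram_def young_def)
  have range: "1 \<le> x" "1 \<le> y" "k \<in> {1..r}" "l \<in> {1..d}" if "((x, y), k, l) \<in> diagram lam" for x y k l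
  proof -
    show "1 \<le> x" "1 \<le> y" using that by (auto simp: diagram_def young_def)
    have "lam k l \<noteq> []" using that by (auto simp: diagram_def young_def row_len_def split: if_splits)
    then show "k \<in> {1..r}" "l \<in> {1..d}" using lam by (auto simp: rd_partitions_def)
  qed
  have tcol: "t ((x', y), k, l) < t ((x, y), k, l)"
    if "((x', y), k, l) \<in> diagram lam" "((x, y), k, l) \<in> diagram lam" "x' < x" for x x' y k l
    using t that unfolding std_tableaux_def by blast
  have trow: "t ((x, y'), k, l) < t ((x, y), k, l)"
    if "((x, y'), k, l) \<in> diagram lam" "((x, y), k, l) \<in> diagram lam" "y' < y" for x y y' k l
    using t that unfolding std_tableaux_def by blast
  have tle: "t ((x', y'), k, l) \<le> t ((x, y), k, l)"
    if "((x, y), k, l) \<in> diagram lam" "1 \<le> x'" "x' \<le> x" "1 \<le> y'" "y' \<le> y" for x y k l x' y'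
  proof -
    have m: "((x, y'), k, l) \<in> diagram lam" "((x', y'), k, l) \<in> diagram lam"
      using closed[OF that(1)] that range[OF that(1)] by auto
    have "t ((x', y'), k, l) \<le> t ((x, y'), k, l)"
      using tcol[OF m(2,1)] that by (cases "x' = x") auto
    also have "\<dots> \<le> t ((x, y), k, l)"
      using trow[OF m(1) that(1)] that by (cases "y' = y") auto
    finally show ?thesis .
  qed
  have seg: "?\<theta> ` {1..j} = {b \<in> diagram lam. t b \<le> j}" if "j \<le> n" for j
  proof (intro equalityI subsetI)
    fix b assume "b \<in> ?\<theta> ` {1..j}"
    then obtain i where "i \<in> {1..j}" "b = ?\<theta> i" by auto
    then show "b \<in> {b \<in> diagram lam. t b \<le> j}" using t\<theta>[of i] im that by auto
  next
    fix b assume "b \<in> {b \<in> diagram lam. t b \<le> j}"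
    then show "b \<in> ?\<theta> ` {1..j}" using \<theta>t[of b] tn[of b] by (intro image_eqI[of _ _ "t b"]) auto
  qed
  have "shape r d (?\<theta> ` {1..j})" if "j \<le> n" for j
    unfolding seg[OF that] shape_def
  proof (intro conjI allI impI ballI)
    show "finite {b \<in> diagram lam. t b \<le> j}" unfolding seg[OF that, symmetric] by simp
  next
    fix x y k l assume a: "((x, y), k, l) \<in> {b \<in> diagram lam. t b \<le> j}"
    then have m: "((x, y), k, l) \<in> diagram lam" "t ((x, y), k, l) \<le> j" by auto
    show "1 \<le> x" "1 \<le> y" "k \<in> {1..r}" "l \<in> {1..d}" by (rule range[OF m(1)])+
    fix x' y' assume "x' \<in> {1..x}" "y' \<in> {1..y}"
    then have "1 \<le> x'" "x' \<le> x" "1 \<le> y'" "y' \<le> y" by auto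
    from closed[OF m(1) this] le_trans[OF tle[OF m(1) this] m(2)]
    show "((x', y'), k, l) \<in> {b \<in> diagram lam. t b \<le> j}" by simp
  qed
  then show "growth r d n ?\<theta>" using bij' by (simp add: growth_def bij_betw_def)
qed

lemma row_len_row: "row_len (lam p l) x = row (diagram lam) p l x"
proof -
  have "{y. ((x, y), p, l) \<in> diagram lam} = {1..row_len (lam p l) x}"
    by (auto simp: diagram_def young_def row_len_def)
  then show ?thesis by (simp add: row_def)
qed

lemma col_len_col: "col_len (lam p l) y = col (diagram lam) p l y"
  by (simp add: col_def col_len_def diagram_def)

lemma growth_tableau:
  assumes G: "growth r d n \<theta>"
  shows "\<exists>lam t. lam \<in> rd_partitions r d n \<and> t \<in> std_tableaux n lam \<and> (\<forall>j\<in>{1..n}. node_of lam t j = \<theta> j)"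
proof -
  let ?D = "\<theta> ` {1..n}"
  note S = growth_shape[OF G]
  define lam where "lam p l = map (row ?D p l) [1..<Suc (col ?D p l 1)]" for p l
  define t where "t = inv_into {1..n} \<theta>"
  have row0: "row ?D p l x = 0 \<longleftrightarrow> \<not> (1 \<le> x \<and> x \<le> col ?D p l 1)" for p l x
    using mem_row[OF S, of x 1 p l] mem_col[OF S, of x 1 p l] by auto
  have rl: "row_len (lam p l) x = row ?D p l x" for p l x
    using row0[of p l x] by (auto simp: row_len_def lam_def simp del: upt_Suc)
  have yg: "(x, y) \<in> young (lam p l) \<longleftrightarrow> ((x, y), p, l) \<in> ?D" for x y p l
    using mem_row[OF S, of x y p l] shapeD(1)[OF S, of x y p l] by (auto simp: young_def rl)
  have dia: "diagram lam = ?D" by (auto simp: diagram_def yg)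
  have part: "is_partition (lam p l)" for p l
  proof -
    have mono: "row ?D p l x' \<le> row ?D p l x" if "1 \<le> x" "x \<le> x'" for x x'
    proof (cases "row ?D p l x' = 0")
      case False
      then have "((x', row ?D p l x'), p, l) \<in> ?D" using mem_row[OF S] by simp
      then have "((x, row ?D p l x'), p, l) \<in> ?D"
        by (rule shapeD(5)[OF S]) (use that False in auto)
      then show ?thesis using mem_row[OF S] by simp
    qed simp
    have "0 \<notin> set (lam p l)" using row0 by (auto simp: lam_def image_iff simp del: upt_Suc)
    then show ?thesis
      using mono by (auto simp: is_partition_def lam_def sorted_wrt_iff_nth_less simp del: upt_Suc)
  qed
  have bijt: "bij_betw t ?D {1..n}"
    unfolding t_def using G by (intro bij_betw_inv_into) (auto simp: growth_def bij_betw_def)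
  have t\<theta>: "t (\<theta> i) = i" if "i \<in> {1..n}" for i
    unfolding t_def using G that by (simp add: growth_def)
  have "lam \<in> rd_partitions r d n"
    unfolding rd_partitions_def
  proof (intro CollectI conjI allI impI part)
    fix p l assume "p \<notin> {1..r} \<or> l \<notin> {1..d}"
    then have "((x, y), p, l) \<notin> ?D" for x y using shapeD(3,4)[OF S] by blast
    then have "col ?D p l 1 = 0" by (simp add: col_def)
    then show "lam p l = []" by (simp add: lam_def)
  next
    have sl: "sum_list (lam p l) = (\<Sum>x\<in>{1..col ?D p l 1}. row ?D p l x)" for p l
      unfolding lam_def
      by (simp only: sum_list_distinct_conv_sum_set distinct_upt set_upt atLeastLessThanSuc_atLeastAtMost)
    let ?C = "\<lambda>p l. Sigma {1..col ?D p l 1} (\<lambda>x. {1..row ?D p l x})"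
    have C: "(x, y) \<in> ?C p l \<longleftrightarrow> ((x, y), p, l) \<in> ?D" for x y p l
      using mem_row[OF S, of x y p l] row0[of p l x] by auto
    have "(\<Sum>p\<in>{1..r}. \<Sum>l\<in>{1..d}. sum_list (lam p l)) = (\<Sum>p\<in>{1..r}. \<Sum>l\<in>{1..d}. card (?C p l))"
      by (simp add: sl)
    also have "\<dots> = card (Sigma {1..r} (\<lambda>p. Sigma {1..d} (\<lambda>l. ?C p l)))"
      by (simp add: card_SigmaI)
    also have "\<dots> = card ?D"
    proof (rule bij_betw_same_card[of "\<lambda>(p, l, b). (b, p, l)"])
      show "bij_betw (\<lambda>(p, l, b). (b, p, l)) (Sigma {1..r} (\<lambda>p. Sigma {1..d} (\<lambda>l. ?C p l))) ?D"
        unfolding bij_betw_def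
      proof (intro conjI equalityI subsetI)
        fix b assume b: "b \<in> ?D"
        obtain x y p l where e: "b = ((x, y), p, l)" by (metis surj_pair)
        show "b \<in> (\<lambda>(p, l, b). (b, p, l)) ` (Sigma {1..r} (\<lambda>p. Sigma {1..d} (\<lambda>l. ?C p l)))"
          using shapeD(3,4)[OF S b[unfolded e]] C[of x y p l] b
          by (intro image_eqI[of _ _ "(p, l, (x, y))"]) (auto simp: e)
      next
        fix b assume "b \<in> (\<lambda>(p, l, b). (b, p, l)) ` (Sigma {1..r} (\<lambda>p. Sigma {1..d} (\<lambda>l. ?C p l)))"
        then obtain p l x y where "b = ((x, y), p, l)" "(x, y) \<in> ?C p l" by auto
        then show "b \<in> ?D" using C by metis
      qed (auto simp: inj_on_def)
    qed
    finally show "(\<Sum>p\<in>{1..r}. \<Sum>l\<in>{1..d}. sum_list (lam p l)) = n" using growth_card[OF G] by simp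
  qed
  moreover have "t \<in> std_tableaux n lam"
    unfolding std_tableaux_def dia
  proof (intro CollectI conjI allI impI bijt; elim conjE)
    fix x y y' k l
    assume a: "((x, y), k, l) \<in> ?D" "((x, y'), k, l) \<in> ?D" "y < y'"
    obtain i j where ij: "i \<in> {1..n}" "\<theta> i = ((x, y), k, l)" "j \<in> {1..n}" "\<theta> j = ((x, y'), k, l)"
      using a(1,2) by (metis imageE)
    have "i \<le> j" using growth_order[OF G ij(1,3,2,4)] a(3) by simp
    moreover have "i \<noteq> j" using ij a(3) by auto
    ultimately show "t ((x, y), k, l) < t ((x, y'), k, l)" using t\<theta> ij by (metis le_neq_implies_less)
  next
    fix x x' y k l
    assume a: "((x, y), k, l) \<in> ?D" "((x', y), k, l) \<in> ?D" "x < x'"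
    obtain i j where ij: "i \<in> {1..n}" "\<theta> i = ((x, y), k, l)" "j \<in> {1..n}" "\<theta> j = ((x', y), k, l)"
      using a(1,2) by (metis imageE)
    have "i \<le> j" using growth_order[OF G ij(1,3,2,4)] a(3) by simp
    moreover have "i \<noteq> j" using ij a(3) by auto
    ultimately show "t ((x, y), k, l) < t ((x', y), k, l)" using t\<theta> ij by (metis le_neq_implies_less)
  qed
  moreover have "node_of lam t j = \<theta> j" if "j \<in> {1..n}" for j
    unfolding node_of_def dia
    using that bijt t\<theta>[OF that] by (intro inv_into_f_eq) (auto simp: bij_betw_def)
  ultimately show ?thesis by blast
qed

lemma growth_extends_to_tableau:
  assumes "growth r d k \<theta>" "k \<le> n" "1 \<le> r" "1 \<le> d"
  shows "\<exists>lam t. lam \<in> rd_partitions r d n \<and> t \<in> std_tableaux n lam \<and> (\<forall>j\<in>{1..k}. node_of lam t j = \<theta> j)"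
proof -
  obtain \<theta>' where "growth r d n \<theta>'" "\<forall>j\<in>{1..k}. \<theta>' j = \<theta> j"
    using growth_extend[OF assms] by blast
  then show ?thesis using growth_tableau[of r d n \<theta>'] assms(2) by fastforce
qed

text \<open>
  A growth sequence of length \<open>k\<close> is the beginning of a standard tableau with \<open>n\<close> entries.
\<close>

lemma content_set_mem:
  assumes "growth r d k \<theta>" "k \<in> {1..n}" "1 \<le> r" "1 \<le> d"
  shows "node_content v (\<theta> k) \<in> content_set r n d v k"
proof -
  obtain lam t where lt: "lam \<in> rd_partitions r d n" "t \<in> std_tableaux n lam"
    and node: "\<forall>j\<in>{1..k}. node_of lam t j = \<theta> j"
    using growth_extends_to_tableau[OF assms(1), of n] assms(2-) by auto
  have "tab_content v lam t k \<in> content_set r n d v k" unfolding content_set_def using lt by blast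
  moreover have "tab_content v lam t k = node_content v (\<theta> k)"
    using assms(2) node by (simp add: tab_content_def)
  ultimately show ?thesis by simp
qed

lemma finite_content_set:
  assumes "k \<in> {1..n}" shows "finite (content_set r n d v k)"
proof -
  let ?N = "({1..n} \<times> {1..n}) \<times> {1..r} \<times> {1..d}"
  have "content_set r n d v k \<subseteq> node_content v ` ?N"
  proof
    fix c assume "c \<in> content_set r n d v k"
    then obtain lam t where a: "lam \<in> rd_partitions r d n" "t \<in> std_tableaux n lam" "c = tab_content v lam t k"
      unfolding content_set_def by blast
    let ?\<theta> = "node_of lam t" and ?D = "diagram lam"
    note G = tableau_growth[OF a(1,2)]
    have S: "shape r d ?D" using growth_shape[OF G(1)] by (simp only: G(2))
    have cD: "card ?D = n" using growth_card[OF G(1)] by (simp only: G(2))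
    obtain x y p l where e: "?\<theta> k = ((x, y), p, l)" by (metis surj_pair)
    have m: "((x, y), p, l) \<in> ?D" using G(2) assms e by (metis imageI)
    note rg = shapeD[OF S m]
    have "((1, y), p, l) \<in> ?D" "((x, 1), p, l) \<in> ?D" using rg by auto
    then have "y \<le> row ?D p l 1" "x \<le> col ?D p l 1" using mem_row[OF S] mem_col[OF S] by auto
    then have "x \<le> n" "y \<le> n"
      using corner_le_comp_size(2,3)[OF S, of p l] comp_size_le[OF shape_finite[OF S], of p l] cD by auto
    then have "((x, y), p, l) \<in> ?N" using rg by auto
    then show "c \<in> node_content v ` ?N" using a(3) e by (auto simp: tab_content_def)
  qed
  then show ?thesis by (rule finite_subset) simp
qed

text \<open>A single row in an arbitrary position provides every root of unity.\<close>

lemma position_set_eq: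
  assumes "k \<in> {1..n}" "1 \<le> d"
  shows "position_set r n d z k = root_set r z"
proof (intro equalityI subsetI)
  fix c assume "c \<in> position_set r n d z k"
  then obtain lam t where a: "lam \<in> rd_partitions r d n" "t \<in> std_tableaux n lam" "c = zeta_pow z (tab_pos lam t k)"
    unfolding position_set_def by blast
  note G = tableau_growth[OF a(1,2)]
  obtain x y p l where e: "node_of lam t k = ((x, y), p, l)" by (metis surj_pair)
  have "((x, y), p, l) \<in> node_of lam t ` {1..n}" using assms e by (metis imageI)
  then have "p \<in> {1..r}" using shapeD(3)[OF growth_shape[OF G(1)]] by blast
  then show "c \<in> root_set r z" using a(3) e by (simp add: tab_pos_def root_set_def)
next
  fix c assume "c \<in> root_set r z"
  then obtain q where q: "q \<in> {1..r}" "c = zeta_pow z q" by (auto simp: root_set_def)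
  obtain lam t where lt: "lam \<in> rd_partitions r d n" "t \<in> std_tableaux n lam"
    and node: "\<forall>j\<in>{1..n}. node_of lam t j = ((1, j), q, 1)"
    using growth_tableau[OF growth_row[OF q(1) assms(2)], of n] by auto
  have "zeta_pow z (tab_pos lam t k) \<in> position_set r n d z k" unfolding position_set_def using lt by blast
  moreover have "zeta_pow z (tab_pos lam t k) = c"
    using assms(1) q(2) node by (simp add: tab_pos_def)
  ultimately show "c \<in> position_set r n d z k" by simp
qed

section \<open>Hook products\<close>

text \<open>
  The generalised hook of a node with respect to component \<open>m\<close>. For the component of the node
  itself it is the ordinary hook length.
\<close>

definition hk :: "node set \<Rightarrow> (nat \<Rightarrow> 'k::field) \<Rightarrow> node \<Rightarrow> nat \<Rightarrow> 'k" where
  "hk D v = (\<lambda>((x, y), p, l) m.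
     of_int (int (row D p l x) + int (col D p m y) - int x - int y + 1) + v l - v m)"

definition hook_product :: "nat \<Rightarrow> (nat \<Rightarrow> 'k::field) \<Rightarrow> node set \<Rightarrow> 'k" where
  "hook_product d v D = (\<Prod>\<theta>\<in>D. \<Prod>m\<in>{1..d}. hk D v \<theta> m)"

lemma hk_simp [simp]:
  "hk D v ((x, y), p, l) m =
     of_int (int (row D p l x) + int (col D p m y) - int x - int y + 1) + v l - v m"
  by (simp add: hk_def)

lemma F_lam_hook_product:
  assumes "shape r d (diagram lam)"
  shows "F_lam d v lam = hook_product d v (diagram lam)"
  unfolding F_lam_def hook_product_def
proof (rule prod.cong[OF refl])
  fix \<theta> assume \<theta>: "\<theta> \<in> diagram lam"
  obtain x y p l where e: "\<theta> = ((x, y), p, l)" by (metis surj_pair)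
  have l: "l \<in> {1..d}" using shapeD(4)[OF assms \<theta>[unfolded e]] .
  have "(\<Prod>m\<in>{1..d}. hk (diagram lam) v \<theta> m)
      = hk (diagram lam) v \<theta> l * (\<Prod>m\<in>{1..d} - {l}. hk (diagram lam) v \<theta> m)"
    using l by (simp add: prod.remove)
  then show "of_int (hook (lam (node_pr \<theta>) (node_pd \<theta>)) (fst \<theta>)) *
        (\<Prod>k\<in>{1..d} - {node_pd \<theta>}.
           of_int (gen_hook (lam (node_pr \<theta>) (node_pd \<theta>)) (lam (node_pr \<theta>) k) (fst \<theta>))
           + v (node_pd \<theta>) - v k) = (\<Prod>m\<in>{1..d}. hk (diagram lam) v \<theta> m)"
    by (simp add: e hook_def gen_hook_def row_len_row col_len_col)
qed

lemma col_le_comp_size: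
  assumes "finite D" shows "col D p l y \<le> comp_size D p l"
proof -
  have "col D p l y = card ((\<lambda>x. ((x, y), p, l)) ` {x. ((x, y), p, l) \<in> D})"
    unfolding col_def by (rule card_image[symmetric]) (auto simp: inj_on_def)
  also have "\<dots> \<le> comp_size D p l"
    unfolding comp_size_def using assms by (intro card_mono) auto
  finally show ?thesis .
qed

lemma hk_nonzero:
  assumes S: "shape r d D" and sep: "separated n d v" and n: "card D \<le> n"
    and \<theta>: "((x, y), p, l) \<in> D" and m: "m \<in> {1..d}"
  shows "hk D v ((x, y), p, l) m \<noteq> 0"
proof -
  note f = shape_finite[OF S]
  let ?h = "int (row D p l x) + int (col D p m y) - int x - int y + 1"
  have xy: "1 \<le> x" "1 \<le> y" "x \<le> col D p l y" "y \<le> row D p l x" "l \<in> {1..d}"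
    using \<theta> mem_row[OF S, of x y p l] mem_col[OF S, of x y p l] shapeD(4)[OF S \<theta>] by auto
  note h = hook_le_comp_size[OF S \<theta>]
  show ?thesis
  proof (cases "m = l")
    case True
    have "?h \<noteq> 0" "\<bar>?h\<bar> \<le> int n"
      using xy h True comp_size_le[OF f, of p l] n by auto
    then have "of_int ?h \<noteq> (0::'a)" using sep unfolding separated_def by blast
    then show ?thesis using True by simp
  next
    case False
    have "x \<le> comp_size D p l" using xy(3) col_le_comp_size[OF f, of p l y] by simp
    moreover note col_le_comp_size[OF f, of p m y] comp_size_add[OF f, of l m p]
    ultimately have "\<bar>?h\<bar> < int n" using xy h False n by auto
    then have "of_int ?h + v l - v m \<noteq> 0" using sep xy(5) m False unfolding separated_def by metis
    then show ?thesis by simp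
  qed
qed

lemma hook_product_nonzero:
  assumes "shape r d D" "separated n d v" "card D \<le> n"
  shows "hook_product d v D \<noteq> 0"
  using hk_nonzero[OF assms] shape_finite[OF assms(1)]
  by (auto simp: hook_product_def simp del: hk_simp)

text \<open>
  The contribution of component \<open>m\<close> to the quotient of the hook products before and after a node
  in column \<open>b\<close> is added, as a function of the content of the node minus \<open>v m\<close>.
\<close>

definition hook_factor :: "node set \<Rightarrow> nat \<Rightarrow> nat \<Rightarrow> nat \<Rightarrow> 'k::field \<Rightarrow> 'k" where
  "hook_factor D p b m w =
     (\<Prod>y\<in>{1..<b}. (w - of_nat y + of_nat (col D p m y) + 1) / (w - of_nat y + of_nat (col D p m y))) *
     (\<Prod>x\<in>{1..col D p m b}. (w - of_nat (row D p m x) + of_nat x - 1) / (w - of_nat (row D p m x) + of_nat x))"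

text \<open>
  The fusion scalar divided by \<open>u - c\<close>, where \<open>c\<close> is the content of the node. At \<open>u = c\<close> it is the
  quotient of the hook products after and before the node is added.
\<close>

definition hook_ratio :: "nat \<Rightarrow> (nat \<Rightarrow> 'k::field) \<Rightarrow> node set \<Rightarrow> node \<Rightarrow> 'k \<Rightarrow> 'k" where
  "hook_ratio d v D = (\<lambda>((a, b), p, l) u.
     (\<Prod>m\<in>{1..d} - {l}. u - v m - of_nat b + 1 + of_nat (col D p m b)) *
     (\<Prod>m\<in>{1..d}. hook_factor D p b m (u - v m)))"

lemma telescope_squares:
  fixes b :: "'k::field"
  assumes nz: "\<And>i::int. b + of_int i \<noteq> 0"
  shows "(\<Prod>j\<in>{1..L}. 1 - 1 / (b + of_nat j)\<^sup>2) = b * (b + of_nat L + 1) / ((b + of_nat L) * (b + 1))"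
proof (induction L)
  case 0
  then show ?case using nz[of 0] nz[of 1] by simp
next
  case (Suc L)
  have n: "b + 1 \<noteq> 0" "b + of_nat L \<noteq> 0" "b + of_nat L + 1 \<noteq> 0"
    using nz[of 1] nz[of "int L"] nz[of "int L + 1"] by (simp_all add: add.assoc)
  define c where "c = b + of_nat L"
  have c: "c \<noteq> 0" "c + 1 \<noteq> 0" using n by (simp_all add: c_def)
  have "1 - 1 / X = (X - 1) / X" if "X \<noteq> 0" for X :: 'k
    using that by (simp add: diff_divide_distrib)
  moreover have "(c + 1) * (c + 1) - 1 = c * (c + 2)" by (simp add: algebra_simps)
  ultimately have "1 - 1 / (c + 1)\<^sup>2 = c * (c + 2) / ((c + 1) * (c + 1))"
    using c by (metis mult_eq_0_iff power2_eq_square)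
  then have "b * (c + 1) / (c * (b + 1)) * (1 - 1 / (c + 1)\<^sup>2) = b * (c + 2) / ((c + 1) * (b + 1))"
    using c n(1) by simp
  moreover have "b + of_nat (Suc L) = c + 1" by (simp add: c_def algebra_simps)
  ultimately show ?case using Suc by (simp add: c_def[symmetric] add.assoc del: of_nat_Suc)
qed

lemma telescope_quotient:
  fixes b :: "'k::field"
  assumes nz: "\<And>i::int. b + of_int i \<noteq> 0"
  shows "(\<Prod>j\<in>{1..L}. (b + of_nat j + 1) / (b + of_nat j)) = (b + of_nat L + 1) / (b + 1)"
proof (induction L)
  case 0
  then show ?case using nz[of 1] by simp
next
  case (Suc L)
  define c where "c = b + of_nat L"
  have "c + 1 \<noteq> 0" using nz[of "int L + 1"] by (simp add: c_def add.assoc)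
  moreover have "b + of_nat (Suc L) = c + 1" by (simp add: c_def algebra_simps)
  ultimately show ?case using Suc by (simp add: c_def[symmetric] del: of_nat_Suc)
qed

definition comp_nodes :: "node set \<Rightarrow> nat \<Rightarrow> nat \<Rightarrow> (nat \<times> nat) set" where
  "comp_nodes D p l = {b. (b, p, l) \<in> D}"

text \<open>
  A Young diagram consists of its columns to the left of column \<open>b\<close> and of its rows from column
  \<open>b\<close> on. The products of interest telescope along these pieces.
\<close>

lemma comp_nodes_split:
  assumes S: "shape r d D" and b: "1 \<le> b"
  shows "(\<Prod>(x, y)\<in>comp_nodes D p l. F x y) =
     (\<Prod>y\<in>{1..<b}. \<Prod>x\<in>{1..col D p l y}. F x y) *
     (\<Prod>x\<in>{1..col D p l b}. \<Prod>y\<in>{b..row D p l x}. F x y)"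
proof -
  let ?A = "Sigma {1..<b} (\<lambda>y. {1..col D p l y})" and ?B = "Sigma {1..col D p l b} (\<lambda>x. {b..row D p l x})"
  have e: "comp_nodes D p l = prod.swap ` ?A \<union> ?B"
  proof (intro equalityI subsetI)
    fix z assume z: "z \<in> comp_nodes D p l"
    obtain x y where xy: "z = (x, y)" by (cases z)
    have m: "((x, y), p, l) \<in> D" using z by (simp add: comp_nodes_def xy)
    note rg = shapeD[OF S m]
    show "z \<in> prod.swap ` ?A \<union> ?B"
    proof (cases "y < b")
      case True
      then have "(y, x) \<in> ?A" using m mem_col[OF S, of x y p l] rg(2) by auto
      then have "prod.swap (y, x) \<in> prod.swap ` ?A" by (rule imageI)
      then show ?thesis by (simp add: xy)
    next
      case False
      then have "((x, b), p, l) \<in> D" using rg b by simp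
      then have "(x, y) \<in> ?B"
        using m mem_col[OF S, of x b p l] mem_row[OF S, of x y p l] False by auto
      then show ?thesis by (simp add: xy)
    qed
  next
    fix z assume z: "z \<in> prod.swap ` ?A \<union> ?B"
    obtain x y where xy: "z = (x, y)" by (cases z)
    have "((x, y), p, l) \<in> D"
    proof (cases "z \<in> ?B")
      case True
      then show ?thesis using mem_row[OF S, of x y p l] b by (simp add: xy)
    next
      case False
      then show ?thesis using z mem_col[OF S, of x y p l] by (auto simp: xy)
    qed
    then show "z \<in> comp_nodes D p l" by (simp add: comp_nodes_def xy)
  qed
  have "(\<Prod>(x, y)\<in>comp_nodes D p l. F x y) = (\<Prod>(x, y)\<in>prod.swap ` ?A. F x y) * (\<Prod>(x, y)\<in>?B. F x y)"
    unfolding e by (rule prod.union_disjoint) auto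
  also have "(\<Prod>(x, y)\<in>prod.swap ` ?A. F x y) = (\<Prod>(y, x)\<in>?A. F x y)"
    by (subst prod.reindex) (auto simp: inj_on_def case_prod_beta)
  finally show ?thesis by (simp add: prod.Sigma)
qed

text \<open>
  Since \<open>1 - 1/z\<^sup>2 = (z - 1) (z + 1) / z\<^sup>2\<close>, the product over a column or a row telescopes to
  its ends. The ends on the column \<open>b\<close> and the ends on the upper border telescope once more.
\<close>

lemma comp_telescope:
  fixes w :: "'k::field"
  assumes S: "shape r d D" and b: "1 \<le> b" and nz: "\<And>i::int. w + of_int i \<noteq> 0"
  shows "w * (\<Prod>(x, y)\<in>comp_nodes D p m. 1 - 1 / (w - (of_nat y - of_nat x))\<^sup>2)
    = (w - of_nat b + 1 + of_nat (col D p m b)) * hook_factor D p b m w"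
proof -
  let ?h = "\<lambda>y. col D p m y" and ?L = "\<lambda>x. row D p m x"
  let ?s = "?h b"
  have nz': "w - of_nat y + of_int i \<noteq> 0" for y i using nz[of "i - int y"] by (simp add: algebra_simps)
  have colp: "(\<Prod>x\<in>{1..?h y}. 1 - 1 / (w - (of_nat y - of_nat x))\<^sup>2)
      = (w - of_nat y) / (w - of_nat y + 1) * ((w - of_nat y + of_nat (?h y) + 1) / (w - of_nat y + of_nat (?h y)))" for y
  proof -
    have "w - (of_nat y - of_nat x) = (w - of_nat y) + of_nat x" for x by simp
    moreover have "A * (A + h + 1) / ((A + h) * (A + 1)) = A / (A + 1) * ((A + h + 1) / (A + h))" for A h :: 'k
      by (simp add: mult.commute)
    ultimately show ?thesis by (simp only: telescope_squares[OF nz'])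
  qed
  have rowp: "(\<Prod>y\<in>{b..?L x}. 1 - 1 / (w - (of_nat y - of_nat x))\<^sup>2)
      = ((w - of_nat b + of_nat x + 1) / (w - of_nat b + of_nat x)) *
        ((w - of_nat (?L x) + of_nat x - 1) / (w - of_nat (?L x) + of_nat x))" if x: "x \<in> {1..?s}" for x
  proof -
    have "((x, b), p, m) \<in> D" using mem_col[OF S, of x b p m] x by simp
    then have bL: "b \<le> ?L x" using mem_row[OF S, of x b p m] by simp
    \<comment> \<open>Along a row the arguments decrease, whence the sign in the starting point.\<close>
    define L where "L = Suc (?L x) - b"
    define a where "a = - w + of_nat b - 1 - of_nat x"
    have a: "a + of_int i \<noteq> 0" for i
    proof
      assume "a + of_int i = 0"
      then have "w + of_int (int x + 1 - int b - i) = 0" by (simp add: a_def algebra_simps)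
      then show False using nz by blast
    qed
    have im: "{b..?L x} = (\<lambda>j. j + b - 1) ` {1..L}"
    proof (intro equalityI subsetI)
      fix y assume "y \<in> {b..?L x}"
      then show "y \<in> (\<lambda>j. j + b - 1) ` {1..L}"
        using b by (intro image_eqI[of _ _ "Suc y - b"]) (auto simp: L_def)
    qed (use b in \<open>auto simp: L_def\<close>)
    have "(\<Prod>y\<in>{b..?L x}. 1 - 1 / (w - (of_nat y - of_nat x))\<^sup>2)
        = (\<Prod>j\<in>{1..L}. 1 - 1 / (w - (of_nat (j + b - 1) - of_nat x))\<^sup>2)"
      unfolding im using b by (subst prod.reindex) (auto simp: inj_on_def)
    also have "\<dots> = (\<Prod>j\<in>{1..L}. 1 - 1 / (a + of_nat j)\<^sup>2)"
    proof (rule prod.cong[OF refl])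
      fix j assume "j \<in> {1..L}"
      have "w - (of_nat (j + b - 1) - of_nat x) = - (a + of_nat j)"
        using b by (simp add: a_def of_nat_diff algebra_simps)
      then show "1 - 1 / (w - (of_nat (j + b - 1) - of_nat x))\<^sup>2 = 1 - 1 / (a + of_nat j)\<^sup>2"
        by (simp only: power2_minus)
    qed
    also have "\<dots> = a * (a + of_nat L + 1) / ((a + of_nat L) * (a + 1))" by (rule telescope_squares[OF a])
    also have "a = - (w - of_nat b + of_nat x + 1)" by (simp add: a_def)
    also have "of_nat L = of_nat (?L x) + 1 - (of_nat b :: 'k)" using bL by (simp add: L_def of_nat_diff)
    finally show ?thesis
    proof (rule trans)
      define c e where "c = w - of_nat b + of_nat x" and "e = w - of_nat (?L x) + of_nat x"
      have "- (w - of_nat b + of_nat x + 1) = - (c + 1)" "- (w - of_nat b + of_nat x + 1) + 1 = - c"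
        "- (w - of_nat b + of_nat x + 1) + (of_nat (?L x) + 1 - of_nat b) = - e"
        "- (w - of_nat b + of_nat x + 1) + (of_nat (?L x) + 1 - of_nat b) + 1 = - (e - 1)"
        by (simp_all add: c_def e_def algebra_simps)
      moreover have "- (C + 1) * - (E - 1) / (- E * - C) = (C + 1) / C * ((E - 1) / E)" for C E :: 'k
        by (simp only: minus_mult_minus times_divide_times_eq mult.commute[of E C])
      ultimately show "- (w - of_nat b + of_nat x + 1) * (- (w - of_nat b + of_nat x + 1) + (of_nat (?L x) + 1 - of_nat b) + 1)
        / ((- (w - of_nat b + of_nat x + 1) + (of_nat (?L x) + 1 - of_nat b)) * (- (w - of_nat b + of_nat x + 1) + 1))
        = ((w - of_nat b + of_nat x + 1) / (w - of_nat b + of_nat x)) *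
        ((w - of_nat (?L x) + of_nat x - 1) / (w - of_nat (?L x) + of_nat x))"
        by (simp only: c_def[symmetric] e_def[symmetric])
    qed
  qed
  have cols: "w * (\<Prod>y\<in>{1..<b}. (w - of_nat y) / (w - of_nat y + 1)) = w - of_nat b + 1"
    using b
  proof (induction b rule: dec_induct)
    case (step b)
    have "{1..<Suc b} = insert b {1..<b}" using step by auto
    then have "w * (\<Prod>y\<in>{1..<Suc b}. (w - of_nat y) / (w - of_nat y + 1))
      = (w - of_nat b) / (w - of_nat b + 1) * (w * (\<Prod>y\<in>{1..<b}. (w - of_nat y) / (w - of_nat y + 1)))"
      by simp
    also have "\<dots> = w - of_nat b" using step nz'[of b 1] by simp
    finally show ?case by simp
  qed simp
  have rows: "(w - of_nat b + 1) * (\<Prod>x\<in>{1..?s}. (w - of_nat b + of_nat x + 1) / (w - of_nat b + of_nat x))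
      = w - of_nat b + 1 + of_nat ?s"
  proof -
    have cancel: "c \<noteq> 0 \<Longrightarrow> c * (a / c) = a" for a c :: 'k by simp
    have ne: "w - of_nat b + 1 \<noteq> 0" using nz'[of b 1] by simp
    have "(\<Prod>x\<in>{1..?s}. (w - of_nat b + of_nat x + 1) / (w - of_nat b + of_nat x))
      = (w - of_nat b + of_nat ?s + 1) / (w - of_nat b + 1)"
      by (rule telescope_quotient[OF nz'])
    then show ?thesis using cancel[OF ne, of "w - of_nat b + of_nat ?s + 1"] by simp
  qed
  have "(\<Prod>(x, y)\<in>comp_nodes D p m. 1 - 1 / (w - (of_nat y - of_nat x))\<^sup>2)
     = (\<Prod>y\<in>{1..<b}. (w - of_nat y) / (w - of_nat y + 1) * ((w - of_nat y + of_nat (?h y) + 1) / (w - of_nat y + of_nat (?h y)))) *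
       (\<Prod>x\<in>{1..?s}. ((w - of_nat b + of_nat x + 1) / (w - of_nat b + of_nat x)) *
        ((w - of_nat (?L x) + of_nat x - 1) / (w - of_nat (?L x) + of_nat x)))"
    unfolding comp_nodes_split[OF S b] using rowp by (simp only: colp cong: prod.cong)
  then have "w * (\<Prod>(x, y)\<in>comp_nodes D p m. 1 - 1 / (w - (of_nat y - of_nat x))\<^sup>2)
    = (w * (\<Prod>y\<in>{1..<b}. (w - of_nat y) / (w - of_nat y + 1))) *
      (\<Prod>x\<in>{1..?s}. (w - of_nat b + of_nat x + 1) / (w - of_nat b + of_nat x)) * hook_factor D p b m w"
    unfolding hook_factor_def prod.distrib by (simp only: mult_ac)
  then show ?thesis unfolding cols rows .
qed

text \<open>
  The components are treated separately. The factor that vanishes at the content of the new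
  node comes from the component of that node.
\<close>

lemma content_product_hook_ratio:
  fixes u :: "'k::field"
  assumes S: "shape r d D" and \<nu>: "\<nu> \<in> addable r d D p"
    and nz: "\<And>i::int. \<And>m. m \<in> {1..d} \<Longrightarrow> u - v m + of_int i \<noteq> 0"
  shows "(\<Prod>m\<in>{1..d}. u - v m) * (\<Prod>\<theta>\<in>{\<theta>\<in>D. node_pr \<theta> = p}. 1 - 1 / (u - node_content v \<theta>)\<^sup>2)
    = (u - node_content v \<nu>) * hook_ratio d v D \<nu> u"
proof -
  obtain a b l where \<nu>': "\<nu> = ((a, b), p, l)" and ab: "1 \<le> a" "1 \<le> b" "l \<in> {1..d}"
    by (rule addableD[OF S \<nu>]) blast
  let ?N = "Sigma {1..d} (comp_nodes D p)"
  have fin: "finite (comp_nodes D p m)" for m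
  proof -
    have "(\<lambda>b. (b, p, m)) ` comp_nodes D p m \<subseteq> D" by (auto simp: comp_nodes_def)
    then show ?thesis using finite_subset[OF _ shape_finite[OF S]] by (meson finite_imageD inj_onI prod.inject)
  qed
  have "(\<Prod>\<theta>\<in>{\<theta>\<in>D. node_pr \<theta> = p}. 1 - 1 / (u - node_content v \<theta>)\<^sup>2)
    = (\<Prod>(m, z)\<in>?N. 1 - 1 / (u - node_content v (z, p, m))\<^sup>2)"
  proof (rule prod.reindex_bij_witness[of _ "\<lambda>(m, z). (z, p, m)" "\<lambda>\<theta>. (node_pd \<theta>, fst \<theta>)"])
    fix \<theta> assume a: "\<theta> \<in> {\<theta>\<in>D. node_pr \<theta> = p}"
    obtain x y m where e: "\<theta> = ((x, y), p, m)" using a by (cases \<theta>) auto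
    then have "((x, y), p, m) \<in> D" using a by simp
    then show "(node_pd \<theta>, fst \<theta>) \<in> ?N" using shapeD(4)[OF S] by (auto simp: e comp_nodes_def)
    show "(case (node_pd \<theta>, fst \<theta>) of (m, z) \<Rightarrow> (z, p, m)) = \<theta>" by (simp add: e)
    show "(case (node_pd \<theta>, fst \<theta>) of (m, z) \<Rightarrow> 1 - 1 / (u - node_content v (z, p, m))\<^sup>2) =
      1 - 1 / (u - node_content v \<theta>)\<^sup>2" by (simp add: e)
  qed (auto simp: comp_nodes_def)
  also have "\<dots> = (\<Prod>m\<in>{1..d}. \<Prod>z\<in>comp_nodes D p m. 1 - 1 / (u - node_content v (z, p, m))\<^sup>2)"
    using fin by (subst prod.Sigma) auto
  finally have "(\<Prod>m\<in>{1..d}. u - v m) * (\<Prod>\<theta>\<in>{\<theta>\<in>D. node_pr \<theta> = p}. 1 - 1 / (u - node_content v \<theta>)\<^sup>2)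
    = (\<Prod>m\<in>{1..d}. (u - v m) * (\<Prod>z\<in>comp_nodes D p m. 1 - 1 / (u - node_content v (z, p, m))\<^sup>2))"
    by (simp add: prod.distrib)
  also have "\<dots> = (\<Prod>m\<in>{1..d}. (u - v m - of_nat b + 1 + of_nat (col D p m b)) * hook_factor D p b m (u - v m))"
  proof (rule prod.cong[OF refl])
    fix m assume m: "m \<in> {1..d}"
    have "(\<Prod>z\<in>comp_nodes D p m. 1 - 1 / (u - node_content v (z, p, m))\<^sup>2)
      = (\<Prod>(x, y)\<in>comp_nodes D p m. 1 - 1 / (u - v m - (of_nat y - of_nat x))\<^sup>2)"
      by (rule prod.cong) (auto simp: node_content_def algebra_simps)
    then show "(u - v m) * (\<Prod>z\<in>comp_nodes D p m. 1 - 1 / (u - node_content v (z, p, m))\<^sup>2)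
      = (u - v m - of_nat b + 1 + of_nat (col D p m b)) * hook_factor D p b m (u - v m)"
      using comp_telescope[OF S ab(2) nz[OF m], of p m] by simp
  qed
  also have "\<dots> = (\<Prod>m\<in>{1..d}. u - v m - of_nat b + 1 + of_nat (col D p m b)) * (\<Prod>m\<in>{1..d}. hook_factor D p b m (u - v m))"
    by (rule prod.distrib)
  also have "(\<Prod>m\<in>{1..d}. u - v m - of_nat b + 1 + of_nat (col D p m b))
     = (u - v l - of_nat b + 1 + of_nat (col D p l b)) * (\<Prod>m\<in>{1..d} - {l}. u - v m - of_nat b + 1 + of_nat (col D p m b))"
    using ab(3) by (simp add: prod.remove)
  also have "u - v l - of_nat b + 1 + of_nat (col D p l b) = u - node_content v \<nu>"
    using addable_row_col(2)[OF S \<nu>[unfolded \<nu>']] ab(1) by (simp add: \<nu>' node_content_def of_nat_diff)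
  finally show ?thesis by (simp add: hook_ratio_def \<nu>' mult.assoc)
qed

lemma row_insert:
  assumes "finite D" "((a, b), p', l') \<notin> D"
  shows "row (insert ((a, b), p', l') D) p l x = row D p l x + (if p = p' \<and> l = l' \<and> x = a then 1 else 0)"
proof -
  have fin: "finite {y. ((x, y), p, l) \<in> D}"
    using assms(1) by (rule finite_surj[of _ _ "\<lambda>\<theta>. snd (fst \<theta>)"]) force
  have "{y. ((x, y), p, l) \<in> insert ((a, b), p', l') D}
    = (if p = p' \<and> l = l' \<and> x = a then insert b {y. ((x, y), p, l) \<in> D} else {y. ((x, y), p, l) \<in> D})"
    by auto
  then show ?thesis using fin assms(2)
    by (cases "p = p' \<and> l = l' \<and> x = a") (auto simp: row_def)
qed

lemma col_insert:
  assumes "finite D" "((a, b), p', l') \<notin> D"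
  shows "col (insert ((a, b), p', l') D) p l y = col D p l y + (if p = p' \<and> l = l' \<and> y = b then 1 else 0)"
proof -
  have fin: "finite {x. ((x, y), p, l) \<in> D}"
    using assms(1) by (rule finite_surj[of _ _ "\<lambda>\<theta>. fst (fst \<theta>)"]) force
  have "{x. ((x, y), p, l) \<in> insert ((a, b), p', l') D}
    = (if p = p' \<and> l = l' \<and> y = b then insert a {x. ((x, y), p, l) \<in> D} else {x. ((x, y), p, l) \<in> D})"
    by auto
  then show ?thesis using fin assms(2)
    by (cases "p = p' \<and> l = l' \<and> y = b") (auto simp: col_def)
qed

text \<open>
  The denominators are the hooks in the row and in the column of the new node, up to sign, and
  therefore do not vanish.
\<close>

lemma hook_ratio_denominators:
  assumes S: "shape r d D" and \<nu>: "((a, b), p, l) \<in> addable r d D p"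
    and sep: "separated n d v" and n: "card D \<le> n" and m: "m \<in> {1..d}"
  defines "w \<equiv> node_content v ((a, b), p, l) - v m"
  shows "y \<in> {1..<b} \<Longrightarrow> hk D v ((a, y), p, l) m = w - of_nat y + of_nat (col D p m y)"
    and "y \<in> {1..<b} \<Longrightarrow> ((a, y), p, l) \<in> D"
    and "y \<in> {1..<b} \<Longrightarrow> w - of_nat y + of_nat (col D p m y) \<noteq> 0"
    and "x \<in> {1..col D p m b} \<Longrightarrow> hk D v ((x, b), p, m) l = - (w - of_nat (row D p m x) + of_nat x)"
    and "x \<in> {1..col D p m b} \<Longrightarrow> ((x, b), p, m) \<in> D"
    and "x \<in> {1..col D p m b} \<Longrightarrow> w - of_nat (row D p m x) + of_nat x \<noteq> 0"
proof -
  note rc = addable_row_col[OF S \<nu>]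
  have l: "l \<in> {1..d}" using shape_node(2)[of r d "insert ((a, b), p, l) D" "((a, b), p, l)"] \<nu> by (simp add: addable_def)
  show A: "((a, y), p, l) \<in> D" if "y \<in> {1..<b}" using mem_row[OF S, of a y p l] that rc by auto
  show B: "hk D v ((a, y), p, l) m = w - of_nat y + of_nat (col D p m y)" if "y \<in> {1..<b}"
    using rc by (simp add: w_def node_content_def of_nat_diff)
  show "w - of_nat y + of_nat (col D p m y) \<noteq> 0" if "y \<in> {1..<b}"
    using hk_nonzero[OF S sep n A[OF that] m] unfolding B[OF that] .
  show C: "((x, b), p, m) \<in> D" if "x \<in> {1..col D p m b}" using mem_col[OF S, of x b p m] that by auto
  show E: "hk D v ((x, b), p, m) l = - (w - of_nat (row D p m x) + of_nat x)" if "x \<in> {1..col D p m b}"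
    using rc by (simp add: w_def node_content_def of_nat_diff)
  show "w - of_nat (row D p m x) + of_nat x \<noteq> 0" if "x \<in> {1..col D p m b}"
    using hk_nonzero[OF S sep n C[OF that] l] unfolding E[OF that] neg_equal_0_iff_equal .
qed

text \<open>
  Adding a node in row \<open>a\<close> and column \<open>b\<close> of component \<open>l\<close> changes, besides creating the hooks of
  the node itself, only the hooks of nodes in row \<open>a\<close> of this component with respect to any
  component, and the hooks with respect to \<open>l\<close> of nodes in column \<open>b\<close> of any component; each of
  them increases by 1.
\<close>

lemma hook_product_insert:
  assumes S: "shape r d D" and \<nu>: "\<nu> \<in> addable r d D p"
    and sep: "separated n d v" and n: "card D \<le> n"
  shows "hook_product d v (insert \<nu> D) = hook_product d v D * hook_ratio d v D \<nu> (node_content v \<nu>)"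
proof -
  obtain a b l where e: "\<nu> = ((a, b), p, l)" and ab: "1 \<le> a" "1 \<le> b" "l \<in> {1..d}" and nD: "((a, b), p, l) \<notin> D"
    by (rule addableD[OF S \<nu>]) blast
  note f = shape_finite[OF S]
  note \<nu>' = \<nu>[unfolded e]
  note rc = addable_row_col[OF S \<nu>']
  note den = hook_ratio_denominators[OF S \<nu>' sep n]
  let ?D = "insert ((a, b), p, l) D" and ?M = "{1..d}"
  let ?c = "node_content v ((a, b), p, l)"
  have hkD: "hk ?D v ((x, y), q, k) m = hk D v ((x, y), q, k) m
      + (if q = p \<and> k = l \<and> x = a then 1 else 0) + (if q = p \<and> m = l \<and> y = b then 1 else 0)" for x y q k m
    by (simp add: row_insert[OF f nD] col_insert[OF f nD])
  \<comment> \<open>The factor by which a hook changes.\<close>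
  define \<rho> where "\<rho> \<theta>m = hk ?D v (fst \<theta>m) (snd \<theta>m) / hk D v (fst \<theta>m) (snd \<theta>m)" for \<theta>m
  have "(\<Prod>\<theta>\<in>D. \<Prod>m\<in>?M. hk ?D v \<theta> m) = (\<Prod>\<theta>m\<in>D \<times> ?M. hk D v (fst \<theta>m) (snd \<theta>m) * \<rho> \<theta>m)"
    unfolding prod.cartesian_product
  proof (rule prod.cong[OF refl])
    fix \<theta>m assume a: "\<theta>m \<in> D \<times> ?M"
    obtain x y q k m where z: "\<theta>m = (((x, y), q, k), m)" by (metis surj_pair)
    have "hk D v ((x, y), q, k) m \<noteq> 0" using a by (intro hk_nonzero[OF S sep n]) (auto simp: z)
    then show "(case \<theta>m of (\<theta>, m) \<Rightarrow> hk ?D v \<theta> m) = hk D v (fst \<theta>m) (snd \<theta>m) * \<rho> \<theta>m"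
      by (simp add: z \<rho>_def del: hk_simp)
  qed
  also have "\<dots> = hook_product d v D * (\<Prod>\<theta>m\<in>D \<times> ?M. \<rho> \<theta>m)"
    by (simp add: prod.distrib hook_product_def prod.cartesian_product case_prod_beta del: hk_simp)
  finally have 1: "(\<Prod>\<theta>\<in>D. \<Prod>m\<in>?M. hk ?D v \<theta> m) = hook_product d v D * (\<Prod>\<theta>m\<in>D \<times> ?M. \<rho> \<theta>m)" .
  let ?I1 = "Sigma ?M (\<lambda>m. {1..<b})" and ?I2 = "Sigma ?M (\<lambda>m. {1..col D p m b})"
  let ?f1 = "\<lambda>(m, y). (((a, y), p, l), m)" and ?f2 = "\<lambda>(m, x). (((x, b), p, m), l)"
  have sub: "?f1 ` ?I1 \<union> ?f2 ` ?I2 \<subseteq> D \<times> ?M"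
    using den(2) den(5) ab(3) by auto
  have one: "\<rho> \<theta>m = 1" if "\<theta>m \<in> D \<times> ?M - (?f1 ` ?I1 \<union> ?f2 ` ?I2)" for \<theta>m
  proof -
    obtain x y q k m where z: "\<theta>m = (((x, y), q, k), m)" by (metis surj_pair)
    have D: "((x, y), q, k) \<in> D" and m: "m \<in> ?M" using that by (auto simp: z)
    have "\<not> (q = p \<and> k = l \<and> x = a)"
    proof
      assume c: "q = p \<and> k = l \<and> x = a"
      then have "(m, y) \<in> ?I1" using D m mem_row[OF S, of a y p l] rc by auto
      then have "?f1 (m, y) \<in> ?f1 ` ?I1" by (rule imageI)
      then show False using that c by (simp add: z)
    qed
    moreover have "\<not> (q = p \<and> m = l \<and> y = b)"
    proof
      assume c: "q = p \<and> m = l \<and> y = b"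
      then have "(k, x) \<in> ?I2" using D mem_col[OF S, of x b p k] shapeD(4)[OF S D] by auto
      then have "?f2 (k, x) \<in> ?f2 ` ?I2" by (rule imageI)
      then show False using that c by (simp add: z)
    qed
    moreover have "hk D v ((x, y), q, k) m \<noteq> 0" by (rule hk_nonzero[OF S sep n D m])
    ultimately have "hk ?D v ((x, y), q, k) m = hk D v ((x, y), q, k) m" "hk D v ((x, y), q, k) m \<noteq> 0"
      by (simp_all only: hkD if_False add_0_right not_False_eq_True)
    then show ?thesis by (simp add: \<rho>_def z del: hk_simp)
  qed
  have "(\<Prod>\<theta>m\<in>D \<times> ?M. \<rho> \<theta>m) = (\<Prod>\<theta>m\<in>?f1 ` ?I1 \<union> ?f2 ` ?I2. \<rho> \<theta>m)"
    using f sub one by (intro prod.mono_neutral_right) auto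
  also have "\<dots> = (\<Prod>\<theta>m\<in>?f1 ` ?I1. \<rho> \<theta>m) * (\<Prod>\<theta>m\<in>?f2 ` ?I2. \<rho> \<theta>m)"
    by (rule prod.union_disjoint) auto
  also have "(\<Prod>\<theta>m\<in>?f1 ` ?I1. \<rho> \<theta>m) = (\<Prod>i\<in>?I1. \<rho> (?f1 i))"
    by (subst prod.reindex) (auto simp: inj_on_def)
  also have "\<dots> = (\<Prod>m\<in>?M. \<Prod>y\<in>{1..<b}. \<rho> (((a, y), p, l), m))"
    by (subst prod.Sigma) (auto simp: case_prod_beta)
  also have "\<dots> = (\<Prod>m\<in>?M. \<Prod>y\<in>{1..<b}.
     (?c - v m - of_nat y + of_nat (col D p m y) + 1) / (?c - v m - of_nat y + of_nat (col D p m y)))"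
  proof (intro prod.cong refl)
    fix m y assume my: "m \<in> ?M" "y \<in> {1..<b}"
    show "\<rho> (((a, y), p, l), m) = (?c - v m - of_nat y + of_nat (col D p m y) + 1) / (?c - v m - of_nat y + of_nat (col D p m y))"
      using my(2) unfolding \<rho>_def fst_conv snd_conv hkD den(1)[OF my] by simp
  qed
  also have "(\<Prod>\<theta>m\<in>?f2 ` ?I2. \<rho> \<theta>m) = (\<Prod>i\<in>?I2. \<rho> (?f2 i))"
    by (subst prod.reindex) (auto simp: inj_on_def)
  also have "\<dots> = (\<Prod>m\<in>?M. \<Prod>x\<in>{1..col D p m b}. \<rho> (((x, b), p, m), l))"
    by (subst prod.Sigma) (auto simp: case_prod_beta)
  also have "\<dots> = (\<Prod>m\<in>?M. \<Prod>x\<in>{1..col D p m b}.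
     (?c - v m - of_nat (row D p m x) + of_nat x - 1) / (?c - v m - of_nat (row D p m x) + of_nat x))"
  proof (intro prod.cong refl)
    fix m x assume mx: "m \<in> ?M" "x \<in> {1..col D p m b}"
    have neg: "- A / - B = A / B" for A B :: 'a by simp
    have "\<not> (m = l \<and> x = a)" using mx rc by auto
    then have "hk ?D v ((x, b), p, m) l = - (?c - v m - of_nat (row D p m x) + of_nat x - 1)"
      unfolding hkD den(4)[OF mx] by auto
    then show "\<rho> (((x, b), p, m), l) = (?c - v m - of_nat (row D p m x) + of_nat x - 1) / (?c - v m - of_nat (row D p m x) + of_nat x)"
      unfolding \<rho>_def fst_conv snd_conv den(4)[OF mx] by (simp only: neg)
  qed
  finally have 2: "(\<Prod>\<theta>m\<in>D \<times> ?M. \<rho> \<theta>m) = (\<Prod>m\<in>?M. hook_factor D p b m (?c - v m))"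
    by (simp add: hook_factor_def prod.distrib)
  have "(\<Prod>m\<in>?M. hk ?D v ((a, b), p, l) m) = hk ?D v ((a, b), p, l) l * (\<Prod>m\<in>?M - {l}. hk ?D v ((a, b), p, l) m)"
    using ab(3) by (simp add: prod.remove)
  also have "hk ?D v ((a, b), p, l) l = 1"
    unfolding hkD using rc ab by (simp add: of_nat_diff)
  also have "(\<Prod>m\<in>?M - {l}. hk ?D v ((a, b), p, l) m) = (\<Prod>m\<in>?M - {l}. ?c - v m - of_nat b + 1 + of_nat (col D p m b))"
    unfolding hkD using rc ab by (intro prod.cong refl) (simp add: of_nat_diff node_content_def)
  finally have 3: "(\<Prod>m\<in>?M. hk ?D v ((a, b), p, l) m) = (\<Prod>m\<in>?M - {l}. ?c - v m - of_nat b + 1 + of_nat (col D p m b))" by simp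
  have "hook_product d v ?D = (\<Prod>m\<in>?M. hk ?D v ((a, b), p, l) m) * (\<Prod>\<theta>\<in>D. \<Prod>m\<in>?M. hk ?D v \<theta> m)"
    unfolding hook_product_def using f nD by simp
  then show ?thesis unfolding e 1 2 3 by (simp add: hook_ratio_def)
qed

section \<open>Weights are contents of standard tableaux\<close>

locale separated_yokonuma = yokonuma J kap x t g e n r d v zt
  for J :: "'a::ring_1 set" and kap :: "'f::field \<Rightarrow> 'a" and x t g e n r d v zt +
  assumes sep: "separated n d v" and n_pos: "1 \<le> n"
begin

definition weight :: "nat \<Rightarrow> (nat \<Rightarrow> 'f \<times> nat) \<Rightarrow> bool" where
  "weight k s \<longleftrightarrow> (\<exists>z. wt k s z \<and> \<not> z \<approx> 0)"

definition matches :: "(nat \<Rightarrow> node) \<Rightarrow> (nat \<Rightarrow> 'f \<times> nat) \<Rightarrow> nat \<Rightarrow> bool" where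
  "matches \<theta> s k \<longleftrightarrow> (\<forall>j\<in>{1..k}. s j = (node_content v (\<theta> j), node_pr (\<theta> j)))"

text \<open>
  Two statements that are proved together by induction on \<open>k\<close>: the first \<open>k\<close> entries of a weight
  come from a standard tableau, and \<open>x\<^sub>k\<^sub>+\<^sub>1\<close> is diagonalisable on such weight vectors, with
  contents of addable nodes as eigenvalues.
\<close>

definition tabular :: "nat \<Rightarrow> bool" where
  "tabular k \<longleftrightarrow> (\<forall>s. weight k s \<longrightarrow> (\<exists>\<theta>. growth r d k \<theta> \<and> matches \<theta> s k))"

definition diagonalisable :: "nat \<Rightarrow> bool" where
  "diagonalisable k \<longleftrightarrow> (\<forall>\<theta> s z. growth r d k \<theta> \<longrightarrow> matches \<theta> s k \<longrightarrow> wt k s z \<longrightarrow> Suc k \<le> n \<longrightarrow>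
     (\<exists>as. distinct as \<and> set as \<subseteq> node_content v ` addable r d (\<theta> ` {1..k}) (snd (s (Suc k))) \<and>
        pl (x (Suc k)) as * z \<approx> 0))"

lemma weight_mono: "weight k s \<Longrightarrow> l \<le> k \<Longrightarrow> weight l s"
  unfolding weight_def using wt_mono by blast

lemma weight_position: "weight k s \<Longrightarrow> j \<in> {1..n} \<Longrightarrow> snd (s j) \<in> {1..r}"
  by (auto simp: weight_def wt_def twt_def)

lemma of_int_nonzero: "m \<noteq> 0 \<Longrightarrow> \<bar>m\<bar> \<le> int n \<Longrightarrow> of_int m \<noteq> (0::'f)"
  using sep unfolding separated_def by blast

lemma two_nonzero: "2 \<le> n \<Longrightarrow> (2::'f) \<noteq> 0"
  using of_int_nonzero[of 2] by simp

text \<open>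
  The intertwiner does not kill the weight vector unless the entries are equal or adjacent.
\<close>

lemma weight_swap:
  assumes W: "weight k s" and k: "k \<le> n" "1 \<le> i" "Suc i \<le> k" and ne: "s i \<noteq> s (Suc i)"
    and nadj: "\<And>c. c \<in> {-1, 1} \<Longrightarrow> s (Suc i) \<noteq> (fst (s i) + of_int c, snd (s i))"
  shows "weight k (s \<circ> sw i)"
proof -
  have i: "i \<in> {1..<n}" using k by auto
  obtain z where z: "wt k s z" "\<not> z \<approx> 0" using W by (auto simp: weight_def)
  show ?thesis
  proof (cases "snd (s i) = snd (s (Suc i))")
    case False
    have "\<not> g i * z \<approx> 0" using g_cancel[OF i] z(2) by blast
    then show ?thesis
      using wt_swap_different_position[OF z(1) k(1,3,2) False] by (auto simp: weight_def)
  next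
    case True
    have d: "fst (s i) \<noteq> fst (s (Suc i))" using ne True by (auto simp: prod_eq_iff)
    let ?D = "fst (s i) - fst (s (Suc i))"
    let ?b = "1 / ?D"
    note w = wt_swap_same_position[OF z(1) k(1,3,2) True d]
    have "fst (s (Suc i)) \<noteq> fst (s i) + of_int c" if "c \<in> {-1, 1}" for c
      using nadj[OF that] True by (auto simp: prod_eq_iff)
    from this[of 1] this[of "-1"] have "?D \<noteq> -1" "?D \<noteq> 1" by (auto simp: algebra_simps)
    then have "?D\<^sup>2 \<noteq> 1" by (simp add: power2_eq_1_iff)
    then have b: "1 - ?b\<^sup>2 \<noteq> 0" using d by (simp add: power_divide)
    have "\<not> g i * z + kap ?b * z \<approx> 0"
    proof
      assume a: "g i * z + kap ?b * z \<approx> 0"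
      have "kap (1 - ?b\<^sup>2) * z \<approx> g i * (g i * z + kap ?b * z) - kap ?b * (g i * z + kap ?b * z)"
        by (rule cg_sym[OF w(2)])
      also have "\<dots> \<approx> g i * 0 - kap ?b * 0" by (intro cg_diff cg_left a)
      finally have "kap (1 - ?b\<^sup>2) * z \<approx> 0" by simp
      then show False using kap_cancel[OF b] z(2) by blast
    qed
    then show ?thesis using w(1) by (auto simp: weight_def)
  qed
qed

text \<open>
  The exclusion of forbidden patterns in weights of length \<open>k\<close>, given the statements for smaller
  lengths.
\<close>

context
  fixes k :: nat
  assumes k: "k \<le> n" and IH: "\<And>j. Suc j < k \<Longrightarrow> tabular j \<and> diagonalisable j"
begin

lemma no_equal_neighbours:
  assumes W: "weight k s" and i: "1 \<le> i" "Suc i \<le> k"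
  shows "s i \<noteq> s (Suc i)"
proof
  assume e: "s i = s (Suc i)"
  obtain z where z: "wt k s z" "\<not> z \<approx> 0" using W by (auto simp: weight_def)
  have in': "i \<in> {1..<n}" using i k by auto
  obtain j where j: "i = Suc j" using i by (cases i) auto
  have w: "wt j (s \<circ> sw i) (g i * z)"
    using wt_g_below[OF wt_mono[OF z(1)] in', of j] j i by simp
  have gz: "\<not> g i * z \<approx> 0" using g_cancel[OF in'] z(2) by blast
  then have "weight j (s \<circ> sw i)" using w by (auto simp: weight_def)
  moreover have TD: "tabular j" "diagonalisable j" using IH[of j] i j by auto
  ultimately obtain \<theta> where \<theta>: "growth r d j \<theta>" "matches \<theta> (s \<circ> sw i) j"
    unfolding tabular_def by blast
  obtain as where "distinct as" "pl (x (Suc j)) as * (g i * z) \<approx> 0"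
    using TD(2)[unfolded diagonalisable_def, rule_format, OF \<theta> w] i j k by auto
  then show False using wt_equal_neighbours[OF z(1) k i(2,1) e] z(2) j by blast
qed

text \<open>
  If one of the two intertwiners did not vanish, it would produce a weight with two equal
  neighbours; if both vanish, the braid relation is violated.
\<close>

lemma no_return:
  assumes W: "weight k s" and i: "1 \<le> i" "Suc (Suc i) \<le> k" and c: "c \<in> {-1, 1}"
    and s: "s (Suc i) = (fst (s i) + of_int c, snd (s i))" "s (Suc (Suc i)) = s i"
  shows False
proof -
  obtain z where z: "wt k s z" "\<not> z \<approx> 0" using W by (auto simp: weight_def)
  have cc: "of_int c * of_int c = (1::'f)" "of_int c \<noteq> (0::'f)" "1 / of_int c = (of_int c :: 'f)"
    using c by auto
  have A: "g i * z + kap (- of_int c) * z \<approx> 0"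
  proof (rule ccontr)
    have "1 / (fst (s i) - fst (s (Suc i))) = - of_int c" using s cc by simp
    moreover assume "\<not> g i * z + kap (- of_int c) * z \<approx> 0"
    ultimately have "weight k (s \<circ> sw i)"
      using wt_swap_same_position(1)[OF z(1) k, of i] i s cc unfolding weight_def by auto
    from no_equal_neighbours[OF this, of "Suc i"] show False
      using i s by (simp add: Transposition.transpose_def)
  qed
  have B: "g (Suc i) * z - kap (- of_int c) * z \<approx> 0"
  proof (rule ccontr)
    have "1 / (fst (s (Suc i)) - fst (s (Suc (Suc i)))) = of_int c" using s cc by simp
    moreover assume "\<not> g (Suc i) * z - kap (- of_int c) * z \<approx> 0"
    ultimately have "weight k (s \<circ> sw (Suc i))"
      using wt_swap_same_position(1)[OF z(1) k, of "Suc i"] i s cc unfolding weight_def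
      by (auto simp: kap_minus)
    from no_equal_neighbours[OF this, of i] show False
      using i s by (simp add: Transposition.transpose_def)
  qed
  have "z \<approx> 0"
    using i k cc(1) two_nonzero by (intro braid_signs[OF _ _ _ _ A B]) auto
  then show False using z(2) by blast
qed

text \<open>
  Induction on the distance of two equal entries. If the entry next to one of the ends is not
  adjacent to it, an exchange moves the ends closer together, and so does a further occurrence
  of the entry in between. Otherwise both inner entries are adjacent to the ends; if neither
  of them has the wanted value, they are equal and by induction enclose a further occurrence
  after all.
\<close>

lemma neighbours_between:
  assumes "weight k s" "1 \<le> i" "i < j" "j \<le> k" "s i = s j" "c \<in> {-1, 1}"
  shows "\<exists>m\<in>{i<..<j}. s m = (fst (s i) + of_int c, snd (s i))"
  using assms
proof (induction "j - i" arbitrary: i j s c rule: less_induct)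
  case less
  note W = less.prems(1) and ij = less.prems(2-4) and e = less.prems(5) and c = less.prems(6)
  let ?a = "fst (s i)" and ?p = "snd (s i)"
  show ?case
  proof (cases "\<exists>m\<in>{i<..<j}. s m = s i")
    case True
    then obtain m where m: "m \<in> {i<..<j}" "s i = s m" by auto
    then show ?thesis using less.hyps[of m i s c] W ij c by fastforce
  next
    case none: False
    obtain j' where j': "j = Suc j'" using ij by (cases j) auto
    have "Suc i \<noteq> j" using no_equal_neighbours[OF W ij(1)] ij e by auto
    then have ij': "Suc i < j" "i < j'" using ij j' by auto
    have ne: "s i \<noteq> s (Suc i)" "s j' \<noteq> s (Suc j')"
      using none ij' j' e by (auto simp: greaterThanLessThan_iff)
    show ?thesis
    proof (cases "\<exists>b\<in>{-1, 1}. s (Suc i) = (?a + of_int b, ?p)")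
      case False
      then have W': "weight k (s \<circ> sw i)"
        using ij ij' by (intro weight_swap W k ne) auto
      have "\<exists>m\<in>{Suc i<..<j}. (s \<circ> sw i) m = (fst ((s \<circ> sw i) (Suc i)) + of_int c, snd ((s \<circ> sw i) (Suc i)))"
        by (rule less.hyps[OF _ W']) (use ij ij' e c in \<open>auto simp: Transposition.transpose_def\<close>)
      then obtain m where "m \<in> {Suc i<..<j}" "s m = (?a + of_int c, ?p)"
        by (auto simp: Transposition.transpose_def)
      then show ?thesis by (intro bexI[of _ m]) auto
    next
      case True
      then obtain b where b: "b \<in> {-1, 1}" "s (Suc i) = (?a + of_int b, ?p)" by blast
      show ?thesis
      proof (cases "\<exists>b\<in>{-1, 1}. s j' = (?a + of_int b, ?p)")
        case False
        have W': "weight k (s \<circ> sw j')"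
        proof (rule weight_swap[OF W k])
          fix b :: int assume b: "b \<in> {-1, 1}"
          show "s (Suc j') \<noteq> (fst (s j') + of_int b, snd (s j'))"
          proof
            assume "s (Suc j') = (fst (s j') + of_int b, snd (s j'))"
            then have "s j' = (?a + of_int (- b), ?p)" using e j' by (auto simp: prod_eq_iff)
            moreover have "- b \<in> {-1, 1}" using b by auto
            ultimately show False using False by blast
          qed
        qed (use ij ij' j' ne in auto)
        have "\<exists>m\<in>{i<..<j'}. (s \<circ> sw j') m = (fst ((s \<circ> sw j') i) + of_int c, snd ((s \<circ> sw j') i))"
          by (rule less.hyps[OF _ W']) (use ij ij' e c j' in \<open>auto simp: Transposition.transpose_def\<close>)
        then obtain m where m: "m \<in> {i<..<j'}" "(s \<circ> sw j') m = (?a + of_int c, ?p)"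
          using ij' by (auto simp: Transposition.transpose_def)
        then have "s m = (?a + of_int c, ?p)" by (auto simp: Transposition.transpose_def)
        then show ?thesis using m(1) j' by (intro bexI[of _ m]) auto
      next
        case True
        then obtain b' where b': "b' \<in> {-1, 1}" "s j' = (?a + of_int b', ?p)" by blast
        consider "b = c" | "b' = c" | "b = - c" "b' = - c" using b b' c by auto
        then show ?thesis
        proof cases
          case 1
          then show ?thesis using b ij' by (intro bexI[of _ "Suc i"]) auto
        next
          case 2
          then show ?thesis using b' ij' j' by (intro bexI[of _ j']) auto
        next
          case 3
          have "Suc i \<noteq> j'"
          proof
            assume "Suc i = j'"
            then show False using no_return[OF W ij(1) _ b(1) b(2)] ij e j' by simp
          qed
          then have "\<exists>m\<in>{Suc i<..<j'}. s m = (fst (s (Suc i)) + of_int c, snd (s (Suc i)))"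
            by (intro less.hyps[OF _ W]) (use ij ij' b(2) b'(2) 3 c j' in auto)
          then obtain m where m: "m \<in> {Suc i<..<j'}" "s m = (?a, ?p)"
            using b(2) 3 by auto
          then have "m \<in> {i<..<j}" "s m = s i" using j' by auto
          then show ?thesis using none by blast
        qed
      qed
    qed
  qed
qed

text \<open>
  As long as the entry is neither equal nor adjacent to its predecessor, it can be exchanged
  with it; an entry that arrives at the first place is a root of the cyclotomic relation.
\<close>

lemma new_content:
  assumes "weight k s" "1 \<le> j" "j \<le> k"
  shows "(\<exists>l\<in>{1..d}. fst (s j) = v l) \<or>
    (\<exists>m\<in>{1..<j}. \<exists>c\<in>{-1, 0, 1}. s m = (fst (s j) + of_int c, snd (s j)))"
  using assms(2,1,3)
proof (induction j arbitrary: s rule: dec_induct)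
  case base
  obtain z where z: "wt k s z" "\<not> z \<approx> 0" using base by (auto simp: weight_def)
  let ?vs = "map v [1..<Suc d]"
  have "pl (x 1) ?vs * z \<approx> 0" using cg_right[OF cyclotomic[OF n_pos], of z] by simp
  moreover have "x 1 * z \<approx> kap (fst (s 1)) * z" using z(1) base by (auto simp: wt_def)
  ultimately have "kap (pv (fst (s 1)) ?vs) * z \<approx> 0"
    using cg_trans[OF cg_sym[OF pl_eig]] by blast
  then have "pv (fst (s 1)) ?vs = 0" using kap_cancel z(2) by blast
  then have "fst (s 1) \<in> set ?vs" using pv_nonzero by blast
  then show ?case by (auto simp del: upt_Suc)
next
  case (step j)
  show ?case
  proof (cases "\<exists>c\<in>{-1, 0, 1}. s j = (fst (s (Suc j)) + of_int c, snd (s (Suc j)))")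
    case True
    then show ?thesis using step.hyps by auto
  next
    case False
    have W': "weight k (s \<circ> sw j)"
    proof (rule weight_swap[OF step.prems(1) k])
      show "s j \<noteq> s (Suc j)"
        using False by (metis add.right_neutral insert_iff of_int_0 prod.collapse)
      fix c :: int assume c: "c \<in> {-1, 1}"
      show "s (Suc j) \<noteq> (fst (s j) + of_int c, snd (s j))"
      proof
        assume "s (Suc j) = (fst (s j) + of_int c, snd (s j))"
        then have "s j = (fst (s (Suc j)) + of_int (- c), snd (s (Suc j)))" by (simp add: prod_eq_iff)
        moreover have "- c \<in> {-1, 0, 1}" using c by auto
        ultimately show False using False by blast
      qed
    qed (use step in auto)
    have "(\<exists>l\<in>{1..d}. fst ((s \<circ> sw j) j) = v l) \<or>
      (\<exists>m\<in>{1..<j}. \<exists>c\<in>{-1, 0, 1}. (s \<circ> sw j) m = (fst ((s \<circ> sw j) j) + of_int c, snd ((s \<circ> sw j) j)))"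
      by (rule step.IH[OF W']) (use step.prems in simp)
    then show ?thesis
    proof
      assume "\<exists>m\<in>{1..<j}. \<exists>c\<in>{-1, 0, 1}. (s \<circ> sw j) m = (fst ((s \<circ> sw j) j) + of_int c, snd ((s \<circ> sw j) j))"
      then obtain m c where "m \<in> {1..<j}" "c \<in> {-1, 0, 1::int}"
        "(s \<circ> sw j) m = (fst ((s \<circ> sw j) j) + of_int c, snd ((s \<circ> sw j) j))" by blast
      moreover from this have "s m = (fst (s (Suc j)) + of_int c, snd (s (Suc j)))"
        by (simp add: Transposition.transpose_def split: if_splits)
      ultimately show ?thesis by (intro disjI2 bexI[of _ m] bexI[of _ c]) auto
    qed simp
  qed
qed

lemma weight_addable:
  assumes W: "weight k s" and k1: "k = Suc m" and G: "growth r d m \<theta>" and M: "matches \<theta> s m"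
  shows "\<exists>\<nu>\<in>addable r d (\<theta> ` {1..m}) (snd (s k)). node_content v \<nu> = fst (s k)"
proof (rule content_addable[OF G sep])
  have s: "s j = (node_content v (\<theta> j), node_pr (\<theta> j))" if "j \<in> {1..m}" for j
    using M that by (simp add: matches_def)
  show "m < n" using k k1 by simp
  show "snd (s k) \<in> {1..r}" using weight_position[OF W, of k] k k1 by simp
  show "\<exists>j\<in>{i<..m}. node_pr (\<theta> j) = snd (s k) \<and> node_content v (\<theta> j) = fst (s k) + of_int c"
    if i: "i \<in> {1..m}" "node_pr (\<theta> i) = snd (s k)" "node_content v (\<theta> i) = fst (s k)" "c \<in> {-1, 1}" for i c
  proof -
    have "s i = s k" using s[OF i(1)] i by (simp add: prod_eq_iff)
    then obtain j where j: "j \<in> {i<..<k}" "s j = (fst (s i) + of_int c, snd (s i))"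
      using neighbours_between[OF W, of i k c] i k1 by auto
    then have "j \<in> {1..m}" using i(1) k1 by auto
    then show ?thesis using j s[of j] \<open>s i = s k\<close> k1 by (intro bexI[of _ j]) auto
  qed
  show "(\<exists>l\<in>{1..d}. fst (s k) = v l) \<or>
    (\<exists>j\<in>{1..m}. \<exists>c\<in>{-1, 0, 1}. node_pr (\<theta> j) = snd (s k) \<and> node_content v (\<theta> j) = fst (s k) + of_int c)"
  proof -
    have "1 \<le> k" using k1 by simp
    from new_content[OF W this le_refl] show ?thesis
  proof (elim disjE)
    assume "\<exists>j\<in>{1..<k}. \<exists>c\<in>{-1, 0, 1}. s j = (fst (s k) + of_int c, snd (s k))"
    then obtain j c where jc: "j \<in> {1..<k}" "c \<in> {-1, 0, 1::int}" "s j = (fst (s k) + of_int c, snd (s k))"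
      by blast
    then have "j \<in> {1..m}" using k1 by auto
    then show ?thesis using jc s[of j] by (intro disjI2 bexI[of _ j] bexI[of _ c]) auto
  qed simp
  qed
qed

end

lemma tabular_step:
  assumes "k \<le> n" "\<And>j. j < k \<Longrightarrow> tabular j \<and> diagonalisable j"
  shows "tabular k"
proof (cases k)
  case 0
  have "growth r d 0 \<theta>" for \<theta> by (simp add: growth_def)
  then show ?thesis by (auto simp: tabular_def matches_def 0)
next
  case (Suc m)
  show ?thesis
    unfolding tabular_def
  proof (intro allI impI)
    fix s assume W: "weight k s"
    have "weight m s" using weight_mono[OF W] Suc by simp
    then obtain \<theta> where \<theta>: "growth r d m \<theta>" "matches \<theta> s m"
      using assms(2)[of m] Suc unfolding tabular_def by auto
    obtain \<nu> where \<nu>: "\<nu> \<in> addable r d (\<theta> ` {1..m}) (snd (s k))" "node_content v \<nu> = fst (s k)"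
      using weight_addable[OF assms(1) assms(2) W Suc \<theta>] by auto
    have "growth r d k (\<theta>(k := \<nu>))" using growth_Suc[OF \<theta>(1) \<nu>(1)] Suc by simp
    moreover have "matches (\<theta>(k := \<nu>)) s k"
      unfolding matches_def
    proof
      fix j assume "j \<in> {1..k}"
      then consider "j = k" | "j \<in> {1..m}" "j \<noteq> k" using Suc by fastforce
      then show "s j = (node_content v ((\<theta>(k := \<nu>)) j), node_pr ((\<theta>(k := \<nu>)) j))"
      proof cases
        case 1
        then show ?thesis using \<nu> by (simp add: addable_def prod_eq_iff)
      next
        case 2
        then show ?thesis using \<theta>(2) by (simp add: matches_def)
      qed
    qed
    ultimately show "\<exists>\<theta>. growth r d k \<theta> \<and> matches \<theta> s k" by blast
  qed
qed

text \<open>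
  For \<open>k = 0\<close> this is the cyclotomic relation. Otherwise \<open>g\<^sub>k z\<close> is a weight vector of length \<open>k - 1\<close>
  whose \<open>x\<^sub>k\<close>-eigenvalues are contents of addable nodes. The root of unity of \<open>z\<close> at \<open>k + 1\<close> takes
  the place of that at \<open>k\<close>. If both agree, the roots \<open>c \<plusminus> 1\<close> that are added are new because
  addable nodes do not have adjacent contents.
\<close>

lemma killed_by_distinct_roots:
  assumes "Suc k \<le> n" "\<And>j. j < k \<Longrightarrow> tabular j \<and> diagonalisable j"
    and G: "growth r d k \<theta>" and M: "matches \<theta> s k" and z: "wt k s z"
  shows "\<exists>as. distinct as \<and> pl (x (Suc k)) as * z \<approx> 0"
proof (cases k)
  case 0
  let ?vs = "map v [1..<Suc d]"
  have "v l \<noteq> v l'" if "l \<in> {1..d}" "l' \<in> {1..d}" "l \<noteq> l'" for l l'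
  proof -
    have "\<bar>0 :: int\<bar> < int n" using n_pos by simp
    then have "of_int 0 + v l - v l' \<noteq> 0" using sep that unfolding separated_def by blast
    then show ?thesis by simp
  qed
  then have "inj_on v {1..d}" unfolding inj_on_def by blast
  then have "distinct ?vs" by (simp add: distinct_map atLeastLessThanSuc_atLeastAtMost del: upt_Suc)
  moreover have "pl (x (Suc 0)) ?vs * z \<approx> 0" using cg_right[OF cyclotomic[OF n_pos], of z] by simp
  ultimately show ?thesis using 0 by blast
next
  case (Suc m)
  have k: "k \<in> {1..<n}" using assms(1) Suc by auto
  let ?c = "fst (s k)"
  have w: "wt m (s \<circ> sw k) (g k * z)"
    using wt_g_below[OF wt_mono[OF z] k, of m] Suc by simp
  have M': "matches \<theta> (s \<circ> sw k) m"
    using M Suc by (auto simp: matches_def Transposition.transpose_def)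
  have G': "growth r d m \<theta>" using growth_mono[OF G] Suc by simp
  have "diagonalisable m" using assms(2) Suc by simp
  from this[unfolded diagonalisable_def, rule_format, OF G' M' w]
  obtain as where as: "distinct as" "pl (x k) as * (g k * z) \<approx> 0"
    "set as \<subseteq> node_content v ` addable r d (\<theta> ` {1..m}) (snd (s (Suc k)))"
    using Suc assms(1) by auto
  show ?thesis
  proof (cases "snd (s k) = snd (s (Suc k))")
    case False
    then have "same s k = 0" by (simp add: same_def)
    then show ?thesis using kills_next_different_position[OF z k _ as(2)] as(1) by blast
  next
    case True
    then have sm: "same s k = 1" by (simp add: same_def)
    have \<theta>k: "\<theta> k \<in> addable r d (\<theta> ` {1..m}) (snd (s (Suc k)))" "?c = node_content v (\<theta> k)"
      using growth_last_addable[of r d m \<theta>] G M True Suc by (auto simp: matches_def)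
    note S = growth_shape[OF growth_mono[OF G, of m]]
    have cd: "card (\<theta> ` {1..m}) + 1 < n" using growth_card[OF growth_mono[OF G, of m]] Suc assms(1) by simp
    have "a \<noteq> ?c + 1" "a \<noteq> ?c - 1" if a: "a \<in> set as" for a
    proof -
      obtain \<nu> where \<nu>: "\<nu> \<in> addable r d (\<theta> ` {1..m}) (snd (s (Suc k)))" "a = node_content v \<nu>"
        using as(3) a by auto
      show "a \<noteq> ?c + 1" using addable_content_not_adjacent[OF S sep cd \<theta>k(1) \<nu>(1)] \<nu>(2) \<theta>k(2) Suc by simp
      show "a \<noteq> ?c - 1" using addable_content_not_adjacent[OF S sep cd \<nu>(1) \<theta>k(1)] \<nu>(2) \<theta>k(2) Suc by auto
    qed
    moreover have "?c + 1 \<noteq> ?c - 1"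
    proof
      assume "?c + 1 = ?c - 1"
      then have "(2::'f) = 0" by (simp add: algebra_simps)
      then show False using two_nonzero k by simp
    qed
    ultimately have "distinct ((?c + 1) # (?c - 1) # removeAll ?c as)"
      using as(1) by (auto simp: distinct_removeAll)
    then show ?thesis using kills_next_same_position[OF z k sm as(1,2)] by blast
  qed
qed

text \<open>
  A weight vector is a sum of eigenvectors of \<open>x\<^sub>k\<^sub>+\<^sub>1\<close>, and the nonzero ones are weight vectors of
  length \<open>k + 1\<close>, whose last entry is the content of an addable node. The roots belonging to
  zero summands may be dropped.
\<close>

lemma diagonalisable_step:
  assumes IH: "\<And>j. j < k \<Longrightarrow> tabular j \<and> diagonalisable j"
  shows "diagonalisable k"
  unfolding diagonalisable_def
proof (intro allI impI)
  fix \<theta> s z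
  assume G: "growth r d k \<theta>" and M: "matches \<theta> s k" and z: "wt k s z" and k: "Suc k \<le> n"
  let ?y = "x (Suc k)" and ?p = "snd (s (Suc k))"
  obtain as where as: "distinct as" "pl ?y as * z \<approx> 0"
    using killed_by_distinct_roots[OF k IH G M z] by blast
  have "\<exists>w. z \<approx> (\<Sum>a\<in>set as. w a) \<and> (\<forall>a\<in>set as. w a \<in> {z. wt k s z} \<and> ?y * w a \<approx> kap a * w a)"
  proof (rule eigenvector_decomposition[where C = UNIV, OF as])
    show "0 \<in> {z. wt k s z}" using wt_scale[OF z, of 0] by simp
  qed (use z k in \<open>auto intro: wt_add wt_scale wt_x\<close>)
  then obtain w where w: "z \<approx> (\<Sum>a\<in>set as. w a)"
    and wV: "\<And>a. a \<in> set as \<Longrightarrow> wt k s (w a) \<and> ?y * w a \<approx> kap a * w a" by blast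
  define bs where "bs = filter (\<lambda>a. \<not> w a \<approx> 0) as"
  have "set bs \<subseteq> node_content v ` addable r d (\<theta> ` {1..k}) ?p"
  proof
    fix a assume "a \<in> set bs"
    then have a: "a \<in> set as" "\<not> w a \<approx> 0" by (auto simp: bs_def)
    let ?s = "s(Suc k := (a, ?p))"
    have "twt ?s (w a)" using wV[OF a(1)] by (auto simp: wt_def twt_def)
    moreover have "x j * w a \<approx> kap (fst (?s j)) * w a" if "j \<in> {1..Suc k}" for j
      using wV[OF a(1)] that by (cases "j = Suc k") (auto simp: wt_def)
    ultimately have W: "weight (Suc k) ?s" using a(2) unfolding weight_def wt_def by blast
    have M': "matches \<theta> ?s k" using M by (auto simp: matches_def)
    have "\<exists>\<nu>\<in>addable r d (\<theta> ` {1..k}) (snd (?s (Suc k))). node_content v \<nu> = fst (?s (Suc k))"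
      by (rule weight_addable[OF k _ W refl G M']) (use IH in auto)
    then show "a \<in> node_content v ` addable r d (\<theta> ` {1..k}) ?p" by auto
  qed
  moreover have "pl ?y bs * z \<approx> 0"
  proof -
    have "pl ?y bs * z \<approx> (\<Sum>a\<in>set as. pl ?y bs * w a)"
      unfolding sum_distrib_left[symmetric] by (rule cg_left[OF w])
    also have "\<dots> \<approx> (\<Sum>a\<in>set as. 0)"
    proof (rule cg_sum)
      fix a assume a: "a \<in> set as"
      show "pl ?y bs * w a \<approx> 0"
      proof (cases "w a \<approx> 0")
        case True
        then show ?thesis using cg_left[OF True, of "pl ?y bs"] by simp
      next
        case False
        then have "pv a bs = 0" using a by (intro pv_zero) (simp add: bs_def)
        then show ?thesis using pl_eig[of ?y "w a" a bs] wV[OF a] by simp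
      qed
    qed
    finally show ?thesis by simp
  qed
  moreover have "distinct bs" using as(1) by (simp add: bs_def)
  ultimately show "\<exists>as. distinct as \<and> set as \<subseteq> node_content v ` addable r d (\<theta> ` {1..k}) ?p \<and> pl ?y as * z \<approx> 0"
    by blast
qed

theorem weights_are_tabular:
  "k \<le> n \<Longrightarrow> tabular k \<and> diagonalisable k"
proof (induction k rule: less_induct)
  case (less k)
  then have "tabular j \<and> diagonalisable j" if "j < k" for j using that by simp
  then show ?case using tabular_step diagonalisable_step less.prems by blast
qed

section \<open>The fusion functions on weight vectors\<close>

text \<open>
  The quotient of \<open>f(u) - f(y)\<close> by \<open>u - y\<close> for \<open>f\<close> with the given roots. If \<open>f(y) = 0\<close>, it is
  \<open>f(u) / (u - y)\<close>, which is how the inverses in the fusion functions are expressed.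
\<close>

primrec divided_difference :: "'f \<Rightarrow> 'a \<Rightarrow> 'f list \<Rightarrow> 'a" where
  "divided_difference u y [] = 0"
| "divided_difference u y (a # as) = kap (u - a) * divided_difference u y as + pl y as"

lemma divided_difference:
  "divided_difference u y as * (kap u - y) = kap (pv u as) - pl y as"
proof (induction as)
  case (Cons a as)
  have "divided_difference u y (a # as) * (kap u - y)
    = kap (u - a) * (divided_difference u y as * (kap u - y)) + pl y as * (kap u - y)"
    by (simp add: distrib_right mult.assoc)
  also have "\<dots> = kap (u - a) * (kap (pv u as) - pl y as) + pl y as * (kap u - y)"
    by (simp only: Cons)
  also have "\<dots> = kap (u - a) * kap (pv u as) - kap (u - a) * pl y as + pl y as * (kap u - y)"
    by (simp only: right_diff_distrib[of "kap (u - a)"])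
  also have "kap (u - a) * pl y as = pl y as * kap (u - a)" by (rule kap_central)
  also have "kap (u - a) * kap (pv u as) - pl y as * kap (u - a) + pl y as * (kap u - y)
    = kap (pv u (a # as)) - pl y as * (y - kap a)"
    by (simp add: kap_mult kap_diff right_diff_distrib)
  also have "pl y as * (y - kap a) = pl y (a # as)" by (simp add: pl_commute_self)
  finally show ?case .
qed simp

lemma divided_difference_commute:
  "(kap u - y) * divided_difference u y as = divided_difference u y as * (kap u - y)"
proof -
  have "y * divided_difference u y as = divided_difference u y as * y"
  proof (induction as)
    case (Cons a as)
    have "y * (kap (u - a) * divided_difference u y as) = kap (u - a) * divided_difference u y as * y"
      by (simp only: kap_left_commute[of y] Cons mult.assoc)
    moreover have "y * pl y as = pl y as * y" by (rule pl_commute) simp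
    ultimately show ?case by (simp add: distrib_left distrib_right)
  qed simp
  then show ?thesis by (simp add: left_diff_distrib right_diff_distrib kap_central)
qed

lemma divided_difference_eig:
  assumes "y * z \<approx> kap c * z" "pl y as * z \<approx> 0" "u \<noteq> c"
  shows "divided_difference u y as * z \<approx> kap (pv u as / (u - c)) * z"
proof -
  let ?R = "divided_difference u y as"
  have "kap (u - c) * (?R * z) = ?R * (kap (u - c) * z)" by (rule kap_left_commute[symmetric])
  also have "\<dots> \<approx> ?R * ((kap u - y) * z)"
  proof (rule cg_left[OF cg_sym])
    show "(kap u - y) * z \<approx> kap (u - c) * z"
      using cg_diff[OF cg_refl[of "kap u * z"] assms(1)] by (simp add: left_diff_distrib kap_diff)
  qed
  also have "\<dots> = kap (pv u as) * z - pl y as * z"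
  proof -
    have "?R * ((kap u - y) * z) = (?R * (kap u - y)) * z" by (rule mult.assoc[symmetric])
    then show ?thesis by (simp only: divided_difference left_diff_distrib[of "kap (pv u as)"])
  qed
  also have "\<dots> \<approx> kap (pv u as) * z - 0" by (intro cg_diff cg_refl assms)
  finally have "kap (u - c) * (?R * z) \<approx> kap (pv u as) * z" by simp
  from cg_left[OF this, of "kap (1 / (u - c))"] show ?thesis
    unfolding kap_kap using assms(3) by simp
qed

text \<open>The index is shifted: this represents \<open>\<phi>\<^sub>k\<^sub>+\<^sub>1\<close>.\<close>

primrec fusion :: "(nat \<Rightarrow> 'f) \<Rightarrow> nat \<Rightarrow> 'f \<Rightarrow> 'a" where
  "fusion us 0 u = divided_difference u (x 1) (map v [1..<Suc d])"
| "fusion us (Suc k) u =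
     (g (Suc k) + kap (1 / (u - us (Suc k))) * e (Suc k)) * fusion us k u * g (Suc k)"

lemma fusion_cong:
  "(\<And>i. i \<in> {1..k} \<Longrightarrow> us i = us' i) \<Longrightarrow> fusion us k u = fusion us' k u"
  by (induction k) auto

definition fusion_scalar :: "(nat \<Rightarrow> 'f \<times> nat) \<Rightarrow> nat \<Rightarrow> 'f \<Rightarrow> 'f" where
  "fusion_scalar s k u =
     pv u (map v [1..<Suc d]) * (\<Prod>i\<in>{i\<in>{1..<k}. snd (s i) = snd (s k)}. 1 - 1 / (u - fst (s i))\<^sup>2)"

text \<open>
  In \<open>\<phi>\<^sub>k\<^sub>+\<^sub>1 z = (g\<^sub>k + e\<^sub>k / (u - c)) \<phi>\<^sub>k g\<^sub>k z\<close> the vector \<open>g\<^sub>k z\<close> is, up to a multiple of \<open>z\<close>, a weight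
  vector with the last two entries exchanged, so that \<open>\<phi>\<^sub>k\<close> acts on both by known scalars. If the
  positions agree, the coefficients combine by a partial fraction identity to a multiple of
  \<open>g\<^sub>k z - z / (u - c)\<close>, and \<open>(g\<^sub>k + 1 / (u - c)) (g\<^sub>k - 1 / (u - c)) = 1 - 1 / (u - c)\<^sup>2\<close>.
\<close>

theorem fusion_eig:
  assumes "Suc k \<le> n" "wt (Suc k) s z" "\<And>i. i \<in> {1..Suc k} \<Longrightarrow> u \<noteq> fst (s i)"
    and "\<And>i. i \<in> {1..k} \<Longrightarrow> us i = fst (s i)"
  shows "fusion us k u * z \<approx> kap (fusion_scalar s (Suc k) u / (u - fst (s (Suc k)))) * z"
  using assms
proof (induction k arbitrary: s z)
  case 0
  let ?vs = "map v [1..<Suc d]"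
  have "pl (x 1) ?vs * z \<approx> 0" using cg_right[OF cyclotomic[OF n_pos], of z] by simp
  moreover have "x 1 * z \<approx> kap (fst (s 1)) * z" using 0 by (simp add: wt_def)
  moreover have "u \<noteq> fst (s 1)" using 0 by simp
  ultimately show ?case
    using divided_difference_eig[of "x 1" z "fst (s 1)" ?vs u] by (simp add: fusion_scalar_def del: upt_Suc)
next
  case (Suc k)
  let ?i = "Suc k"
  let ?s = "s \<circ> sw ?i"
  let ?c = "fst (s ?i)" and ?a = "fst (s (Suc ?i))"
  let ?F = "fusion us k u" and ?dl = "1 / (u - ?c)"
  have i: "?i \<in> {1..<n}" using Suc.prems(1) by simp
  have sl: "?s j = s j" if "j \<in> {1..k}" for j using that by (simp add: Transposition.transpose_def)
  have si: "?s ?i = s (Suc ?i)" by simp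
  have T: "twt s z" using Suc.prems(2) by (simp add: wt_def)
  have usi: "us ?i = ?c" using Suc.prems(4) by simp
  have u: "u \<noteq> ?c" "u \<noteq> ?a" using Suc.prems(3)[of ?i] Suc.prems(3)[of "Suc ?i"] by auto
  have set: "{j\<in>{1..<Suc ?i}. snd (s j) = snd (s (Suc ?i))} =
    (if snd (s ?i) = snd (s (Suc ?i)) then {?i} else {}) \<union> {j\<in>{1..<?i}. snd (?s j) = snd (?s ?i)}"
  proof -
    have c1: "{1..<Suc ?i} = insert ?i {1..<?i}" by auto
    have c2: "{j\<in>{1..<?i}. snd (?s j) = snd (?s ?i)} = {j\<in>{1..<?i}. snd (s j) = snd (s (Suc ?i))}"
      by (rule Collect_cong) (use sl si in auto)
    have c3: "{j\<in>insert ?i A. P j} = (if P ?i then {?i} else {}) \<union> {j\<in>A. P j}" for A P by auto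
    show ?thesis unfolding c2 unfolding c1 unfolding c3 ..
  qed
  define H where "H = fusion_scalar ?s ?i u"
  have H: "fusion_scalar s (Suc ?i) u =
     (if snd (s ?i) = snd (s (Suc ?i)) then 1 - ?dl\<^sup>2 else 1) * H"
  proof -
    have "(\<Prod>j\<in>{j\<in>{1..<?i}. snd (?s j) = snd (?s ?i)}. 1 - 1 / (u - fst (s j))\<^sup>2)
      = (\<Prod>j\<in>{j\<in>{1..<?i}. snd (?s j) = snd (?s ?i)}. 1 - 1 / (u - fst (?s j))\<^sup>2)"
      using sl by (intro prod.cong refl) auto
    then show ?thesis unfolding fusion_scalar_def H_def set
      by (auto simp: prod.union_disjoint power_divide simp del: upt_Suc)
  qed
  have IHs: "fusion us k u * y \<approx> kap (H / (u - ?a)) * y" if "wt (Suc k) ?s y" for y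
  proof -
    have A: "u \<noteq> fst (?s j)" if "j \<in> {1..Suc k}" for j
    proof (cases "j = ?i")
      case True
      then show ?thesis using u(2) si by simp
    next
      case False
      then have "j \<in> {1..k}" using that by auto
      then show ?thesis unfolding sl[OF \<open>j \<in> {1..k}\<close>] by (intro Suc.prems(3)) auto
    qed
    have B: "us j = fst (?s j)" if "j \<in> {1..k}" for j
      unfolding sl[OF that] using that by (intro Suc.prems(4)) auto
    from Suc.IH[OF Suc_leD[OF Suc.prems(1)] that A B] show ?thesis unfolding H_def si .
  qed
  \<comment> \<open>A nonzero weight vector has distinct neighbouring entries, which the intertwiner requires.\<close>
  show ?case
  proof (cases "z \<approx> 0")
    case True
    then have "c * z \<approx> 0" for c using cg_left[of z 0 c] by simp
    from cg_trans[OF this cg_sym[OF this]] show ?thesis .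
  next
    case False
    then have "weight (Suc ?i) s" using Suc.prems(2) by (auto simp: weight_def)
    then have ne: "s ?i \<noteq> s (Suc ?i)"
      using no_equal_neighbours[of "Suc ?i" s ?i] weights_are_tabular Suc.prems(1) by auto
    show ?thesis
    proof (cases "snd (s ?i) = snd (s (Suc ?i))")
      case False
      note w = wt_swap_different_position[OF Suc.prems(2,1) le_refl _ False]
      have "(g ?i + kap ?dl * e ?i) * (?F * (g ?i * z)) \<approx> (g ?i + kap ?dl * e ?i) * (kap (H / (u - ?a)) * (g ?i * z))"
        using w by (intro cg_left IHs) (auto intro: wt_mono)
      also have "\<dots> = kap (H / (u - ?a)) * (g ?i * (g ?i * z) + kap ?dl * (e ?i * (g ?i * z)))"
        by (simp only: kap_left_commute distrib_right mult.assoc)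
      also have "\<dots> \<approx> kap (H / (u - ?a)) * (z + kap ?dl * (kap (same ?s ?i) * (g ?i * z)))"
        by (intro cg_left cg_add gg_act e_act twt_g T i)
      also have "same ?s ?i = 0" using False by (simp add: same_def)
      finally show ?thesis using False H usi by (simp add: mult.assoc)
    next
      case True
      have ca: "?c \<noteq> ?a" using ne True by (auto simp: prod_eq_iff)
      define b where "b = 1 / (?c - ?a)"
      let ?y = "g ?i * z + kap b * z"
      have wy: "wt (Suc k) ?s ?y"
        using wt_swap_same_position(1)[OF Suc.prems(2,1) le_refl _ True ca] wt_mono unfolding b_def by fastforce
      have sc: "fusion_scalar s ?i u = H"
      proof -
        have "{j\<in>{1..<?i}. snd (s j) = snd (s ?i)} = {j\<in>{1..<?i}. snd (?s j) = snd (?s ?i)}"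
          using sl True by auto
        then show ?thesis unfolding H_def fusion_scalar_def
          using sl by (auto intro!: prod.cong arg_cong2[of _ _ _ _ "(*)"])
      qed
      have Fz: "?F * z \<approx> kap (H / (u - ?c)) * z"
        using Suc.IH[of s z] Suc.prems wt_mono[OF Suc.prems(2), of ?i] by (simp add: sc)
      have coef: "b * (1 / (u - ?a) - 1 / (u - ?c)) = - (1 / (u - ?a) * ?dl)"
      proof -
        have "1 / (u - ?a) - 1 / (u - ?c) = (?a - ?c) * (1 / (u - ?a) * ?dl)"
          using u by (simp add: field_simps)
        moreover have "b * (?a - ?c) = - 1" using ca by (simp add: b_def field_simps)
        ultimately show ?thesis by (simp add: mult.assoc[symmetric])
      qed
      have "?F * (g ?i * z) = ?F * ?y - kap b * (?F * z)"
        by (simp add: distrib_left kap_left_commute[of ?F])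
      also have "\<dots> \<approx> kap (H / (u - ?a)) * ?y - kap b * (kap (H / (u - ?c)) * z)"
        by (intro cg_diff cg_left IHs wy Fz)
      also have "\<dots> = kap (H / (u - ?a)) * (g ?i * z) + kap (H / (u - ?a) * b - b * (H / (u - ?c))) * z"
        by (simp add: distrib_left kap_kap kap_diff left_diff_distrib)
      also have "H / (u - ?a) * b - b * (H / (u - ?c)) = H * (b * (1 / (u - ?a) - 1 / (u - ?c)))"
        by (simp add: algebra_simps)
      also have "\<dots> = H / (u - ?a) * - ?dl" by (simp add: coef)
      also have "kap (H / (u - ?a)) * (g ?i * z) + kap (H / (u - ?a) * - ?dl) * z
        = kap (H / (u - ?a)) * (g ?i * z + kap (- ?dl) * z)"
        by (simp only: distrib_left kap_kap)
      finally have Fg: "?F * (g ?i * z) \<approx> kap (H / (u - ?a)) * (g ?i * z + kap (- ?dl) * z)" .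
      have same: "same s ?i = 1" "same ?s ?i = 1" using True by (auto simp: same_def)
      have "(g ?i + kap ?dl * e ?i) * (?F * (g ?i * z))
        \<approx> (g ?i + kap ?dl * e ?i) * (kap (H / (u - ?a)) * (g ?i * z + kap (- ?dl) * z))"
        by (intro cg_left Fg)
      also have "\<dots> = kap (H / (u - ?a)) * ((g ?i + kap ?dl * e ?i) * (g ?i * z + kap (- ?dl) * z))"
        by (rule kap_left_commute)
      also have "(g ?i + kap ?dl * e ?i) * (g ?i * z + kap (- ?dl) * z)
        = g ?i * (g ?i * z) + kap (- ?dl) * (g ?i * z) + kap ?dl * (e ?i * (g ?i * z)) + kap ?dl * (kap (- ?dl) * (e ?i * z))"
        by (simp add: distrib_left distrib_right mult.assoc kap_left_commute[of "g ?i"] kap_left_commute[of "e ?i"])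
      also have "kap (H / (u - ?a)) * \<dots> \<approx> kap (H / (u - ?a)) * (z + kap (- ?dl) * (g ?i * z)
          + kap ?dl * (kap (same ?s ?i) * (g ?i * z)) + kap ?dl * (kap (- ?dl) * (kap (same s ?i) * z)))"
        by (intro cg_left cg_add gg_act cg_refl e_act twt_g T i)
      also have "z + kap (- ?dl) * (g ?i * z) + kap ?dl * (kap (same ?s ?i) * (g ?i * z))
          + kap ?dl * (kap (- ?dl) * (kap (same s ?i) * z)) = kap (1 - ?dl\<^sup>2) * z"
      proof -
        have "z + kap (- D) * w + kap D * (kap 1 * w) + kap D * (kap (- D) * (kap 1 * z)) = kap (1 - D\<^sup>2) * z" for D w
          by (simp add: kap_minus kap_diff kap_kap power2_eq_square left_diff_distrib)
        then show ?thesis unfolding same .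
      qed
      also have "kap (H / (u - ?a)) * (kap (1 - ?dl\<^sup>2) * z) = kap ((1 - ?dl\<^sup>2) * H / (u - ?a)) * z"
        by (simp add: kap_kap mult.commute)
      finally show ?thesis using True H usi by (simp add: mult.assoc)
    qed
  qed
qed

end

section \<open>Finitely supported functions\<close>

lemma poly_mapping_single_induct [case_names zero single add]:
  assumes "P 0" "\<And>k c. P (Poly_Mapping.single k c)" "\<And>p q. P p \<Longrightarrow> P q \<Longrightarrow> P (p + q)"
  shows "P (p :: 'b \<Rightarrow>\<^sub>0 'c::comm_monoid_add)"
proof (induction p rule: update_induct)
  case (update f a b)
  then have "Poly_Mapping.lookup f a = 0" by (simp add: in_keys_iff)
  then have "Poly_Mapping.update a b f = f + Poly_Mapping.single a b"
    by (intro poly_mapping_eqI) (auto simp: lookup_update lookup_add lookup_single)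
  then show ?case using assms(2,3) update by simp
qed (rule assms)

lemma lookup_map: "f 0 = 0 \<Longrightarrow> Poly_Mapping.lookup (Poly_Mapping.map f p) k = f (Poly_Mapping.lookup p k)"
  by (simp add: Poly_Mapping.map.rep_eq when_def)

lemma map_zero: "Poly_Mapping.map f 0 = 0"
  by (simp add: map_eq_zero_iff)

lemma map_add:
  assumes "f 0 = 0" "\<And>a b. f (a + b) = f a + f b"
  shows "Poly_Mapping.map f (p + q) = Poly_Mapping.map f p + Poly_Mapping.map f q"
  by (rule poly_mapping_eqI) (simp add: lookup_map assms lookup_add)

lemma map_diff:
  assumes "f 0 = 0" "\<And>a b. f (a - b) = f a - f b"
  shows "Poly_Mapping.map f (p - q) = Poly_Mapping.map f p - Poly_Mapping.map f q"
  by (rule poly_mapping_eqI) (simp add: lookup_map assms lookup_minus)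

lemma map_mult:
  fixes f :: "'c::semiring_0 \<Rightarrow> 'd::semiring_0" and p :: "'b::monoid_add \<Rightarrow>\<^sub>0 'c"
  assumes f: "f 0 = 0" "\<And>a b. f (a + b) = f a + f b" "\<And>a b. f (a * b) = f a * f b"
  shows "Poly_Mapping.map f (p * q) = Poly_Mapping.map f p * Poly_Mapping.map f q"
proof (induction p rule: poly_mapping_single_induct)
  case (single k c)
  show ?case
  proof (induction q rule: poly_mapping_single_induct)
    case (single k' c')
    then show ?case by (simp add: mult_single f)
  qed (simp_all add: map_add f distrib_left map_zero)
qed (simp_all add: map_add f distrib_right map_zero)

section \<open>Rational functions and their values\<close>

lemma rconst_add: "rconst (a + b) = rconst a + rconst b"
  by (simp add: rconst_def single_add)

lemma rconst_diff: "rconst (a - b) = rconst a - rconst b"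
  by (simp add: rconst_def single_diff)

lemma rconst_minus: "rconst (- a) = - rconst a"
  by (simp add: rconst_def single_uminus)

lemma rconst_mult: "rconst (a * b) = rconst a * rconst b"
  by (simp add: rconst_def mult_single)

lemma rconst_0 [simp]: "rconst 0 = 0"
  by (simp add: rconst_def Zero_fract_def)

lemma rconst_1 [simp]: "rconst 1 = 1"
  by (simp add: rconst_def One_fract_def)

lemma rconst_eq_iff [simp]: "rconst a = rconst b \<longleftrightarrow> a = b"
proof
  assume "rconst a = rconst b"
  then have "Poly_Mapping.single (0 :: var \<Rightarrow>\<^sub>0 nat) a = Poly_Mapping.single 0 b"
    by (simp add: rconst_def eq_fract)
  from arg_cong[OF this, of "\<lambda>p. Poly_Mapping.lookup p 0"] show "a = b" by simp
qed simp

lemma rconst_eq_0_iff [simp]: "rconst a = 0 \<longleftrightarrow> a = 0"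
  using rconst_eq_iff[of a 0] by (simp del: rconst_eq_iff)

lemma rconst_inverse: "rconst (1 / a) = 1 / rconst a"
proof (cases "a = 0")
  case False
  then have "rconst (1 / a) * rconst a = 1" by (simp add: rconst_mult[symmetric])
  then show ?thesis using False by (simp add: field_simps)
qed simp

lemma rconst_of_nat: "rconst (of_nat k) = of_nat k"
  by (induction k) (simp_all add: rconst_add)

lemma rconst_of_int: "rconst (of_int k) = of_int k"
  by (cases k) (simp_all add: rconst_of_nat rconst_minus rconst_diff)

lemma rconst_prod: "rconst (prod f A) = (\<Prod>i\<in>A. rconst (f i))"
  by (induction A rule: infinite_finite_induct) (simp_all add: rconst_mult)

lemma rconst_power: "rconst (a ^ k) = rconst a ^ k"
  by (induction k) (simp_all add: rconst_mult)

lemma rvar_neq_rconst: "rvar z \<noteq> rconst c"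
proof
  assume "rvar z = rconst c"
  then have "Poly_Mapping.single (Poly_Mapping.single z (1::nat)) 1 = Poly_Mapping.single 0 c"
    by (simp add: rconst_def rvar_def eq_fract)
  note arg_cong[OF this, of "\<lambda>p. Poly_Mapping.lookup p (Poly_Mapping.single z 1)"]
  moreover have "Poly_Mapping.single z (1::nat) \<noteq> 0"
    by (metis lookup_single_eq lookup_zero one_neq_zero)
  ultimately show False by (simp add: lookup_single_not_eq)
qed

lemma rvar_neq:
  assumes "z \<noteq> z'" shows "rvar z \<noteq> (rvar z' :: 'k::field ratfun)"
proof
  assume e: "rvar z = (rvar z' :: 'k ratfun)"
  have "Poly_Mapping.single z' (1::nat) \<noteq> Poly_Mapping.single z 1"
    using assms by (metis lookup_single_eq lookup_single_not_eq one_neq_zero)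
  moreover have "Poly_Mapping.single (Poly_Mapping.single z (1::nat)) (1::'k) = Poly_Mapping.single (Poly_Mapping.single z' 1) 1"
    using e by (simp add: rvar_def eq_fract)
  note arg_cong[OF this, of "\<lambda>p. Poly_Mapping.lookup p (Poly_Mapping.single z 1)"]
  ultimately show False by (simp add: lookup_single_not_eq)
qed

lemma poly_subst_superset:
  assumes "finite S" "Poly_Mapping.keys p \<subseteq> S"
  shows "poly_subst z a p = (\<Sum>m\<in>S. Poly_Mapping.single (Poly_Mapping.update z 0 m) (Poly_Mapping.lookup p m * a ^ Poly_Mapping.lookup m z))"
  unfolding poly_subst_def using assms
  by (intro sum.mono_neutral_left) (auto simp: in_keys_iff)

lemma poly_subst_add: "poly_subst z a (p + q) = poly_subst z a p + poly_subst z a q"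
proof -
  let ?S = "Poly_Mapping.keys p \<union> Poly_Mapping.keys q"
  have "Poly_Mapping.keys (p + q) \<subseteq> ?S" by (rule Poly_Mapping.keys_add)
  then show ?thesis
    by (simp add: poly_subst_superset[of ?S] lookup_add distrib_right single_add sum.distrib)
qed

lemma poly_subst_single:
  "poly_subst z a (Poly_Mapping.single m c) = Poly_Mapping.single (Poly_Mapping.update z 0 m) (c * a ^ Poly_Mapping.lookup m z)"
  by (subst poly_subst_superset[of "{m}"]) auto

lemma poly_subst_0 [simp]: "poly_subst z a 0 = 0"
  by (simp add: poly_subst_def)

lemma poly_subst_mult: "poly_subst z a (p * q) = poly_subst z a p * poly_subst z a q"
proof (induction p rule: poly_mapping_single_induct)
  case (single m c)
  show ?case
  proof (induction q rule: poly_mapping_single_induct)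
    case (single m' c')
    have "Poly_Mapping.update z 0 (m + m') = Poly_Mapping.update z 0 m + Poly_Mapping.update z 0 m'"
      by (rule poly_mapping_eqI) (simp add: lookup_update lookup_add)
    then show ?case by (simp add: mult_single poly_subst_single lookup_add power_add) (simp add: mult_ac)
  qed (simp_all add: poly_subst_add distrib_left)
qed (simp_all add: poly_subst_add distrib_right)

lemma poly_subst_const: "poly_subst z a (Poly_Mapping.single 0 c) = Poly_Mapping.single 0 c"
proof -
  have "Poly_Mapping.update z (0::nat) 0 = 0"
    by (rule poly_mapping_eqI) (simp add: lookup_update)
  then show ?thesis by (simp add: poly_subst_single)
qed

lemma poly_subst_1 [simp]: "poly_subst z a 1 = 1"
  using poly_subst_const[of z a 1] by simp

text \<open>
  A relational form of \<open>value_at\<close>, which is preserved by the field operations without separate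
  regularity conditions.
\<close>

definition has_value :: "var \<Rightarrow> 'k::field \<Rightarrow> 'k ratfun \<Rightarrow> 'k ratfun \<Rightarrow> bool" where
  "has_value z a f h \<longleftrightarrow> (\<exists>p q. f = Fraction_Field.Fract p q \<and> poly_subst z a q \<noteq> 0 \<and>
     h = Fraction_Field.Fract (poly_subst z a p) (poly_subst z a q))"

lemma has_valueE:
  assumes "has_value z a f h"
  obtains p q where "f = Fraction_Field.Fract p q" "q \<noteq> 0" "poly_subst z a q \<noteq> 0"
    "h = Fraction_Field.Fract (poly_subst z a p) (poly_subst z a q)"
  using assms poly_subst_0 unfolding has_value_def by metis

lemma has_value_unique:
  assumes "has_value z a f h" "has_value z a f h'" shows "h = h'"
  using assms(1)
proof (rule has_valueE)
  fix p q assume 1: "f = Fraction_Field.Fract p q" "q \<noteq> 0" "poly_subst z a q \<noteq> 0"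
    "h = Fraction_Field.Fract (poly_subst z a p) (poly_subst z a q)"
  show ?thesis
    using assms(2)
  proof (rule has_valueE)
    fix p' q' assume 2: "f = Fraction_Field.Fract p' q'" "q' \<noteq> 0" "poly_subst z a q' \<noteq> 0"
      "h' = Fraction_Field.Fract (poly_subst z a p') (poly_subst z a q')"
    have "p * q' = p' * q" using 1(1,2) 2(1,2) by (simp add: eq_fract)
    then have "poly_subst z a p * poly_subst z a q' = poly_subst z a p' * poly_subst z a q"
      by (metis poly_subst_mult)
    then show ?thesis using 1 2 by (simp add: eq_fract)
  qed
qed

lemma has_value_value_at: "has_value z a f h \<Longrightarrow> regular_at z a f \<and> value_at z a f = h"
proof -
  assume h: "has_value z a f h"
  have "value_at z a f = (THE h. has_value z a f h)" by (simp add: value_at_def has_value_def)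
  also have "\<dots> = h" using h has_value_unique by (intro the_equality) blast+
  finally show ?thesis using h by (auto simp: regular_at_def has_value_def)
qed

lemma regular_at_has_value: "regular_at z a f \<Longrightarrow> has_value z a f (value_at z a f)"
proof -
  assume "regular_at z a f"
  then obtain h where "has_value z a f h" unfolding regular_at_def has_value_def by blast
  then show ?thesis using has_value_value_at by blast
qed

lemma has_value_add: "has_value z a f h \<Longrightarrow> has_value z a f' h' \<Longrightarrow> has_value z a (f + f') (h + h')"
proof (elim has_valueE)
  fix p q p' q'
  assume "f = Fraction_Field.Fract p q" "q \<noteq> 0" "poly_subst z a q \<noteq> 0"
    "h = Fraction_Field.Fract (poly_subst z a p) (poly_subst z a q)"
    "f' = Fraction_Field.Fract p' q'" "q' \<noteq> 0" "poly_subst z a q' \<noteq> 0"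
    "h' = Fraction_Field.Fract (poly_subst z a p') (poly_subst z a q')"
  then show ?thesis unfolding has_value_def
    by (intro exI[of _ "p * q' + p' * q"] exI[of _ "q * q'"]) (simp add: poly_subst_add poly_subst_mult)
qed

lemma has_value_mult: "has_value z a f h \<Longrightarrow> has_value z a f' h' \<Longrightarrow> has_value z a (f * f') (h * h')"
proof (elim has_valueE)
  fix p q p' q'
  assume "f = Fraction_Field.Fract p q" "poly_subst z a q \<noteq> 0"
    "h = Fraction_Field.Fract (poly_subst z a p) (poly_subst z a q)"
    "f' = Fraction_Field.Fract p' q'" "poly_subst z a q' \<noteq> 0"
    "h' = Fraction_Field.Fract (poly_subst z a p') (poly_subst z a q')"
  then show ?thesis unfolding has_value_def
    by (intro exI[of _ "p * p'"] exI[of _ "q * q'"]) (simp add: poly_subst_mult)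
qed

lemma has_value_rconst: "has_value z a (rconst c) (rconst c)"
  unfolding has_value_def rconst_def
  by (intro exI[of _ "Poly_Mapping.single 0 c"] exI[of _ 1]) (simp add: poly_subst_const)

lemma has_value_0 [simp]: "has_value z a 0 0" and has_value_1 [simp]: "has_value z a 1 1"
  using has_value_rconst[of z a 0] has_value_rconst[of z a 1] by simp_all

lemma has_value_minus: "has_value z a f h \<Longrightarrow> has_value z a (- f) (- h)"
  using has_value_mult[OF has_value_rconst[of z a "- 1"], of f h] by (simp add: rconst_minus)

lemma has_value_diff: "has_value z a f h \<Longrightarrow> has_value z a f' h' \<Longrightarrow> has_value z a (f - f') (h - h')"
  using has_value_add[of z a f h "- f'" "- h'"] has_value_minus by force

lemma has_value_inverse: "has_value z a f h \<Longrightarrow> h \<noteq> 0 \<Longrightarrow> has_value z a (1 / f) (1 / h)"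
proof -
  assume "has_value z a f h" and h: "h \<noteq> 0"
  then obtain p q where 1: "f = Fraction_Field.Fract p q" "poly_subst z a q \<noteq> 0"
    "h = Fraction_Field.Fract (poly_subst z a p) (poly_subst z a q)"
    unfolding has_value_def by blast
  have "poly_subst z a p \<noteq> 0" using h 1 by (auto simp: fract_collapse)
  then show ?thesis unfolding has_value_def
    using 1 by (intro exI[of _ q] exI[of _ p]) (simp add: One_fract_def)
qed

lemma has_value_divide:
  "has_value z a f h \<Longrightarrow> has_value z a f' h' \<Longrightarrow> h' \<noteq> 0 \<Longrightarrow> has_value z a (f / f') (h / h')"
  using has_value_mult[of z a f h "1 / f'" "1 / h'"] has_value_inverse by force

lemma has_value_prod:
  "(\<And>i. i \<in> A \<Longrightarrow> has_value z a (f i) (h i)) \<Longrightarrow> has_value z a (prod f A) (prod h A)"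
  by (induction A rule: infinite_finite_induct) (auto intro: has_value_mult)

lemma has_value_of_nat: "has_value z a (of_nat k) (of_nat k)"
  using has_value_rconst[of z a "of_nat k"] by (simp add: rconst_of_nat)

lemma has_value_var: "has_value z a (rvar z) (rconst a)"
proof -
  have "Poly_Mapping.update z 0 (Poly_Mapping.single z (1::nat)) = 0"
    by (rule poly_mapping_eqI) (simp add: lookup_update lookup_single when_def)
  then show ?thesis unfolding has_value_def rvar_def rconst_def
    by (intro exI[of _ "Poly_Mapping.single (Poly_Mapping.single z 1) 1"] exI[of _ 1])
      (simp add: poly_subst_single)
qed

lemma has_value_other_var: "z \<noteq> z' \<Longrightarrow> has_value z a (rvar z') (rvar z')"
proof -
  assume ne: "z \<noteq> z'"
  then have "Poly_Mapping.update z 0 (Poly_Mapping.single z' (1::nat)) = Poly_Mapping.single z' 1"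
    by (intro poly_mapping_eqI) (auto simp: lookup_update lookup_single when_def)
  then show ?thesis unfolding has_value_def rvar_def using ne
    by (intro exI[of _ "Poly_Mapping.single (Poly_Mapping.single z' 1) 1"] exI[of _ 1])
      (simp add: poly_subst_single lookup_single when_def)
qed

text \<open>
  Evaluation at \<open>z = a\<close> is linear over the constants, hence is the restriction of a linear map
  that is defined on all rational functions. This makes it compatible with any relations that
  have constant coefficients.
\<close>

definition const_linear :: "('k::field ratfun \<Rightarrow> 'k ratfun) \<Rightarrow> bool" where
  "const_linear V \<longleftrightarrow> (\<forall>f h. V (f + h) = V f + V h) \<and> (\<forall>c f. V (rconst c * f) = rconst c * V f)"

definition const_scale :: "'k::field \<Rightarrow> 'k ratfun \<Rightarrow> 'k ratfun" where
  "const_scale c f = rconst c * f"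

lemma vector_space_const_scale: "vector_space const_scale"
  by unfold_locales (simp_all add: const_scale_def rconst_add rconst_mult distrib_left distrib_right mult.assoc)

lemma value_linear_extension:
  obtains V :: "'k::field ratfun \<Rightarrow> 'k ratfun"
  where "const_linear V" "\<And>f h. has_value z a f h \<Longrightarrow> V f = h"
proof -
  note vs = vector_space_const_scale
  note md = module_iff_vector_space[THEN iffD2, OF vs]
  have vsp: "vector_space_pair const_scale const_scale" using vs by (simp add: vector_space_pair_def)
  let ?R = "{f. regular_at z a f}"
  have ind: "\<not> module.dependent const_scale {}" by (rule module.independent_empty[OF md])
  obtain B where "{} \<subseteq> B" and B: "B \<subseteq> ?R" "\<not> module.dependent const_scale B" "?R \<subseteq> module.span const_scale B"
    by (rule vector_space.maximal_independent_subset_extend[OF vs empty_subsetI ind])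
  obtain V where V: "Vector_Spaces.linear const_scale const_scale V" "\<And>f. f \<in> B \<Longrightarrow> V f = value_at z a f"
    using vector_space_pair.linear_independent_extend[OF vsp B(2), of "value_at z a"] by blast
  have lin: "module_hom const_scale const_scale V"
    using V(1) by (simp add: Vector_Spaces.linear_def)
  have add: "V (f + h) = V f + V h" for f h by (rule module_hom.add[OF lin])
  have scale: "V (rconst c * f) = rconst c * V f" for c f
    using module_hom.scale[OF lin, of c f] by (simp add: const_scale_def)
  have zero: "V 0 = 0" using scale[of 0 0] by simp
  let ?S = "{f. has_value z a f (V f)}"
  have "module.subspace const_scale ?S"
    unfolding module.subspace_def[OF md] const_scale_def
    by (auto simp: add scale zero intro: has_value_add has_value_mult has_value_rconst)
  moreover have "B \<subseteq> ?S" using B(1) V(2) regular_at_has_value by fastforce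
  ultimately have "module.span const_scale B \<subseteq> ?S" by (intro module.span_minimal[OF md])
  then have "V f = h" if "has_value z a f h" for f h
    using that B(3) has_value_value_at has_value_unique by blast
  moreover have "const_linear V" by (simp add: const_linear_def add scale)
  ultimately show ?thesis using that by blast
qed

section \<open>The algebras as quotients of free algebras\<close>

abbreviation good_word :: "nat \<Rightarrow> fword \<Rightarrow> bool" where
  "good_word n w \<equiv> set (letters w) \<subseteq> generators n"

lemma good_word_plus: "good_word n (w + w') \<longleftrightarrow> good_word n w \<and> good_word n w'"
  by (simp add: plus_fword_def)

lemma good_word_zero [simp]: "good_word n 0"
  by (simp add: zero_fword_def)

lemma free_algebra_simps [simp]:
  "mult (free_algebra n) = (*)" "one (free_algebra n) = 1" "zero (free_algebra n) = 0" "add (free_algebra n) = (+)"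
  by (simp_all add: free_algebra_def)

lemma mem_free_algebra: "P \<in> carrier (free_algebra n) \<longleftrightarrow> (\<forall>w. \<not> good_word n w \<longrightarrow> Poly_Mapping.lookup P w = 0)"
  by (auto simp: free_algebra_def in_keys_iff)

lemma free_algebra_add: "P \<in> carrier (free_algebra n) \<Longrightarrow> Q \<in> carrier (free_algebra n) \<Longrightarrow> P + Q \<in> carrier (free_algebra n)"
  by (simp add: mem_free_algebra lookup_add)

lemma free_algebra_minus: "P \<in> carrier (free_algebra n) \<Longrightarrow> - P \<in> carrier (free_algebra n)"
  by (simp add: mem_free_algebra)

lemma free_algebra_diff: "P \<in> carrier (free_algebra n) \<Longrightarrow> Q \<in> carrier (free_algebra n) \<Longrightarrow> P - Q \<in> carrier (free_algebra n)"
  by (simp add: mem_free_algebra lookup_minus)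

lemma free_algebra_zero: "0 \<in> carrier (free_algebra n)"
  by (simp add: mem_free_algebra)

lemma free_algebra_one: "1 \<in> carrier (free_algebra n)"
  by (auto simp: mem_free_algebra lookup_one when_def)

lemma free_algebra_mult: "P \<in> carrier (free_algebra n) \<Longrightarrow> Q \<in> carrier (free_algebra n) \<Longrightarrow> P * Q \<in> carrier (free_algebra n)"
  unfolding free_algebra_def using keys_mult[of P Q] by (fastforce simp: good_word_plus plus_fword_def)

lemma free_algebra_power: "P \<in> carrier (free_algebra n) \<Longrightarrow> P ^ k \<in> carrier (free_algebra n)"
  by (induction k) (auto intro: free_algebra_one free_algebra_mult)

lemma free_algebra_sum: "(\<And>i. i \<in> A \<Longrightarrow> f i \<in> carrier (free_algebra n)) \<Longrightarrow> sum f A \<in> carrier (free_algebra n)"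
  by (induction A rule: infinite_finite_induct) (auto intro: free_algebra_zero free_algebra_add)

lemma free_algebra_prod_list: "(\<And>i. i \<in> set xs \<Longrightarrow> f i \<in> carrier (free_algebra n)) \<Longrightarrow> prod_list (map f xs) \<in> carrier (free_algebra n)"
  by (induction xs) (auto intro: free_algebra_one free_algebra_mult)

lemma free_algebra_fconst: "fconst c \<in> carrier (free_algebra n)"
  by (auto simp: mem_free_algebra fconst_def lookup_single when_def)

lemma free_algebra_fgen: "a \<in> generators n \<Longrightarrow> fgen a \<in> carrier (free_algebra n)"
  by (auto simp: mem_free_algebra fgen_def lookup_single when_def)

lemma free_algebra_generators:
  "i \<in> {1..n} \<Longrightarrow> ft i \<in> carrier (free_algebra n)" "i \<in> {1..n} \<Longrightarrow> fx i \<in> carrier (free_algebra n)"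
  "i \<in> {1..<n} \<Longrightarrow> fg i \<in> carrier (free_algebra n)"
  by (auto intro!: free_algebra_fgen simp: generators_def)

lemma free_algebra_fe: "i \<in> {1..<n} \<Longrightarrow> fe r i \<in> carrier (free_algebra n)"
  unfolding fe_def
  by (intro free_algebra_mult free_algebra_sum free_algebra_fconst free_algebra_power free_algebra_generators) auto

lemmas free_algebra_closed = free_algebra_add free_algebra_minus free_algebra_diff free_algebra_zero
  free_algebra_one free_algebra_mult free_algebra_power free_algebra_fconst free_algebra_generators free_algebra_fe

lemma ring_free_algebra: "ring (free_algebra n)"
proof (rule ringI)
  show "abelian_group (free_algebra n)"
  proof (rule abelian_groupI)
    fix P assume "P \<in> carrier (free_algebra n)"
    then show "\<exists>Q\<in>carrier (free_algebra n). Q \<oplus>\<^bsub>free_algebra n\<^esub> P = \<zero>\<^bsub>free_algebra n\<^esub>"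
      by (intro bexI[of _ "- P"]) (auto intro: free_algebra_minus)
  qed (auto intro: free_algebra_closed simp: add.assoc add.commute)
  show "monoid (free_algebra n)"
    by (rule monoidI) (auto intro: free_algebra_closed simp: mult.assoc)
qed (auto simp: distrib_left distrib_right)

lemma free_algebra_a_inv: "P \<in> carrier (free_algebra n) \<Longrightarrow> a_inv (free_algebra n) P = - P"
  using abelian_group.minus_equality[OF ring.is_abelian_group[OF ring_free_algebra[of n]], of "- P" P]
  by (simp add: free_algebra_minus)

lemma free_algebra_a_minus:
  "P \<in> carrier (free_algebra n) \<Longrightarrow> Q \<in> carrier (free_algebra n) \<Longrightarrow> P \<ominus>\<^bsub>free_algebra n\<^esub> Q = P - Q"
  by (simp add: a_minus_def free_algebra_a_inv)

lemma free_algebra_idealI: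
  assumes "I \<subseteq> carrier (free_algebra n)" "0 \<in> I" "\<And>P Q. P \<in> I \<Longrightarrow> Q \<in> I \<Longrightarrow> P + Q \<in> I"
    and l: "\<And>P Q. P \<in> I \<Longrightarrow> Q \<in> carrier (free_algebra n) \<Longrightarrow> Q * P \<in> I"
    and "\<And>P Q. P \<in> I \<Longrightarrow> Q \<in> carrier (free_algebra n) \<Longrightarrow> P * Q \<in> I"
  shows "ideal I (free_algebra n)"
proof (rule idealI[OF ring_free_algebra])
  have "- P \<in> I" if "P \<in> I" for P
    using l[OF that, of "- 1"] by (simp add: free_algebra_minus free_algebra_one)
  then have "m_inv (add_monoid (free_algebra n)) P \<in> I" if "P \<in> I" for P
    using that assms(1) free_algebra_a_inv[of P n] unfolding a_inv_def by (simp only: subsetD)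
  then show "subgroup I (add_monoid (free_algebra n))"
    using assms(1-3) by (intro subgroup.intro) simp_all
qed (use assms in auto)

definition cyclotomic_element :: "nat \<Rightarrow> (nat \<Rightarrow> 'f::field) \<Rightarrow> 'f falg" where
  "cyclotomic_element d v = prod_list (map (\<lambda>l. fx 1 - fconst (v l)) [1..<Suc d])"

definition all_relations :: "nat \<Rightarrow> nat \<Rightarrow> nat \<Rightarrow> (nat \<Rightarrow> 'f::field) \<Rightarrow> 'f falg set" where
  "all_relations r n d v = insert (cyclotomic_element d v) (affine_relations r n)"

text \<open>The two quotients are performed at once, by the ideal generated by all relations.\<close>

definition total_ideal :: "nat \<Rightarrow> nat \<Rightarrow> nat \<Rightarrow> (nat \<Rightarrow> 'f::field) \<Rightarrow> 'f falg set" where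
  "total_ideal r n d v = Idl\<^bsub>free_algebra n\<^esub> (all_relations r n d v)"

lemma affine_relations_carrier: "affine_relations r n \<subseteq> carrier (free_algebra n)"
proof -
  have "Transposition.transpose i (i + 1) j \<in> {1..n}" if "i \<in> {1..<n}" "j \<in> {1..n}" for i j
    using that by (auto simp: Transposition.transpose_def)
  moreover have "i + 1 \<in> {1..n}" "i \<in> {1..n}" if "i \<in> {1..<n}" for i using that by auto
  ultimately show ?thesis
    unfolding affine_relations_def
    by (intro Un_least subsetI; clarify; intro free_algebra_closed; (assumption | blast))
qed

lemma cyclotomic_element_carrier: "1 \<le> n \<Longrightarrow> cyclotomic_element d v \<in> carrier (free_algebra n)"
  unfolding cyclotomic_element_def by (intro free_algebra_prod_list free_algebra_closed) auto

lemma all_relations_carrier: "1 \<le> n \<Longrightarrow> all_relations r n d v \<subseteq> carrier (free_algebra n)"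
  using affine_relations_carrier cyclotomic_element_carrier by (auto simp: all_relations_def)

lemma ideal_total_ideal: "1 \<le> n \<Longrightarrow> ideal (total_ideal r n d v) (free_algebra n)"
  unfolding total_ideal_def by (intro ring.genideal_ideal ring_free_algebra all_relations_carrier)

lemma total_ideal_closed:
  assumes "1 \<le> n"
  shows "0 \<in> total_ideal r n d v"
    and "P \<in> total_ideal r n d v \<Longrightarrow> Q \<in> total_ideal r n d v \<Longrightarrow> P + Q \<in> total_ideal r n d v"
    and "P \<in> total_ideal r n d v \<Longrightarrow> R \<in> carrier (free_algebra n) \<Longrightarrow> R * P \<in> total_ideal r n d v"
    and "P \<in> total_ideal r n d v \<Longrightarrow> R \<in> carrier (free_algebra n) \<Longrightarrow> P * R \<in> total_ideal r n d v"
  using additive_subgroup.zero_closed[OF ideal.axioms(1)[OF ideal_total_ideal[OF assms, of r d v]]]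
    additive_subgroup.a_closed[OF ideal.axioms(1)[OF ideal_total_ideal[OF assms, of r d v]], of P Q]
    ideal.I_l_closed[OF ideal_total_ideal[OF assms, of r d v], of P R]
    ideal.I_r_closed[OF ideal_total_ideal[OF assms, of r d v], of P R]
  by simp_all

lemma total_ideal_minimal:
  "ideal I (free_algebra n) \<Longrightarrow> all_relations r n d v \<subseteq> I \<Longrightarrow> total_ideal r n d v \<subseteq> I"
  unfolding total_ideal_def by (rule ring.genideal_minimal[OF ring_free_algebra])

lemma all_relations_subset: "1 \<le> n \<Longrightarrow> all_relations r n d v \<subseteq> total_ideal r n d v"
  unfolding total_ideal_def by (rule ring.genideal_self[OF ring_free_algebra all_relations_carrier])

lemma ideal_affine_ideal: "ideal (affine_ideal r n) (free_algebra n)"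
  unfolding affine_ideal_def by (intro ring.genideal_ideal ring_free_algebra affine_relations_carrier)

lemma ring_affine_YH: "ring (affine_YH r n)"
  unfolding affine_YH_def by (rule ideal.quotient_is_ring[OF ideal_affine_ideal])

lemma affine_class_hom: "affine_class r n \<in> ring_hom (free_algebra n) (affine_YH r n)"
  using ideal.rcos_ring_hom[OF ideal_affine_ideal[of r n]] by (simp add: affine_class_def[abs_def] affine_YH_def)

context
  fixes r n d :: nat and v :: "nat \<Rightarrow> 'f::field"
  assumes n: "1 \<le> n"
begin

lemma ideal_cyclotomic_ideal: "ideal (cyclotomic_ideal r n d v) (affine_YH r n)"
proof -
  have "affine_class r n (cyclotomic_element d v) \<in> carrier (affine_YH r n)"
    using ring_hom_closed[OF affine_class_hom] cyclotomic_element_carrier[OF n] by blast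
  then show ?thesis
    unfolding cyclotomic_ideal_def cyclotomic_element_def
    by (intro ring.genideal_ideal ring_affine_YH) simp
qed

lemma ring_YH: "ring (YH r n d v)"
  unfolding YH_def by (rule ideal.quotient_is_ring[OF ideal_cyclotomic_ideal])

lemma YH_class_hom: "YH_class r n d v \<in> ring_hom (free_algebra n) (YH r n d v)"
proof -
  have "(+>\<^bsub>affine_YH r n\<^esub>) (cyclotomic_ideal r n d v) \<in> ring_hom (affine_YH r n) (YH r n d v)"
    unfolding YH_def by (rule ideal.rcos_ring_hom[OF ideal_cyclotomic_ideal])
  from ring_hom_trans[OF affine_class_hom this] show ?thesis
    by (simp add: YH_class_def[abs_def] o_def)
qed

lemma zero_affine_YH: "\<zero>\<^bsub>affine_YH r n\<^esub> = affine_ideal r n"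
  by (simp add: affine_YH_def FactRing_def)

lemma zero_YH: "\<zero>\<^bsub>YH r n d v\<^esub> = cyclotomic_ideal r n d v"
  by (simp add: YH_def FactRing_def)

lemma cyclotomic_class: "affine_class r n (cyclotomic_element d v) \<in> cyclotomic_ideal r n d v"
  unfolding cyclotomic_ideal_def cyclotomic_element_def[symmetric]
  by (intro ring.genideal_self'[OF ring_affine_YH] ring_hom_closed[OF affine_class_hom]
      cyclotomic_element_carrier n)

lemma affine_ideal_subset: "affine_ideal r n \<subseteq> total_ideal r n d v"
  unfolding affine_ideal_def
  using all_relations_subset[OF n, of r d v] ideal_total_ideal[OF n, of r d v]
  by (intro ring.genideal_minimal[OF ring_free_algebra]) (auto simp: all_relations_def)

text \<open>
  The third isomorphism theorem: an ideal of the affine algebra is the image of an ideal of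
  the free algebra.
\<close>

lemma YH_class_eq_zero:
  assumes P: "P \<in> carrier (free_algebra n)"
  shows "YH_class r n d v P = \<zero>\<^bsub>YH r n d v\<^esub> \<longleftrightarrow> P \<in> total_ideal r n d v"
proof
  interpret hom: ring_hom_ring "free_algebra n" "YH r n d v" "YH_class r n d v"
    by (rule ring_hom_ringI2[OF ring_free_algebra ring_YH YH_class_hom])
  let ?K = "a_kernel (free_algebra n) (YH r n d v) (YH_class r n d v)"
  assume "P \<in> total_ideal r n d v"
  moreover have "total_ideal r n d v \<subseteq> ?K"
  proof (rule total_ideal_minimal[OF hom.kernel_is_ideal])
    show "all_relations r n d v \<subseteq> ?K"
    proof
      fix \<rho> assume a: "\<rho> \<in> all_relations r n d v"
      then have c: "\<rho> \<in> carrier (free_algebra n)" using all_relations_carrier[OF n] by blast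
      have "affine_class r n \<rho> \<in> cyclotomic_ideal r n d v"
      proof (cases "\<rho> \<in> affine_relations r n")
        case True
        then have "\<rho> \<in> affine_ideal r n"
          unfolding affine_ideal_def
          using ring.genideal_self[OF ring_free_algebra affine_relations_carrier] by blast
        then have "affine_class r n \<rho> = \<zero>\<^bsub>affine_YH r n\<^esub>"
          unfolding affine_class_def zero_affine_YH
          by (rule ring.a_rcos_zero[OF ring_free_algebra ideal_affine_ideal])
        then show ?thesis
          using additive_subgroup.zero_closed[OF ideal.axioms(1)[OF ideal_cyclotomic_ideal]] by simp
      next
        case False
        then have "\<rho> = cyclotomic_element d v" using a by (simp add: all_relations_def)
        then show ?thesis using cyclotomic_class by simp
      qed
      then have "YH_class r n d v \<rho> = \<zero>\<^bsub>YH r n d v\<^esub>"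
        unfolding YH_class_def zero_YH by (rule ring.a_rcos_zero[OF ring_affine_YH ideal_cyclotomic_ideal])
      then show "\<rho> \<in> ?K" using c unfolding a_kernel_def' by blast
    qed
  qed
  ultimately show "YH_class r n d v P = \<zero>\<^bsub>YH r n d v\<^esub>" unfolding a_kernel_def' by blast
next
  let ?A = "affine_YH r n" and ?I = "affine_ideal r n"
  assume "YH_class r n d v P = \<zero>\<^bsub>YH r n d v\<^esub>"
  then have "cyclotomic_ideal r n d v +>\<^bsub>?A\<^esub> affine_class r n P = cyclotomic_ideal r n d v"
    by (simp add: YH_class_def zero_YH)
  moreover have cP: "affine_class r n P \<in> carrier ?A" using ring_hom_closed[OF affine_class_hom P] .
  ultimately have "affine_class r n P \<in> cyclotomic_ideal r n d v"
    using abelian_subgroup.a_rcos_self[OF abelian_subgroupI3[OF ideal.axioms(1)[OF ideal_cyclotomic_ideal] ring.is_abelian_group[OF ring_affine_YH]] cP]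
    by simp
  also have "cyclotomic_ideal r n d v \<subseteq> affine_class r n ` total_ideal r n d v"
    unfolding cyclotomic_ideal_def
  proof (rule ring.genideal_minimal[OF ring_affine_YH])
    have "ideal ((+>\<^bsub>free_algebra n\<^esub>) ?I ` total_ideal r n d v) (free_algebra n Quot ?I)"
      by (rule ring.ring_ideal_imp_quot_ideal[OF ring_free_algebra ideal_affine_ideal ideal_total_ideal[OF n]])
    then show "ideal (affine_class r n ` total_ideal r n d v) ?A"
      by (simp add: affine_class_def[abs_def] affine_YH_def)
    show "{affine_class r n (prod_list (map (\<lambda>l. fx 1 - fconst (v l)) [1..<Suc d]))} \<subseteq> affine_class r n ` total_ideal r n d v"
      using all_relations_subset[OF n, of r d v] by (auto simp: all_relations_def cyclotomic_element_def)
  qed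
  finally obtain Q where Q: "Q \<in> total_ideal r n d v" "affine_class r n P = affine_class r n Q" by blast
  interpret T: ideal "total_ideal r n d v" "free_algebra n" by (rule ideal_total_ideal[OF n])
  have cQ: "Q \<in> carrier (free_algebra n)" using Q(1) T.a_subset by blast
  have "P \<ominus>\<^bsub>free_algebra n\<^esub> Q \<in> ?I"
    using ring.quotient_eq_iff_same_a_r_cos[OF ring_free_algebra ideal_affine_ideal P cQ] Q(2)
    by (simp add: affine_class_def)
  then have "P - Q \<in> total_ideal r n d v"
    using affine_ideal_subset by (auto simp: free_algebra_a_minus P cQ)
  from total_ideal_closed(2)[OF n this Q(1)] show "P \<in> total_ideal r n d v" by simp
qed

lemma YH_class_eq_iff:
  assumes "P \<in> carrier (free_algebra n)" "Q \<in> carrier (free_algebra n)"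
  shows "YH_class r n d v P = YH_class r n d v Q \<longleftrightarrow> P - Q \<in> total_ideal r n d v"
proof -
  interpret hom: ring_hom_ring "free_algebra n" "YH r n d v" "YH_class r n d v"
    by (rule ring_hom_ringI2[OF ring_free_algebra ring_YH YH_class_hom])
  have PQ: "P - Q \<in> carrier (free_algebra n)" by (rule free_algebra_diff[OF assms])
  have "YH_class r n d v P = YH_class r n d v (P - Q) \<oplus>\<^bsub>YH r n d v\<^esub> YH_class r n d v Q"
    using hom.hom_add[OF PQ assms(2)] by simp
  moreover have "YH_class r n d v Q = \<zero>\<^bsub>YH r n d v\<^esub> \<oplus>\<^bsub>YH r n d v\<^esub> YH_class r n d v Q"
    using hom.hom_closed[OF assms(2)] by simp
  ultimately have "YH_class r n d v P = YH_class r n d v Q \<longleftrightarrow> YH_class r n d v (P - Q) = \<zero>\<^bsub>YH r n d v\<^esub>"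
    using hom.S.add.right_cancel[of "YH_class r n d v Q" "YH_class r n d v (P - Q)" "\<zero>\<^bsub>YH r n d v\<^esub>"]
      hom.hom_closed[OF assms(2)] hom.hom_closed[OF PQ] by simp
  then show ?thesis unfolding YH_class_eq_zero[OF PQ] .
qed

end

text \<open>
  Symbols that are not generators are sent to zero. The algebra thereby becomes a quotient of
  the whole type of noncommutative polynomials by \<open>null_ideal\<close>, and no carriers have to be
  tracked.
\<close>

definition restrict_gens :: "nat \<Rightarrow> 'f::field falg \<Rightarrow> 'f falg" where
  "restrict_gens n P = Poly_Mapping.mapp (\<lambda>w c. if good_word n w then c else 0) P"

lemma lookup_restrict_gens:
  "Poly_Mapping.lookup (restrict_gens n P) w = (if good_word n w then Poly_Mapping.lookup P w else 0)"
  by (simp add: restrict_gens_def lookup_mapp when_def in_keys_iff)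

lemma restrict_gens_carrier: "restrict_gens n P \<in> carrier (free_algebra n)"
  by (simp add: mem_free_algebra lookup_restrict_gens)

lemma restrict_gens_id: "P \<in> carrier (free_algebra n) \<Longrightarrow> restrict_gens n P = P"
  by (rule poly_mapping_eqI) (auto simp: lookup_restrict_gens mem_free_algebra)

lemma restrict_gens_add: "restrict_gens n (P + Q) = restrict_gens n P + restrict_gens n Q"
  by (rule poly_mapping_eqI) (simp add: lookup_restrict_gens lookup_add)

lemma restrict_gens_diff: "restrict_gens n (P - Q) = restrict_gens n P - restrict_gens n Q"
  by (rule poly_mapping_eqI) (simp add: lookup_restrict_gens lookup_minus)

lemma restrict_gens_zero [simp]: "restrict_gens n 0 = 0"
  by (rule restrict_gens_id[OF free_algebra_zero])

lemma restrict_gens_single: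
  "restrict_gens n (Poly_Mapping.single w c) = (if good_word n w then Poly_Mapping.single w c else 0)"
  by (rule poly_mapping_eqI) (auto simp: lookup_restrict_gens lookup_single when_def)

lemma restrict_gens_mult: "restrict_gens n (P * Q) = restrict_gens n P * restrict_gens n Q"
proof (induction P rule: poly_mapping_single_induct)
  case (single w c)
  show ?case
  proof (induction Q rule: poly_mapping_single_induct)
    case (single w' c')
    then show ?case by (simp add: mult_single restrict_gens_single good_word_plus)
  qed (simp_all add: restrict_gens_add distrib_left)
qed (simp_all add: restrict_gens_add distrib_right)

definition null_ideal :: "nat \<Rightarrow> nat \<Rightarrow> nat \<Rightarrow> (nat \<Rightarrow> 'f::field) \<Rightarrow> 'f falg set" where
  "null_ideal r n d v = {P. restrict_gens n P \<in> total_ideal r n d v}"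

definition cls :: "nat \<Rightarrow> nat \<Rightarrow> nat \<Rightarrow> (nat \<Rightarrow> 'f::field) \<Rightarrow> 'f falg \<Rightarrow> 'f falg set set" where
  "cls r n d v P = YH_class r n d v (restrict_gens n P)"

lemma cls_YH_class: "P \<in> carrier (free_algebra n) \<Longrightarrow> YH_class r n d v P = cls r n d v P"
  by (simp add: cls_def restrict_gens_id)

lemma fconst_hom:
  "fconst (a + b) = fconst a + fconst b" "fconst (a * b) = fconst a * fconst b" "fconst 1 = 1"
  by (simp_all add: fconst_def single_add mult_single)

lemma fconst_central: "fconst a * P = P * fconst a"
proof (induction P rule: poly_mapping_single_induct)
  case (single w c)
  then show ?case by (simp add: fconst_def mult_single mult.commute)
qed (simp_all add: distrib_left distrib_right)

context
  fixes r n d :: nat and v :: "nat \<Rightarrow> 'f::field"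
  assumes n: "1 \<le> n"
begin

lemma ideal_mod_null_ideal: "ideal_mod (null_ideal r n d v) fconst"
proof -
  show ?thesis
  proof
    show "0 \<in> null_ideal r n d v" by (simp add: null_ideal_def total_ideal_closed[OF n])
    show "P + Q \<in> null_ideal r n d v" if "P \<in> null_ideal r n d v" "Q \<in> null_ideal r n d v" for P Q
      using that by (simp add: null_ideal_def restrict_gens_add total_ideal_closed[OF n])
    show "Q * P \<in> null_ideal r n d v" "P * Q \<in> null_ideal r n d v" if "P \<in> null_ideal r n d v" for P Q
      using that by (simp_all add: null_ideal_def restrict_gens_mult restrict_gens_carrier total_ideal_closed[OF n])
    show "fconst s * P = P * fconst s" for s P by (rule fconst_central)
  qed (simp_all add: fconst_hom)
qed

lemma relation_null: "\<rho> \<in> all_relations r n d v \<Longrightarrow> \<rho> \<in> null_ideal r n d v"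
  using all_relations_subset[OF n, of r d v] all_relations_carrier[OF n, of r d v]
  by (simp add: null_ideal_def restrict_gens_id subset_iff)

lemma cls_eq_iff: "cls r n d v P = cls r n d v Q \<longleftrightarrow> P - Q \<in> null_ideal r n d v"
  unfolding cls_def YH_class_eq_iff[OF n restrict_gens_carrier restrict_gens_carrier]
  by (simp add: null_ideal_def restrict_gens_diff)

lemma cls_mult: "cls r n d v (P * Q) = cls r n d v P \<otimes>\<^bsub>YH r n d v\<^esub> cls r n d v Q"
  unfolding cls_def restrict_gens_mult
  using ring_hom_mult[OF YH_class_hom[OF n] restrict_gens_carrier restrict_gens_carrier] by simp

lemma cls_one: "cls r n d v 1 = \<one>\<^bsub>YH r n d v\<^esub>"
  unfolding cls_def restrict_gens_id[OF free_algebra_one]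
  using ring_hom_one[OF YH_class_hom[OF n]] by simp

lemma cls_carrier: "cls r n d v P \<in> carrier (YH r n d v)"
  unfolding cls_def by (rule ring_hom_closed[OF YH_class_hom[OF n] restrict_gens_carrier])

lemma cls_ring_prod_list: "ring_prod_list (YH r n d v) (map (\<lambda>i. cls r n d v (f i)) xs) = cls r n d v (prod_list (map f xs))"
  by (induction xs) (simp_all add: ring_prod_list_def cls_one cls_mult)

lemma cls_inv:
  assumes "P * Q - fconst c \<in> null_ideal r n d v" "Q * P - fconst c \<in> null_ideal r n d v" "c \<noteq> 0"
  shows "inv\<^bsub>YH r n d v\<^esub> (cls r n d v P) = cls r n d v (fconst (1 / c) * Q)"
proof -
  interpret I: ideal_mod "null_ideal r n d v" fconst by (rule ideal_mod_null_ideal)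
  interpret Y: ring "YH r n d v" by (rule ring_YH[OF n])
  have unit: "fconst (1 / c) * fconst c = (1 :: 'f falg)"
    using assms(3) by (simp add: fconst_hom(2)[symmetric] fconst_hom(3))
  have "P * (fconst (1 / c) * Q) - 1 = fconst (1 / c) * (P * Q - fconst c)"
    unfolding right_diff_distrib unit I.kap_left_commute[of P] ..
  then have 1: "cls r n d v P \<otimes>\<^bsub>YH r n d v\<^esub> cls r n d v (fconst (1 / c) * Q) = \<one>\<^bsub>YH r n d v\<^esub>"
    unfolding cls_mult[symmetric] cls_one[symmetric] cls_eq_iff using I.J_left[OF assms(1)] by simp
  have "fconst (1 / c) * Q * P - 1 = fconst (1 / c) * (Q * P - fconst c)"
    unfolding right_diff_distrib unit mult.assoc ..
  then have 2: "cls r n d v (fconst (1 / c) * Q) \<otimes>\<^bsub>YH r n d v\<^esub> cls r n d v P = \<one>\<^bsub>YH r n d v\<^esub>"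
    unfolding cls_mult[symmetric] cls_one[symmetric] cls_eq_iff using I.J_left[OF assms(2)] by simp
  show ?thesis using 1 2 by (metis Y.inv_char cls_carrier)
qed

end

lemma yokonuma_free_algebra:
  assumes n: "1 \<le> n" and zt: "\<And>p. p \<in> {1..r} \<Longrightarrow> zt p ^ r = 1" "inj_on zt {1..r}" and r: "of_nat r \<noteq> (0::'f::field)"
  shows "yokonuma (null_ideal r n d v) fconst fx ft fg (fe r) n r d v (zt :: nat \<Rightarrow> 'f)"
proof -
  interpret I: ideal_mod "null_ideal r n d v" fconst by (rule ideal_mod_null_ideal[OF n])
  have rel: "I.cg a b" if "a - b \<in> all_relations r n d v" for a b
    unfolding I.cg_def using relation_null[OF n that] .
  have aff: "I.cg a b" if "a - b \<in> affine_relations r n" for a b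
    using rel that by (simp add: all_relations_def)
  show ?thesis
  proof (intro yokonuma.intro yokonuma_axioms.intro)
    show "ideal_mod (null_ideal r n d v) fconst" by (rule I.ideal_mod_axioms)
    fix i :: nat
    show "fe r i = fconst (1 / of_nat r) * (\<Sum>s\<in>{0..<r}. ft i ^ s * ft (i + 1) ^ (r - s))"
      by (rule fe_def)
  next
    fix i assume i: "i \<in> {1..<n}"
    show "I.cg (fg i * fg i) 1"
      using i by (intro aff) (unfold affine_relations_def power2_eq_square, blast)
    show "I.cg (fg i * fx (i + 1)) (fx i * fg i + fe r i)"
      using i by (intro aff) (unfold affine_relations_def, blast)
  next
    fix i assume "i \<in> {1..<n}" "i + 1 \<in> {1..<n}"
    then show "I.cg (fg i * fg (i + 1) * fg i) (fg (i + 1) * fg i * fg (i + 1))"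
      by (intro aff) (unfold affine_relations_def, blast)
  next
    fix i j assume "i \<in> {1..<n}" "j \<in> {1..<n}" "\<bar>int i - int j\<bar> \<ge> 2"
    then show "I.cg (fg i * fg j) (fg j * fg i)"
      by (intro aff) (unfold affine_relations_def, blast)
  next
    fix i j assume ij: "i \<in> {1..<n}" "j \<in> {1..n}"
    show "I.cg (fg i * ft j) (ft (Transposition.transpose i (i + 1) j) * fg i)"
      using ij by (intro aff) (unfold affine_relations_def, blast)
    assume "j \<noteq> i" "j \<noteq> i + 1"
    then show "I.cg (fg i * fx j) (fx j * fg i)"
      using ij by (intro aff) (unfold affine_relations_def, blast)
  next
    fix i assume i: "i \<in> {1..n}"
    show "I.cg (ft i ^ r) 1" using i by (intro aff) (unfold affine_relations_def, blast)
    fix j assume j: "j \<in> {1..n}"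
    show "I.cg (ft i * ft j) (ft j * ft i)" using i j by (intro aff) (unfold affine_relations_def, blast)
    show "I.cg (fx i * fx j) (fx j * fx i)" using i j by (intro aff) (unfold affine_relations_def, blast)
    show "I.cg (ft j * fx i) (fx i * ft j)" using i j by (intro aff) (unfold affine_relations_def, blast)
  next
    have "I.pl (fx 1) (map v [1..<Suc d]) = cyclotomic_element d v"
      unfolding I.pl_def cyclotomic_element_def map_map o_def ..
    then show "I.cg (I.pl (fx 1) (map v [1..<Suc d])) 0"
      by (intro rel) (simp add: all_relations_def)
  qed (fact zt r)+
qed

section \<open>Extension of scalars\<close>

abbreviation extend_scalars :: "'k::field falg \<Rightarrow> 'k ratfun falg" where
  "extend_scalars \<equiv> Poly_Mapping.map rconst"

lemma extend_scalars_simps: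
  "extend_scalars (P + Q) = extend_scalars P + extend_scalars Q"
  "extend_scalars (P - Q) = extend_scalars P - extend_scalars Q"
  "extend_scalars (P * Q) = extend_scalars P * extend_scalars Q"
  "extend_scalars 0 = 0" "extend_scalars 1 = 1"
  "extend_scalars (fconst c) = fconst (rconst c)"
  "extend_scalars (fgen a) = fgen a"
proof -
  show "extend_scalars 1 = 1" using map_single[of 1 rconst "0 :: fword"] by simp
qed (simp_all add: map_add map_diff map_mult map_zero rconst_add rconst_diff rconst_mult fconst_def fgen_def)

lemma extend_scalars_power: "extend_scalars (P ^ k) = extend_scalars P ^ k"
  by (induction k) (simp_all add: extend_scalars_simps)

lemma extend_scalars_sum: "extend_scalars (sum f A) = (\<Sum>i\<in>A. extend_scalars (f i))"
  by (induction A rule: infinite_finite_induct) (simp_all add: extend_scalars_simps)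

lemma extend_scalars_prod_list: "extend_scalars (prod_list (map f xs)) = prod_list (map (\<lambda>i. extend_scalars (f i)) xs)"
  by (induction xs) (simp_all add: extend_scalars_simps)

lemma extend_scalars_fe: "extend_scalars (fe r i) = fe r i"
  by (simp add: fe_def extend_scalars_simps extend_scalars_sum extend_scalars_power rconst_inverse rconst_of_nat)

lemma extend_scalars_carrier: "P \<in> carrier (free_algebra n) \<Longrightarrow> extend_scalars P \<in> carrier (free_algebra n)"
  by (simp add: mem_free_algebra lookup_map)

lemma extend_scalars_affine_relations: "extend_scalars ` affine_relations r n = affine_relations r n"
proof -
  have 1: "f ` {a i | i. P i} = {f (a i) | i. P i}" for f :: "'k falg \<Rightarrow> 'k ratfun falg" and a :: "nat \<Rightarrow> 'k falg" and P
    by blast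
  have 2: "f ` {a i j | i j. P i j} = {f (a i j) | i j. P i j}"
    for f :: "'k falg \<Rightarrow> 'k ratfun falg" and a :: "nat \<Rightarrow> nat \<Rightarrow> 'k falg" and P by blast
  show ?thesis
    unfolding affine_relations_def image_Un 1 2 extend_scalars_simps extend_scalars_power extend_scalars_fe ..
qed

lemma extend_scalars_all_relations:
  "extend_scalars ` all_relations r n d v = all_relations r n d (\<lambda>l. rconst (v l))"
  by (simp add: all_relations_def extend_scalars_affine_relations cyclotomic_element_def
      extend_scalars_prod_list extend_scalars_simps)

context
  fixes r n d :: nat and v :: "nat \<Rightarrow> 'k::field"
  assumes n: "1 \<le> n"
begin

abbreviation (input) rational_ideal :: "'k ratfun falg set" where
  "rational_ideal \<equiv> total_ideal r n d (\<lambda>l. rconst (v l))"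

lemma extend_scalars_total_ideal:
  assumes "P \<in> total_ideal r n d v" shows "extend_scalars P \<in> rational_ideal"
proof -
  let ?I = "{P \<in> carrier (free_algebra n). extend_scalars P \<in> rational_ideal}"
  have "total_ideal r n d v \<subseteq> ?I"
  proof (rule total_ideal_minimal)
    show "ideal ?I (free_algebra n)"
      by (intro free_algebra_idealI)
        (auto intro: free_algebra_closed simp: extend_scalars_simps total_ideal_closed[OF n] extend_scalars_carrier)
    show "all_relations r n d v \<subseteq> ?I"
      using all_relations_carrier[OF n, of r d v] all_relations_subset[OF n, of r d "\<lambda>l. rconst (v l)"]
      unfolding extend_scalars_all_relations[symmetric] by blast
  qed
  then show ?thesis using assms by blast
qed

lemma const_linear_zero: "const_linear V \<Longrightarrow> V 0 = 0"
  unfolding const_linear_def by (metis add_cancel_right_right)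

lemma const_linear_add: "const_linear V \<Longrightarrow> V (f + h) = V f + V h"
  by (simp add: const_linear_def)

lemma map_single_mult:
  assumes V: "const_linear V"
  shows "Poly_Mapping.map V (Poly_Mapping.single w c * P) = Poly_Mapping.single w 1 * Poly_Mapping.map (\<lambda>f. V (c * f)) P"
    and "Poly_Mapping.map V (P * Poly_Mapping.single w c) = Poly_Mapping.map (\<lambda>f. V (f * c)) P * Poly_Mapping.single w 1"
proof -
  note z = const_linear_zero[OF V] and a = const_linear_add[OF V]
  show "Poly_Mapping.map V (Poly_Mapping.single w c * P) = Poly_Mapping.single w 1 * Poly_Mapping.map (\<lambda>f. V (c * f)) P"
    by (induction P rule: poly_mapping_single_induct) (simp_all add: map_zero mult_single z a map_add distrib_left)
  show "Poly_Mapping.map V (P * Poly_Mapping.single w c) = Poly_Mapping.map (\<lambda>f. V (f * c)) P * Poly_Mapping.single w 1"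
    by (induction P rule: poly_mapping_single_induct) (simp_all add: map_zero mult_single z a map_add distrib_right)
qed

lemma sum_of_singles: "(P :: fword \<Rightarrow>\<^sub>0 'b::comm_monoid_add) = (\<Sum>w\<in>Poly_Mapping.keys P. Poly_Mapping.single w (Poly_Mapping.lookup P w))"
  by (rule poly_mapping_eqI) (auto simp: lookup_sum lookup_single when_def in_keys_iff)

lemma map_sum: "const_linear V \<Longrightarrow> Poly_Mapping.map V (sum f A) = (\<Sum>i\<in>A. Poly_Mapping.map V (f i))"
  by (induction A rule: infinite_finite_induct) (simp_all add: map_zero map_add const_linear_zero const_linear_add)

text \<open>
  The relations have constant coefficients, so the ideal that they generate over the rational
  functions is stable under every map that is linear over the constants and applied to
  coefficients.
\<close>

lemma const_linear_total_ideal: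
  assumes "P \<in> rational_ideal" "const_linear V" shows "Poly_Mapping.map V P \<in> rational_ideal"
proof -
  let ?C = "carrier (free_algebra n) :: 'k ratfun falg set"
  \<comment> \<open>All maps are considered at once, because multiplication of \<open>P\<close> by a scalar \<open>c\<close> turns \<open>V\<close> into
    the map \<open>f \<mapsto> V (c f)\<close>.\<close>
  let ?I = "{P \<in> ?C. \<forall>V. const_linear V \<longrightarrow> Poly_Mapping.map V P \<in> rational_ideal}"
  have Tsum: "sum f A \<in> rational_ideal" if "\<And>i. i \<in> A \<Longrightarrow> f i \<in> rational_ideal" for f :: "fword \<Rightarrow> 'k ratfun falg" and A
    using that by (induction A rule: infinite_finite_induct) (auto simp: total_ideal_closed[OF n])
  have word: "Poly_Mapping.single w 1 \<in> ?C" if "w \<in> Poly_Mapping.keys Q" "Q \<in> ?C" for w Q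
    using that by (auto simp: mem_free_algebra lookup_single when_def in_keys_iff)
  have lin: "const_linear (\<lambda>f. V (c * f))" "const_linear (\<lambda>f. V (f * c))" if "const_linear V" for V and c :: "'k ratfun"
  proof -
    have "V (c * (rconst a * f)) = rconst a * V (c * f)" for a f
      using that unfolding const_linear_def mult.left_commute[of c "rconst a" f] by blast
    moreover have "V (c * (f + h)) = V (c * f) + V (c * h)" for f h
      unfolding distrib_left by (rule const_linear_add[OF that])
    ultimately show "const_linear (\<lambda>f. V (c * f))" unfolding const_linear_def by blast
    then show "const_linear (\<lambda>f. V (f * c))" unfolding mult.commute[of c] .
  qed
  have "rational_ideal \<subseteq> ?I"
  proof (rule total_ideal_minimal)
    show "ideal ?I (free_algebra n)"
    proof (rule free_algebra_idealI)
      fix P Q assume P: "P \<in> ?I" and Q: "Q \<in> ?C"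
      have "Poly_Mapping.map V (Q * P) \<in> rational_ideal" if V: "const_linear V" for V
      proof -
        have "Poly_Mapping.map V (Q * P) = (\<Sum>w\<in>Poly_Mapping.keys Q.
          Poly_Mapping.single w 1 * Poly_Mapping.map (\<lambda>f. V (Poly_Mapping.lookup Q w * f)) P)"
          by (subst sum_of_singles[of Q]) (simp add: sum_distrib_right map_sum[OF V] map_single_mult[OF V])
        also have "\<dots> \<in> rational_ideal"
        proof (rule Tsum)
          fix w assume w: "w \<in> Poly_Mapping.keys Q"
          have "Poly_Mapping.map (\<lambda>f. V (Poly_Mapping.lookup Q w * f)) P \<in> rational_ideal"
            using P lin(1)[OF V] by simp
          then show "Poly_Mapping.single w 1 * Poly_Mapping.map (\<lambda>f. V (Poly_Mapping.lookup Q w * f)) P \<in> rational_ideal"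
            by (rule total_ideal_closed(3)[OF n _ word[OF w Q]])
        qed
        finally show ?thesis .
      qed
      then show "Q * P \<in> ?I" using P Q free_algebra_mult by blast
      have "Poly_Mapping.map V (P * Q) \<in> rational_ideal" if V: "const_linear V" for V
      proof -
        have "Poly_Mapping.map V (P * Q) = (\<Sum>w\<in>Poly_Mapping.keys Q.
          Poly_Mapping.map (\<lambda>f. V (f * Poly_Mapping.lookup Q w)) P * Poly_Mapping.single w 1)"
          by (subst sum_of_singles[of Q]) (simp add: sum_distrib_left map_sum[OF V] map_single_mult[OF V])
        also have "\<dots> \<in> rational_ideal"
        proof (rule Tsum)
          fix w assume w: "w \<in> Poly_Mapping.keys Q"
          have "Poly_Mapping.map (\<lambda>f. V (f * Poly_Mapping.lookup Q w)) P \<in> rational_ideal"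
            using P lin(2)[OF V] by simp
          then show "Poly_Mapping.map (\<lambda>f. V (f * Poly_Mapping.lookup Q w)) P * Poly_Mapping.single w 1 \<in> rational_ideal"
            by (rule total_ideal_closed(4)[OF n _ word[OF w Q]])
        qed
        finally show ?thesis .
      qed
      then show "P * Q \<in> ?I" using P Q free_algebra_mult by blast
    qed (auto simp: map_zero map_add const_linear_zero const_linear_add free_algebra_closed total_ideal_closed[OF n])
    show "all_relations r n d (\<lambda>l. rconst (v l)) \<subseteq> ?I"
    proof
      fix \<rho> :: "'k ratfun falg" assume a: "\<rho> \<in> all_relations r n d (\<lambda>l. rconst (v l))"
      then obtain \<rho>' where \<rho>': "\<rho>' \<in> all_relations r n d v" "\<rho> = extend_scalars \<rho>'"
        unfolding extend_scalars_all_relations[symmetric] by blast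
      have "Poly_Mapping.map V \<rho> = fconst (V 1) * \<rho>" if V: "const_linear V" for V
      proof (rule poly_mapping_eqI)
        fix w
        have "V (rconst c) = V 1 * rconst c" for c
          using V unfolding const_linear_def by (metis mult.commute mult.right_neutral)
        then show "Poly_Mapping.lookup (Poly_Mapping.map V \<rho>) w = Poly_Mapping.lookup (fconst (V 1) * \<rho>) w"
          by (simp add: \<rho>'(2) fconst_def mult_map_scale_conv_mult[symmetric] lookup_map const_linear_zero[OF V])
      qed
      moreover have "fconst c * \<rho> \<in> rational_ideal" for c
        using a all_relations_subset[OF n] by (intro total_ideal_closed(3)[OF n _ free_algebra_fconst]) blast
      moreover have "\<rho> \<in> ?C" using a all_relations_carrier[OF n] by blast
      ultimately show "\<rho> \<in> ?I" by simp
    qed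
  qed
  then show ?thesis using assms by blast
qed

end

section \<open>Evaluation of rational functions with values in the algebra\<close>

definition coeff_value :: "var \<Rightarrow> 'k::field \<Rightarrow> 'k ratfun falg \<Rightarrow> 'k ratfun falg \<Rightarrow> bool" where
  "coeff_value z a P Q \<longleftrightarrow> (\<forall>w. has_value z a (Poly_Mapping.lookup P w) (Poly_Mapping.lookup Q w))"

lemma coeff_value_zero: "coeff_value z a 0 0"
  by (simp add: coeff_value_def)

lemma coeff_value_add: "coeff_value z a P Q \<Longrightarrow> coeff_value z a P' Q' \<Longrightarrow> coeff_value z a (P + P') (Q + Q')"
  by (simp add: coeff_value_def lookup_add has_value_add)

lemma coeff_value_sum: "(\<And>i. i \<in> A \<Longrightarrow> coeff_value z a (f i) (h i)) \<Longrightarrow> coeff_value z a (sum f A) (sum h A)"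
  by (induction A rule: infinite_finite_induct) (auto intro: coeff_value_add coeff_value_zero)

lemma coeff_value_single:
  "has_value z a f h \<Longrightarrow> coeff_value z a (Poly_Mapping.single w f) (Poly_Mapping.single w h)"
  by (auto simp: coeff_value_def lookup_single when_def)

lemma coeff_value_extend_scalars: "coeff_value z a (extend_scalars P) (extend_scalars P)"
  by (simp add: coeff_value_def lookup_map has_value_rconst)

lemma sum_of_singles_superset:
  "finite S \<Longrightarrow> Poly_Mapping.keys P \<subseteq> S \<Longrightarrow>
    (P :: fword \<Rightarrow>\<^sub>0 'b::comm_monoid_add) = (\<Sum>w\<in>S. Poly_Mapping.single w (Poly_Mapping.lookup P w))"
  by (rule poly_mapping_eqI) (auto simp: lookup_sum lookup_single when_def in_keys_iff)

lemma coeff_value_mult: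
  assumes "coeff_value z a P Q" "coeff_value z a P' Q'"
  shows "coeff_value z a (P * P') (Q * Q')"
proof -
  let ?S = "Poly_Mapping.keys P \<union> Poly_Mapping.keys Q" and ?S' = "Poly_Mapping.keys P' \<union> Poly_Mapping.keys Q'"
  have e: "R * R' = (\<Sum>w\<in>?S. \<Sum>w'\<in>?S'. Poly_Mapping.single (w + w') (Poly_Mapping.lookup R w * Poly_Mapping.lookup R' w'))"
    if "Poly_Mapping.keys R \<subseteq> ?S" "Poly_Mapping.keys R' \<subseteq> ?S'" for R R'
  proof -
    have "R * R' = (\<Sum>w\<in>?S. Poly_Mapping.single w (Poly_Mapping.lookup R w)) *
        (\<Sum>w\<in>?S'. Poly_Mapping.single w (Poly_Mapping.lookup R' w))"
      using sum_of_singles_superset[OF _ that(1)] sum_of_singles_superset[OF _ that(2)] by simp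
    then show ?thesis by (simp add: sum_product mult_single)
  qed
  have "coeff_value z a
    (\<Sum>w\<in>?S. \<Sum>w'\<in>?S'. Poly_Mapping.single (w + w') (Poly_Mapping.lookup P w * Poly_Mapping.lookup P' w'))
    (\<Sum>w\<in>?S. \<Sum>w'\<in>?S'. Poly_Mapping.single (w + w') (Poly_Mapping.lookup Q w * Poly_Mapping.lookup Q' w'))"
    using assms unfolding coeff_value_def[of z a P] coeff_value_def[of z a P']
    by (intro coeff_value_sum coeff_value_single has_value_mult) auto
  then show ?thesis using e[of P P'] e[of Q Q'] by simp
qed

text \<open>
  Evaluation of representatives, up to the ideal on both sides, so that it is compatible with
  congruences.
\<close>

definition ev :: "nat \<Rightarrow> nat \<Rightarrow> nat \<Rightarrow> (nat \<Rightarrow> 'k::field) \<Rightarrow> var \<Rightarrow> 'k \<Rightarrow> 'k ratfun falg \<Rightarrow> 'k ratfun falg \<Rightarrow> bool" where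
  "ev r n d v z a P Q \<longleftrightarrow>
     (\<exists>P' Q'. P - P' \<in> null_ideal r n d (\<lambda>l. rconst (v l)) \<and> Q - Q' \<in> null_ideal r n d (\<lambda>l. rconst (v l)) \<and>
        coeff_value z a P' Q')"

lemma map_value_at:
  assumes "coeff_value z a P Q" shows "Poly_Mapping.map (value_at z a) P = Q"
proof (rule poly_mapping_eqI)
  fix w
  have h: "has_value z a (Poly_Mapping.lookup P w) (Poly_Mapping.lookup Q w)" using assms by (simp add: coeff_value_def)
  show "Poly_Mapping.lookup (Poly_Mapping.map (value_at z a) P) w = Poly_Mapping.lookup Q w"
  proof (cases "Poly_Mapping.lookup P w = 0")
    case True
    then show ?thesis using h has_value_unique[OF has_value_0] by (simp add: Poly_Mapping.map.rep_eq)
  next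
    case False
    then show ?thesis using has_value_value_at[OF h] by (simp add: Poly_Mapping.map.rep_eq)
  qed
qed

context
  fixes r n d :: nat and v :: "nat \<Rightarrow> 'k::field"
  assumes n: "1 \<le> n"
begin

interpretation R: ideal_mod "null_ideal r n d (\<lambda>l. rconst (v l))" fconst
  by (rule ideal_mod_null_ideal[OF n])

abbreviation (input) "J \<equiv> null_ideal r n d (\<lambda>l. rconst (v l))"

text \<open>
  The difference of two expressions for the same element lies in the ideal, and so does the
  difference of the values, because evaluation extends to a map that is linear over the
  constants.
\<close>

lemma is_value_at_unique:
  assumes "is_value_at r n d v z a f h" "is_value_at r n d v z a f h'"
  shows "h = h'"
proof -
  obtain P P' where P: "P \<in> carrier (free_algebra n)" "f = YH_rat_class r n d v P"
    "\<And>w. regular_at z a (Poly_Mapping.lookup P w)" "h = YH_rat_class r n d v (Poly_Mapping.map (value_at z a) P)"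
    and P': "P' \<in> carrier (free_algebra n)" "f = YH_rat_class r n d v P'"
    "\<And>w. regular_at z a (Poly_Mapping.lookup P' w)" "h' = YH_rat_class r n d v (Poly_Mapping.map (value_at z a) P')"
    using assms unfolding is_value_at_def by blast
  obtain V :: "'k ratfun \<Rightarrow> 'k ratfun" where V: "const_linear V" "\<And>f h. has_value z a f h \<Longrightarrow> V f = h"
    by (rule value_linear_extension[of z a]) (rule that, blast, blast)
  have mV: "Poly_Mapping.map V Q = Poly_Mapping.map (value_at z a) Q" if "\<And>w. regular_at z a (Poly_Mapping.lookup Q w)" for Q
    using V(2)[OF regular_at_has_value[OF that]]
    by (intro poly_mapping_eqI) (simp add: Poly_Mapping.map.rep_eq)
  have V0: "V 0 = 0" using V(2)[OF has_value_0] .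
  have Vd: "V (f - h) = V f - V h" for f h
    using const_linear_add[OF n V(1), of "f - h" h] by simp
  have "YH_class r n d (\<lambda>l. rconst (v l)) P = YH_class r n d (\<lambda>l. rconst (v l)) P'"
    using P(2) P'(2) by (simp add: YH_rat_class_def)
  then have "P - P' \<in> total_ideal r n d (\<lambda>l. rconst (v l))"
    unfolding YH_class_eq_iff[OF n P(1) P'(1)] .
  from const_linear_total_ideal[OF n this V(1)]
  have "Poly_Mapping.map (value_at z a) P - Poly_Mapping.map (value_at z a) P' \<in> total_ideal r n d (\<lambda>l. rconst (v l))"
    by (simp add: map_diff V0 Vd mV P(3) P'(3))
  moreover have "Poly_Mapping.map (value_at z a) P \<in> carrier (free_algebra n)"
    "Poly_Mapping.map (value_at z a) P' \<in> carrier (free_algebra n)"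
    using P(1) P'(1) by (simp_all add: mem_free_algebra Poly_Mapping.map.rep_eq)
  ultimately show ?thesis
    using P(4) P'(4) YH_class_eq_iff[OF n] unfolding YH_rat_class_def by blast
qed

lemma ev_YH_eval:
  assumes "ev r n d v z a P Q"
  shows "YH_eval r n d v (z, a) (cls r n d (\<lambda>l. rconst (v l)) P) = Some (cls r n d (\<lambda>l. rconst (v l)) Q)"
proof -
  obtain P' Q' where PQ: "P - P' \<in> J" "Q - Q' \<in> J" "coeff_value z a P' Q'"
    using assms by (auto simp: ev_def)
  let ?P = "restrict_gens n P'" and ?Q = "restrict_gens n Q'"
  have c: "coeff_value z a ?P ?Q" using PQ(3) by (simp add: coeff_value_def lookup_restrict_gens)
  have e: "cls r n d (\<lambda>l. rconst (v l)) P = YH_rat_class r n d v ?P" "cls r n d (\<lambda>l. rconst (v l)) Q = YH_rat_class r n d v ?Q"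
    using cls_eq_iff[OF n] PQ unfolding YH_rat_class_def cls_def by blast+
  have "is_value_at r n d v z a (cls r n d (\<lambda>l. rconst (v l)) P) (cls r n d (\<lambda>l. rconst (v l)) Q)"
    unfolding is_value_at_def e
  proof (intro bexI[of _ ?P] conjI allI)
    show "regular_at z a (Poly_Mapping.lookup ?P w)" for w
      using c has_value_value_at unfolding coeff_value_def by blast
  qed (simp_all add: map_value_at[OF c] restrict_gens_carrier)
  then show ?thesis
    using is_value_at_unique unfolding YH_eval_def fst_conv snd_conv
    by (metis (mono_tags, lifting) the1_equality)
qed

lemma ev_cong: "R.cg P P' \<Longrightarrow> R.cg Q Q' \<Longrightarrow> ev r n d v z a P Q \<Longrightarrow> ev r n d v z a P' Q'"
proof -
  assume a: "R.cg P P'" "R.cg Q Q'" and "ev r n d v z a P Q"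
  then obtain P1 Q1 where "R.cg P P1" "R.cg Q Q1" "coeff_value z a P1 Q1"
    unfolding ev_def R.cg_def by blast
  then show ?thesis using a R.cg_trans[OF R.cg_sym] unfolding ev_def R.cg_def[symmetric] by blast
qed

lemma ev_coeff_value: "coeff_value z a P Q \<Longrightarrow> ev r n d v z a P Q"
  unfolding ev_def R.cg_def[symmetric] by blast

lemma ev_add: "ev r n d v z a P Q \<Longrightarrow> ev r n d v z a P' Q' \<Longrightarrow> ev r n d v z a (P + P') (Q + Q')"
  unfolding ev_def R.cg_def[symmetric] using R.cg_add coeff_value_add by blast

lemma ev_mult: "ev r n d v z a P Q \<Longrightarrow> ev r n d v z a P' Q' \<Longrightarrow> ev r n d v z a (P * P') (Q * Q')"
  unfolding ev_def R.cg_def[symmetric] using R.cg_mult coeff_value_mult by blast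

lemma ev_fconst: "has_value z a f h \<Longrightarrow> ev r n d v z a (fconst f) (fconst h)"
  unfolding fconst_def by (intro ev_coeff_value coeff_value_single)

lemma ev_extend_scalars: "ev r n d v z a (extend_scalars P) (extend_scalars P)"
  by (intro ev_coeff_value coeff_value_extend_scalars)

lemma ev_zero: "ev r n d v z a 0 0"
  by (intro ev_coeff_value coeff_value_zero)

lemma ev_one: "ev r n d v z a 1 1"
  using ev_extend_scalars[of z a 1] by (simp add: extend_scalars_simps)

lemma ev_fgen: "ev r n d v z a (fgen b) (fgen b)"
  using ev_extend_scalars[of z a "fgen b"] by (simp add: extend_scalars_simps)

lemma ev_fe: "ev r n d v z a (fe r i) (fe r i)"
  using ev_extend_scalars[of z a "fe r i"] by (simp add: extend_scalars_fe)

lemma ev_sum: "(\<And>i. i \<in> A \<Longrightarrow> ev r n d v z a (f i) (h i)) \<Longrightarrow> ev r n d v z a (sum f A) (sum h A)"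
  by (induction A rule: infinite_finite_induct) (auto intro: ev_add ev_zero)

lemma ev_prod_list:
  "(\<And>i. i \<in> set xs \<Longrightarrow> ev r n d v z a (f i) (h i)) \<Longrightarrow> ev r n d v z a (prod_list (map f xs)) (prod_list (map h xs))"
  by (induction xs) (auto intro: ev_mult ev_one)

lemma YH_evals_chain:
  assumes "\<And>i. i < length zas \<Longrightarrow> ev r n d v (fst (zas ! i)) (snd (zas ! i)) (P i) (P (Suc i))"
  shows "YH_evals r n d v zas (cls r n d (\<lambda>l. rconst (v l)) (P 0)) =
    Some (cls r n d (\<lambda>l. rconst (v l)) (P (length zas)))"
  using assms
proof (induction zas arbitrary: P)
  case (Cons za zas)
  obtain z a where za: "za = (z, a)" by (cases za)
  have "ev r n d v z a (P 0) (P 1)" using Cons.prems[of 0] by (simp add: za)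
  from ev_YH_eval[OF this] show ?case
    using Cons.IH[of "\<lambda>i. P (Suc i)"] Cons.prems[of "Suc _"] by (simp add: za)
qed simp

end

section \<open>Roots of unity\<close>

context ideal_mod
begin

text \<open>
  An element \<open>y\<close> with \<open>y\<^sup>r = 1\<close> is annihilated by the product of all \<open>y - c\<^sup>p\<close>: the unit is a sum of
  eigenvectors of \<open>y\<close>, by Fourier inversion.
\<close>

lemma pl_roots_of_unity:
  assumes y: "y ^ r \<approx> 1" and c: "c ^ r = 1" "\<And>m. m \<in> {1..<r} \<Longrightarrow> c ^ m \<noteq> 1"
    and r: "of_nat r \<noteq> (0::'f)" and zs: "\<And>p. p < r \<Longrightarrow> c ^ p \<in> set zs"
  shows "pl y zs \<approx> 0"
proof -
  define b where "b = 1 / c"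
  have r0: "r > 0" using r by (cases r) auto
  have c0: "c \<noteq> 0" using c(1) r0 by (auto simp: zero_power)
  have br: "b ^ r = 1" using c(1) by (simp add: b_def power_divide)
  define h where "h p s = kap (b ^ (p * s)) * y ^ s" for p s
  \<comment> \<open>The component of the unit in the eigenspace of \<open>y\<close> to \<open>c\<^sup>p\<close>.\<close>
  define T where "T p = kap (1 / of_nat r) * (\<Sum>s<r. h p s)" for p
  have eig: "y * T p \<approx> kap (c ^ p) * T p" for p
  proof -
    have yh: "y * h p s = kap (c ^ p) * h p (Suc s)" for s
    proof -
      have "c ^ p * b ^ (p * Suc s) = b ^ (p * s)"
        using c0 by (simp add: b_def power_divide power_add)
      then show ?thesis by (simp add: h_def kap_left_commute[of y] kap_kap)
    qed
    have "(\<Sum>s<r. h p (Suc s)) + h p 0 = (\<Sum>s<r. h p s) + h p r"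
      by (simp add: sum.lessThan_Suc_shift[symmetric] add.commute)
    moreover have "h p r \<approx> h p 0"
    proof -
      have "b ^ (p * r) = 1" by (simp add: mult.commute[of p] power_mult br)
      then show ?thesis using y by (simp add: h_def)
    qed
    ultimately have "(\<Sum>s<r. h p (Suc s)) + h p 0 \<approx> (\<Sum>s<r. h p s) + h p 0"
      using cg_add[OF cg_refl[of "\<Sum>s<r. h p s"] \<open>h p r \<approx> h p 0\<close>] by simp
    from cg_diff[OF this cg_refl[of "h p 0"]]
    have "(\<Sum>s<r. h p (Suc s)) \<approx> (\<Sum>s<r. h p s)" by simp
    from cg_left[OF cg_left[OF this, of "kap (c ^ p)"], of "kap (1 / of_nat r)"]
    show ?thesis
      by (simp add: T_def kap_left_commute[of y] sum_distrib_left yh kap_kap mult.commute)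
  qed
  have one: "(\<Sum>p<r. T p) = 1"
  proof -
    have "(\<Sum>p<r. T p) = kap (1 / of_nat r) * (\<Sum>s<r. \<Sum>p<r. h p s)"
      by (simp add: T_def sum_distrib_left[symmetric] sum.swap[of h])
    also have "(\<Sum>s<r. \<Sum>p<r. h p s) = (\<Sum>s<r. if s = 0 then kap (of_nat r) else 0)"
    proof (rule sum.cong[OF refl])
      fix s assume s: "s \<in> {..<r}"
      have "(\<Sum>p<r. h p s) = kap (\<Sum>p<r. (b ^ s) ^ p) * y ^ s"
        by (simp add: h_def kap_sum sum_distrib_right power_mult[symmetric] mult.commute)
      also have "(\<Sum>p<r. (b ^ s) ^ p) = (if s = 0 then of_nat r else 0)"
      proof (cases "s = 0")
        case False
        then have "b ^ s \<noteq> 1" using c(2)[of s] s by (simp add: b_def power_divide)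
        moreover have "(b ^ s) ^ r = 1" by (simp add: power_mult[symmetric] mult.commute[of s] power_mult br)
        ultimately show ?thesis using False by (simp add: geometric_sum)
      qed simp
      finally show "(\<Sum>p<r. h p s) = (if s = 0 then kap (of_nat r) else 0)" by simp
    qed
    also have "\<dots> = kap (of_nat r)" using r0 by simp
    finally show ?thesis using r by (simp add: kap_mult[symmetric])
  qed
  have "pl y zs = (\<Sum>p<r. pl y zs * T p)" using one by (simp add: sum_distrib_left[symmetric])
  also have "\<dots> \<approx> (\<Sum>p<r. 0)"
  proof (rule cg_sum)
    fix p assume "p \<in> {..<r}"
    then have "pv (c ^ p) zs = 0" by (intro pv_zero zs) simp
    then show "pl y zs * T p \<approx> 0" using pl_eig[OF eig, of zs p] by simp
  qed
  finally show ?thesis by simp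
qed

lemma normalised_product:
  "prod_list (map (\<lambda>b. kap (1 / (c - b)) * (y - kap b)) bs) = kap (1 / pv c bs) * pl y bs"
proof (induction bs)
  case (Cons b bs)
  then show ?case
    by (simp add: mult.assoc kap_left_commute[of "y - kap b"] kap_kap)
qed simp

lemma normalised_commute:
  "(kap a * (y - kap b)) * (kap c * (y - kap b')) = (kap c * (y - kap b')) * (kap a * (y - kap b))"
proof -
  have "(y - kap b) * (y - kap b') = (y - kap b') * (y - kap b)"
    using pl_commute_self[of y b "[b']"] by simp
  moreover have "(kap a * p) * (kap c * q) = kap (a * c) * (p * q)" for a c p q
  proof -
    have "(kap a * p) * (kap c * q) = kap a * (p * (kap c * q))" by (rule mult.assoc)
    also have "p * (kap c * q) = kap c * (p * q)" by (rule kap_left_commute)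
    finally show ?thesis by (simp only: kap_kap)
  qed
  ultimately show ?thesis by (simp only: mult.commute[of a c])
qed

lemma prod_list_scaled:
  "prod_list (map (\<lambda>i. kap (c i) * f i) xs) = kap (prod_list (map c xs)) * prod_list (map f xs)"
proof (induction xs)
  case (Cons i xs)
  have "(kap (c i) * f i) * (kap (prod_list (map c xs)) * prod_list (map f xs))
    = kap (c i) * (kap (prod_list (map c xs)) * (f i * prod_list (map f xs)))"
    by (simp only: mult.assoc kap_left_commute[of "f i"])
  then show ?case using Cons by (simp add: kap_kap)
qed simp

lemma normalised_product_eig:
  assumes "y * z \<approx> kap a * z"
  shows "kap (1 / pv c bs) * pl y bs * z \<approx> kap (pv a bs / pv c bs) * z"
  using cg_left[OF pl_eig[OF assms, of bs], of "kap (1 / pv c bs)"] by (simp add: mult.assoc kap_kap)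

lemma commute_mult: "a * b \<approx> b * a \<Longrightarrow> a * c \<approx> c * a \<Longrightarrow> a * (b * c) \<approx> b * c * a"
proof -
  assume h: "a * b \<approx> b * a" "a * c \<approx> c * a"
  have "a * (b * c) \<approx> b * (a * c)" using cg_right[OF h(1), of c] by (simp add: mult.assoc)
  also have "\<dots> \<approx> b * (c * a)" by (rule cg_left[OF h(2)])
  finally show ?thesis by (simp add: mult.assoc)
qed

lemma commute_kap_pl: "a * y \<approx> y * a \<Longrightarrow> a * (kap s * pl y bs) \<approx> kap s * pl y bs * a"
  using kap_central[of s a] pl_commute_cg[of a y bs] by (intro commute_mult) simp_all

lemma commute_prod_list:
  "(\<And>i. i \<in> set xs \<Longrightarrow> a * f i \<approx> f i * a) \<Longrightarrow> a * prod_list (map f xs) \<approx> prod_list (map f xs) * a"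
  by (induction xs) (auto intro: commute_mult)

end

section \<open>The setting\<close>

lemma separated_if_nonzero:
  fixes v :: "nat \<Rightarrow> 'k::field"
  assumes "of_nat (fact n) * (\<Prod>(i, j)\<in>{(i, j). 1 \<le> i \<and> i < j \<and> j \<le> d}.
      \<Prod>l\<in>{- int n<..<int n}. of_int l + v i - v j) \<noteq> 0"
  shows "separated n d v"
  unfolding separated_def
proof (intro conjI allI ballI impI; elim conjE)
  fix m :: int assume m: "m \<noteq> 0" "\<bar>m\<bar> \<le> int n"
  have "nat \<bar>m\<bar> dvd fact n" using m by (intro dvd_fact) auto
  then obtain q where q: "fact n = nat \<bar>m\<bar> * q" by (auto simp: dvd_def)
  have "of_nat (fact n) \<noteq> (0::'k)" using assms by auto
  then have "of_nat (nat \<bar>m\<bar>) \<noteq> (0::'k)" unfolding q by auto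
  then show "of_int m \<noteq> (0::'k)" by (cases "m \<ge> 0") auto
next
  let ?I = "{(i, j). 1 \<le> i \<and> i < j \<and> j \<le> d}"
  have "?I \<subseteq> {1..d} \<times> {1..d}" by auto
  then have fin: "finite ?I" by (rule finite_subset) simp
  have pair: "of_int m + v i - v j \<noteq> 0" if "1 \<le> i" "i < j" "j \<le> d" "\<bar>m\<bar> < int n" for i j m
  proof -
    have "(\<Prod>l\<in>{- int n<..<int n}. of_int l + v i - v j) \<noteq> 0"
      using assms that fin by auto
    moreover have "m \<in> {- int n<..<int n}" using that(4) by auto
    ultimately show ?thesis using prod_zero[of "{- int n<..<int n}" "\<lambda>l. of_int l + v i - v j"] by blast
  qed
  fix l l' and m :: int
  assume l: "l \<in> {1..d}" "l' \<in> {1..d}" "l \<noteq> l'" "\<bar>m\<bar> < int n"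
  show "of_int m + v l - v l' \<noteq> 0"
  proof (cases "l < l'")
    case True
    then show ?thesis using pair[of l l' m] l by simp
  next
    case False
    then have "of_int (- m) + v l' - v l \<noteq> 0" using l by (intro pair) auto
    then have "- (of_int m + v l - v l') \<noteq> 0" by (simp add: algebra_simps)
    then show ?thesis by simp
  qed
qed

lemma separated_rconst: "separated n d v \<Longrightarrow> separated n d (\<lambda>l. rconst (v l))"
  unfolding separated_def by (simp add: rconst_of_int[symmetric] rconst_add[symmetric] rconst_diff[symmetric])

lemma node_content_rconst: "node_content (\<lambda>l. rconst (v l)) \<theta> = rconst (node_content v \<theta>)"
  by (simp add: node_content_diagonal rconst_add rconst_of_int)

lemma hook_product_rconst:
  "hook_product d (\<lambda>l. rconst (v l)) D = rconst (hook_product d v D)"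
proof -
  have "hk D (\<lambda>l. rconst (v l)) \<theta> m = rconst (hk D v \<theta> m)" for \<theta> m
    by (cases \<theta>) (auto simp: rconst_add rconst_diff rconst_of_nat)
  then show ?thesis by (simp add: hook_product_def rconst_prod)
qed

lemma prod_list_permute:
  fixes q :: "'i \<Rightarrow> 'a::monoid_mult"
  assumes "\<And>i j. q i * q j = q j * q i" "distinct xs" "distinct ys" "set xs = set ys"
  shows "prod_list (map q xs) = prod_list (map q ys)"
  using assms(2-4)
proof (induction xs arbitrary: ys)
  case (Cons x xs)
  have pull: "prod_list (map q zs) = q x * prod_list (map q (remove1 x zs))" if "x \<in> set zs" for zs
    using that
  proof (induction zs)
    case (Cons z zs)
    show ?case
    proof (cases "z = x")
      case False
      then have "prod_list (map q (z # zs)) = q z * (q x * prod_list (map q (remove1 x zs)))"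
        using Cons by simp
      also have "\<dots> = q x * (q z * prod_list (map q (remove1 x zs)))"
        by (simp add: mult.assoc[symmetric] assms(1)[of z x])
      finally show ?thesis using False by simp
    qed simp
  qed simp
  have "prod_list (map q xs) = prod_list (map q (remove1 x ys))"
    using Cons.prems by (intro Cons.IH) auto
  moreover have "x \<in> set ys" using Cons.prems(3) by auto
  ultimately show ?case using pull[of ys] by simp
qed simp

lemma comm_prod_cls:
  assumes n: "1 \<le> n" and q: "\<And>i j. q i * q j = q j * q i" and xs: "distinct xs"
  shows "comm_prod (YH r n d v) (\<lambda>i. cls r n d v (q i)) (set xs) = cls r n d v (prod_list (map q xs))"
  unfolding comm_prod_def cls_ring_prod_list[OF n]
proof (rule the_equality)
  show "\<forall>ys. distinct ys \<and> set ys = set xs \<longrightarrow> cls r n d v (prod_list (map q xs)) = cls r n d v (prod_list (map q ys))"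
  proof (intro allI impI, elim conjE)
    fix ys assume "distinct ys" "set ys = set xs"
    then show "cls r n d v (prod_list (map q xs)) = cls r n d v (prod_list (map q ys))"
      using prod_list_permute[of q xs ys, OF q xs] by simp
  qed
  fix y assume "\<forall>ys. distinct ys \<and> set ys = set xs \<longrightarrow> y = cls r n d v (prod_list (map q ys))"
  then show "y = cls r n d v (prod_list (map q xs))" using xs by blast
qed

text \<open>
  The extension of scalars maps the ideal of relations into that over the rational functions.
\<close>

lemma YH_const_cls:
  assumes n: "1 \<le> n" and P: "P \<in> carrier (free_algebra n)"
  shows "YH_const r n d v (cls r n d v P) = cls r n d (\<lambda>l. rconst (v l)) (extend_scalars P)"
  unfolding YH_const_def YH_rat_class_def
proof (rule the_equality)
  show "\<exists>Q\<in>carrier (free_algebra n). cls r n d v P = YH_class r n d v Q \<and>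
    cls r n d (\<lambda>l. rconst (v l)) (extend_scalars P) = YH_class r n d (\<lambda>l. rconst (v l)) (extend_scalars Q)"
    using P by (intro bexI[of _ P]) (simp_all add: cls_YH_class extend_scalars_carrier)
  fix h assume "\<exists>Q\<in>carrier (free_algebra n). cls r n d v P = YH_class r n d v Q \<and>
    h = YH_class r n d (\<lambda>l. rconst (v l)) (extend_scalars Q)"
  then obtain Q where Q: "Q \<in> carrier (free_algebra n)" "cls r n d v P = YH_class r n d v Q"
    "h = YH_class r n d (\<lambda>l. rconst (v l)) (extend_scalars Q)" by blast
  have "YH_class r n d v Q = YH_class r n d v P" using Q(2) cls_YH_class[OF P] by simp
  then have "Q - P \<in> total_ideal r n d v" unfolding YH_class_eq_iff[OF n Q(1) P] .
  from extend_scalars_total_ideal[OF n this]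
  have "extend_scalars Q - extend_scalars P \<in> total_ideal r n d (\<lambda>l. rconst (v l))"
    by (simp only: extend_scalars_simps(2))
  then have "YH_class r n d (\<lambda>l. rconst (v l)) (extend_scalars Q) = YH_class r n d (\<lambda>l. rconst (v l)) (extend_scalars P)"
    unfolding YH_class_eq_iff[OF n extend_scalars_carrier[OF Q(1)] extend_scalars_carrier[OF P]] .
  then show "h = cls r n d (\<lambda>l. rconst (v l)) (extend_scalars P)"
    unfolding Q(3) cls_YH_class[OF extend_scalars_carrier[OF P], symmetric] .
qed

text \<open>
  The hypotheses of the theorem in the form in which they are used. The calculus of weight
  vectors is applied to the algebra over the rational functions.
\<close>

locale fusion_procedure =
  fixes r d n :: nat and v :: "nat \<Rightarrow> 'k::field" and \<zeta> :: 'k and lam :: rd_partition and t :: "node \<Rightarrow> nat"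
  assumes r: "1 \<le> r" and d: "1 \<le> d" and n: "1 \<le> n" and r_inv: "of_nat r \<noteq> (0::'k)"
    and sep: "separated n d v" and prim: "primitive_root_of_unity r \<zeta>"
    and lam: "lam \<in> rd_partitions r d n" and t: "t \<in> std_tableaux n lam"
begin

abbreviation "rv \<equiv> \<lambda>l. rconst (v l)"

lemma zeta_power: "zeta_pow \<zeta> p ^ r = 1"
proof -
  have "zeta_pow \<zeta> p ^ r = (\<zeta> ^ r) ^ (p - 1)" by (simp add: zeta_pow_def power_mult[symmetric] mult.commute)
  then show ?thesis using prim by (simp add: primitive_root_of_unity_def)
qed

lemma zeta_inj: "inj_on (zeta_pow \<zeta>) {1..r}"
proof -
  have "\<zeta> \<noteq> 0" using prim r by (auto simp: primitive_root_of_unity_def zero_power)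
  have *: "p = q" if "p \<in> {1..r}" "q \<in> {1..r}" "zeta_pow \<zeta> p = zeta_pow \<zeta> q" "p \<le> q" for p q
  proof (rule ccontr)
    assume "p \<noteq> q"
    have "\<zeta> ^ (q - 1) = \<zeta> ^ (p - 1) * \<zeta> ^ (q - p)" using that by (simp add: power_add[symmetric])
    then have "\<zeta> ^ (q - p) = 1" using that(3) \<open>\<zeta> \<noteq> 0\<close> by (simp add: zeta_pow_def)
    moreover have "q - p \<in> {1..<r}" using that \<open>p \<noteq> q\<close> by auto
    ultimately show False using prim by (auto simp: primitive_root_of_unity_def)
  qed
  show ?thesis
  proof (rule inj_onI)
    fix p q assume "p \<in> {1..r}" "q \<in> {1..r}" "zeta_pow \<zeta> p = zeta_pow \<zeta> q"
    then show "p = q" using *[of p q] *[of q p] by (cases "p \<le> q") auto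
  qed
qed

sublocale Y: separated_yokonuma "null_ideal r n d rv" fconst fx ft fg "fe r" n r d rv "\<lambda>p. rconst (zeta_pow \<zeta> p)"
proof (intro separated_yokonuma.intro separated_yokonuma_axioms.intro yokonuma_free_algebra n separated_rconst sep)
  show "rconst (zeta_pow \<zeta> p) ^ r = 1" for p by (simp add: rconst_power[symmetric] zeta_power)
  show "inj_on (\<lambda>p. rconst (zeta_pow \<zeta> p)) {1..r}" using zeta_inj unfolding inj_on_def rconst_eq_iff .
  show "of_nat r \<noteq> (0 :: 'k ratfun)" using r_inv by (simp add: rconst_of_nat[symmetric])
qed

definition \<theta> :: "nat \<Rightarrow> node" where "\<theta> = node_of lam t"
definition cont :: "nat \<Rightarrow> 'k" where "cont k = tab_content v lam t k"
definition zet :: "nat \<Rightarrow> 'k" where "zet k = zeta_pow \<zeta> (tab_pos lam t k)"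
text \<open>The weight of the idempotent \<open>E\<close> of the tableau.\<close>

definition wseq :: "nat \<Rightarrow> 'k ratfun \<times> nat" where "wseq k = (rconst (cont k), tab_pos lam t k)"

text \<open>The order of the factors is immaterial, so any enumeration will do.\<close>

definition other_contents :: "nat \<Rightarrow> 'k list" where
  "other_contents k = (SOME xs. distinct xs \<and> set xs = content_set r n d v k - {cont k})"
definition other_roots :: "nat \<Rightarrow> 'k list" where
  "other_roots k = remove1 (zet k) (map (zeta_pow \<zeta>) [1..<Suc r])"

text \<open>The factors of Lagrange interpolation of which the idempotent consists.\<close>

definition X_factor :: "nat \<Rightarrow> 'k falg" where
  "X_factor k = prod_list (map (\<lambda>b. fconst (1 / (cont k - b)) * (fx k - fconst b)) (other_contents k))"
definition T_factor :: "nat \<Rightarrow> 'k falg" where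
  "T_factor k = prod_list (map (\<lambda>b. fconst (1 / (zet k - b)) * (ft k - fconst b)) (other_roots k))"

definition T_idem :: "'k ratfun falg" where
  "T_idem = prod_list (map (\<lambda>k. extend_scalars (T_factor k)) [1..<Suc n])"

text \<open>
  The factor \<open>\<phi>\<^sub>k\<^sub>+\<^sub>1\<close> meets \<open>partial_idem k\<close>, which becomes \<open>partial_idem (Suc k)\<close> by the evaluation.
\<close>

primrec partial_idem :: "nat \<Rightarrow> 'k ratfun falg" where
  "partial_idem 0 = T_idem"
| "partial_idem (Suc k) = extend_scalars (X_factor (Suc k)) * partial_idem k"

lemma growth: "growth r d n \<theta>" and image: "\<theta> ` {1..n} = diagram lam"
  using tableau_growth[OF lam t] by (simp_all add: \<theta>_def)

lemma growth_le: "k \<le> n \<Longrightarrow> growth r d k \<theta>"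
  using growth_mono[OF growth] .

lemma shape_le: "k \<le> n \<Longrightarrow> shape r d (\<theta> ` {1..k})"
  using growth_shape[OF growth_le] .

lemma theta_range: "k \<in> {1..n} \<Longrightarrow> node_pr (\<theta> k) \<in> {1..r}"
  using shape_node(1)[OF shape_le[of n]] by blast

lemma pos_theta: "tab_pos lam t k = node_pr (\<theta> k)"
  by (simp add: tab_pos_def \<theta>_def)

lemma cont_theta: "cont k = node_content v (\<theta> k)"
  by (simp add: cont_def tab_content_def \<theta>_def)

lemma matches: "Y.matches \<theta> wseq k"
  by (simp add: Y.matches_def wseq_def pos_theta cont_theta node_content_rconst)

lemma other_contents:
  assumes "k \<in> {1..n}"
  shows "distinct (other_contents k)" "set (other_contents k) = content_set r n d v k - {cont k}"
proof -
  have "finite (content_set r n d v k - {cont k})" using finite_content_set[OF assms] by simp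
  from finite_distinct_list[OF this] have "\<exists>xs. distinct xs \<and> set xs = content_set r n d v k - {cont k}" by blast
  from someI_ex[OF this] show "distinct (other_contents k)" "set (other_contents k) = content_set r n d v k - {cont k}"
    by (simp_all add: other_contents_def)
qed

lemma distinct_roots: "distinct (map (zeta_pow \<zeta>) [1..<Suc r])"
  using zeta_inj by (simp add: distinct_map atLeastLessThanSuc_atLeastAtMost del: upt_Suc)

lemma set_roots: "set (map (zeta_pow \<zeta>) [1..<Suc r]) = root_set r \<zeta>"
  by (simp add: root_set_def atLeastLessThanSuc_atLeastAtMost del: upt_Suc)

lemma other_roots: "distinct (other_roots k)" "set (other_roots k) = root_set r \<zeta> - {zet k}"
  unfolding other_roots_def
  using distinct_roots set_remove1_eq[OF distinct_roots] set_roots by (simp_all del: upt_Suc)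

lemma zet_root: "k \<in> {1..n} \<Longrightarrow> zet k \<in> root_set r \<zeta>"
  using theta_range by (auto simp: zet_def pos_theta root_set_def)

lemma t_annihilated:
  assumes "k \<in> {1..n}"
  shows "Y.cg (Y.pl (ft k) (map rconst (zet k # other_roots k))) 0"
proof (rule Y.pl_roots_of_unity[OF Y.t_r[OF assms]])
  show "rconst \<zeta> ^ r = 1" using prim by (simp add: rconst_power[symmetric] primitive_root_of_unity_def)
  show "rconst \<zeta> ^ m \<noteq> 1" if "m \<in> {1..<r}" for m
    using prim that rconst_eq_iff[of "\<zeta> ^ m" 1] by (simp add: rconst_power[symmetric] primitive_root_of_unity_def)
  show "of_nat r \<noteq> (0 :: 'k ratfun)" by (rule Y.r_nonzero)
  fix p assume "p < r"
  then have "\<zeta> ^ p = zeta_pow \<zeta> (Suc p)" "Suc p \<in> {1..r}" by (auto simp: zeta_pow_def)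
  then have "\<zeta> ^ p \<in> root_set r \<zeta>" by (auto simp: root_set_def)
  then have "\<zeta> ^ p \<in> set (zet k # other_roots k)" using other_roots(2)[of k] by auto
  then show "rconst \<zeta> ^ p \<in> set (map rconst (zet k # other_roots k))"
    unfolding rconst_power[symmetric] set_map by (rule imageI)
qed

lemma extend_normalised:
  "extend_scalars (prod_list (map (\<lambda>b. fconst (1 / (c - b)) * (fgen y - fconst b)) bs))
   = fconst (1 / Y.pv (rconst c) (map rconst bs)) * Y.pl (fgen y) (map rconst bs)"
proof -
  have "extend_scalars (prod_list (map (\<lambda>b. fconst (1 / (c - b)) * (fgen y - fconst b)) bs))
    = prod_list (map (\<lambda>b. fconst (1 / (rconst c - b)) * (fgen y - fconst b)) (map rconst bs))"
    by (simp add: extend_scalars_prod_list extend_scalars_simps rconst_inverse rconst_diff o_def)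
  then show ?thesis unfolding Y.normalised_product .
qed

lemmas extend_X_factor = extend_normalised[of "cont k" "XGen k" "other_contents k" for k, folded X_factor_def]
lemmas extend_T_factor = extend_normalised[of "zet k" "TGen k" "other_roots k" for k, folded T_factor_def]

section \<open>The idempotent as a weight vector\<close>

lemma twt_T_idem: "Y.twt wseq T_idem"
  unfolding Y.twt_def
proof (intro ballI conjI)
  fix j assume j: "j \<in> {1..n}"
  show "snd (wseq j) \<in> {1..r}" using theta_range[OF j] by (simp add: wseq_def pos_theta)
  have "Y.cg (ft j * prod_list (map (\<lambda>k. extend_scalars (T_factor k)) xs))
      (fconst (rconst (zet j)) * prod_list (map (\<lambda>k. extend_scalars (T_factor k)) xs))"
    if "set xs \<subseteq> {1..n}" "j \<in> set xs" for xs
    using that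
  proof (induction xs)
    case (Cons k xs)
    let ?P = "prod_list (map (\<lambda>k. extend_scalars (T_factor k)) xs)"
    show ?case
    proof (cases "k = j")
      case True
      let ?L = "Y.pl (ft j) (map rconst (other_roots j))" and ?c = "1 / Y.pv (rconst (zet j)) (map rconst (other_roots j))"
      have "Y.cg ((ft j - fconst (rconst (zet j))) * ?L) 0" using t_annihilated[OF j] by simp
      then have "Y.cg (ft j * ?L) (fconst (rconst (zet j)) * ?L)"
        by (simp add: left_diff_distrib Y.cg_zero_iff)
      from Y.eig_scale[OF this, of ?c]
      have "Y.cg (ft j * extend_scalars (T_factor j)) (fconst (rconst (zet j)) * extend_scalars (T_factor j))"
        by (simp only: extend_T_factor)
      from Y.cg_right[OF this, of ?P] show ?thesis using True by (simp add: mult.assoc)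
    next
      case False
      have k: "k \<in> {1..n}" and jx: "j \<in> set xs" using Cons.prems False by auto
      have "Y.cg (ft j * extend_scalars (T_factor k)) (extend_scalars (T_factor k) * ft j)"
        unfolding extend_T_factor by (intro Y.commute_kap_pl Y.t_t j k)
      moreover have "Y.cg (ft j * ?P) (fconst (rconst (zet j)) * ?P)"
        using Cons jx by simp
      ultimately show ?thesis using Y.eig_commute by simp
    qed
  qed simp
  from this[of "[1..<Suc n]"] have "Y.cg (ft j * T_idem) (fconst (rconst (zet j)) * T_idem)"
    using j unfolding T_idem_def by (simp add: atLeastLessThanSuc_atLeastAtMost del: upt_Suc)
  then show "Y.cg (ft j * T_idem) (fconst (rconst (zeta_pow \<zeta> (snd (wseq j)))) * T_idem)"
    by (simp add: wseq_def zet_def)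
qed

lemma ev_partial_idem: "ev r n d v z a (partial_idem k) (partial_idem k)"
  by (induction k) (simp_all add: T_idem_def ev_mult[OF n] ev_extend_scalars[OF n] ev_prod_list[OF n])

text \<open>
  The partial idempotent splits into eigenvectors of the next \<open>x\<close>, whose eigenvalues are
  contents of addable nodes. They are defined over the constants, hence are their own values.
\<close>

lemma partial_idem_splits:
  assumes k: "k < n" and w: "Y.wt k wseq (partial_idem k)"
  shows "\<exists>as w. distinct as \<and>
     set as \<subseteq> node_content rv ` addable r d (\<theta> ` {1..k}) (node_pr (\<theta> (Suc k))) \<and>
     Y.cg (partial_idem k) (\<Sum>a\<in>set as. w a) \<and>
     (\<forall>a\<in>set as. Y.wt k wseq (w a) \<and> Y.cg (fx (Suc k) * w a) (fconst a * w a) \<and> ev r n d v z b (w a) (w a))"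
proof -
  have "Y.diagonalisable k" using Y.weights_are_tabular[of k] k by simp
  then obtain as where as: "distinct as"
    "set as \<subseteq> node_content rv ` addable r d (\<theta> ` {1..k}) (snd (wseq (Suc k)))"
    "Y.cg (Y.pl (fx (Suc k)) as * partial_idem k) 0"
    unfolding Y.diagonalisable_def using growth_le[of k] matches w k by force
  let ?V = "{y. Y.wt k wseq y \<and> ev r n d v z b y y}"
  have "\<exists>w. Y.cg (partial_idem k) (\<Sum>a\<in>set as. w a) \<and>
    (\<forall>a\<in>set as. w a \<in> ?V \<and> Y.cg (fx (Suc k) * w a) (fconst a * w a))"
  proof (rule Y.eigenvector_decomposition[where C = "range rconst", OF as(1,3)])
    show "partial_idem k \<in> ?V" using w ev_partial_idem by simp
    show "0 \<in> ?V" using Y.wt_scale[OF w, of 0] ev_zero[OF n] by simp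
    show "u + y \<in> ?V" if "u \<in> ?V" "y \<in> ?V" for u y
      using that Y.wt_add ev_add[OF n] by blast
    show "fconst c * y \<in> ?V" if "c \<in> range rconst" "y \<in> ?V" for c y
      using that Y.wt_scale ev_mult[OF n ev_fconst[OF n has_value_rconst]] by blast
    show "fx (Suc k) * y \<in> ?V" if "y \<in> ?V" for y
    proof -
      have "Y.wt k wseq (fx (Suc k) * y)" using that k by (intro Y.wt_x) auto
      moreover have "ev r n d v z b (fx (Suc k) * y) (fx (Suc k) * y)"
        using that by (intro ev_mult[OF n] ev_fgen[OF n]) auto
      ultimately show ?thesis by simp
    qed
    show "a - b \<in> range rconst" if "a \<in> range rconst" "b \<in> range rconst" for a b :: "'k ratfun"
      using that by (auto simp: rconst_diff[symmetric])
    show "1 / a \<in> range rconst" if "a \<in> range rconst" for a :: "'k ratfun"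
      using that by (auto simp: rconst_inverse[symmetric])
    show "1 \<in> range (rconst :: 'k \<Rightarrow> 'k ratfun)" using rconst_1 by (metis rangeI)
    show "set as \<subseteq> range rconst" using as(2) by (auto simp: node_content_rconst)
  qed
  then show ?thesis using as(1,2) by (auto simp: wseq_def pos_theta)
qed

lemma addable_content_mem:
  assumes "k < n" "\<nu> \<in> addable r d (\<theta> ` {1..k}) p"
  shows "node_content v \<nu> \<in> content_set r n d v (Suc k)"
  using content_set_mem[OF growth_Suc[OF growth_le[of k] assms(2)], of n v] assms(1) r d by simp

text \<open>
  Contents of addable nodes belong to the set over which the Lagrange factor is formed, since
  every diagram can be completed to a tableau with \<open>n\<close> entries.
\<close>

lemma X_factor_selects:
  assumes k: "k < n" and a: "a \<in> node_content rv ` addable r d (\<theta> ` {1..k}) p"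
    and y: "Y.cg (fx (Suc k) * y) (fconst a * y)"
  shows "Y.cg (extend_scalars (X_factor (Suc k)) * y) (if a = rconst (cont (Suc k)) then y else 0)"
proof -
  have k1: "Suc k \<in> {1..n}" using k by simp
  let ?bs = "map rconst (other_contents (Suc k))" and ?c = "rconst (cont (Suc k))"
  note oc = other_contents(2)[OF k1]
  have "Y.cg (extend_scalars (X_factor (Suc k)) * y) (fconst (Y.pv a ?bs / Y.pv ?c ?bs) * y)"
    unfolding extend_X_factor by (rule Y.normalised_product_eig[OF y])
  moreover have "Y.pv ?c ?bs \<noteq> 0"
  proof (rule Y.pv_nonzero)
    have "cont (Suc k) \<notin> set (other_contents (Suc k))" unfolding oc by blast
    then show "?c \<notin> set ?bs" unfolding set_map image_iff rconst_eq_iff by blast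
  qed
  moreover have "Y.pv a ?bs = 0" if "a \<noteq> ?c"
  proof -
    obtain \<nu> where \<nu>: "\<nu> \<in> addable r d (\<theta> ` {1..k}) p" "a = rconst (node_content v \<nu>)"
      using a by (auto simp: node_content_rconst)
    have "node_content v \<nu> \<noteq> cont (Suc k)"
      using that unfolding \<nu>(2) rconst_eq_iff .
    then have "node_content v \<nu> \<in> set (other_contents (Suc k))"
      unfolding oc using addable_content_mem[OF k \<nu>(1)] by blast
    then have "a \<in> set ?bs" unfolding \<nu>(2) set_map by (rule imageI)
    then show ?thesis by (rule Y.pv_zero)
  qed
  ultimately show ?thesis by (cases "a = ?c") (auto simp: fconst_hom(3))
qed

lemma partial_idem_Suc:
  assumes k: "k < n"
    and as: "distinct as" "set as \<subseteq> node_content rv ` addable r d (\<theta> ` {1..k}) (node_pr (\<theta> (Suc k)))"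
    and y: "Y.cg (partial_idem k) (\<Sum>a\<in>set as. y a)"
    and eig: "\<And>a. a \<in> set as \<Longrightarrow> Y.cg (fx (Suc k) * y a) (fconst a * y a)"
  shows "Y.cg (partial_idem (Suc k)) (if rconst (cont (Suc k)) \<in> set as then y (rconst (cont (Suc k))) else 0)"
proof -
  let ?c = "rconst (cont (Suc k))"
  have "Y.cg (partial_idem (Suc k)) (\<Sum>a\<in>set as. extend_scalars (X_factor (Suc k)) * y a)"
    unfolding partial_idem.simps sum_distrib_left[symmetric] by (rule Y.cg_left[OF y])
  also have "Y.cg \<dots> (\<Sum>a\<in>set as. if a = ?c then y a else 0)"
    using as(2) by (intro Y.cg_sum X_factor_selects[OF k] eig) auto
  also have "(\<Sum>a\<in>set as. if a = ?c then y a else 0) = (if ?c \<in> set as then y ?c else 0)"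
    by (simp add: sum.delta')
  finally show ?thesis .
qed

lemma wt_partial_idem: "k \<le> n \<Longrightarrow> Y.wt k wseq (partial_idem k)"
proof (induction k)
  case 0
  then show ?case using twt_T_idem by (simp add: Y.wt_def)
next
  case (Suc k)
  let ?c = "rconst (cont (Suc k))"
  have w: "Y.wt k wseq (partial_idem k)" using Suc by simp
  obtain as y where as: "distinct as" "set as \<subseteq> node_content rv ` addable r d (\<theta> ` {1..k}) (node_pr (\<theta> (Suc k)))"
    and y: "Y.cg (partial_idem k) (\<Sum>a\<in>set as. y a)"
    "\<And>a. a \<in> set as \<Longrightarrow> Y.wt k wseq (y a) \<and> Y.cg (fx (Suc k) * y a) (fconst a * y a)"
    using partial_idem_splits[OF _ w] Suc.prems by (metis Suc_le_lessD)
  have S: "Y.cg (partial_idem (Suc k)) (if ?c \<in> set as then y ?c else 0)"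
    using Suc.prems y(2) by (intro partial_idem_Suc[OF _ as y(1)]) auto
  have "Y.wt (Suc k) wseq (if ?c \<in> set as then y ?c else 0)"
  proof (cases "?c \<in> set as")
    case True
    have "Y.cg (fx j * y ?c) (fconst (fst (wseq j)) * y ?c)" if "j \<in> {1..Suc k}" for j
      using y(2)[OF True] that by (cases "j = Suc k") (auto simp: Y.wt_def wseq_def)
    then show ?thesis using True y(2)[OF True] by (auto simp: Y.wt_def)
  next
    case False
    then show ?thesis using w by (auto simp: Y.wt_def Y.twt_def)
  qed
  then show ?case by (rule Y.wt_cong[OF Y.cg_sym[OF S]])
qed

section \<open>The evaluations\<close>

lemma ev_pl: "ev r n d v z a y y' \<Longrightarrow> ev r n d v z a (Y.pl y (map rconst bs)) (Y.pl y' (map rconst bs))"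
proof (induction bs)
  case (Cons b bs)
  have "ev r n d v z a (y + fconst (rconst (- b))) (y' + fconst (rconst (- b)))"
    using Cons.prems by (intro ev_add[OF n] ev_fconst[OF n] has_value_rconst)
  then have "ev r n d v z a (y - fconst (rconst b)) (y' - fconst (rconst b))"
    by (simp add: rconst_minus Y.kap_minus)
  then show ?case using Cons ev_mult[OF n] by simp
qed (simp add: ev_one[OF n])

lemma ev_divided_difference:
  assumes "has_value z a u u'"
  shows "ev r n d v z a (Y.divided_difference u (fgen y) (map rconst bs)) (Y.divided_difference u' (fgen y) (map rconst bs))"
proof (induction bs)
  case (Cons b bs)
  then show ?case
    by (auto intro!: ev_add[OF n] ev_mult[OF n] ev_fconst[OF n] has_value_diff assms has_value_rconst ev_pl ev_fgen[OF n])
qed (simp add: ev_zero[OF n])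

lemma map_rv: "map rv xs = map rconst (map v xs)"
  by simp

lemma ev_fusion:
  assumes "has_value z a u u'" "\<And>i. i \<in> {1..k} \<Longrightarrow> has_value z a (us i) (us' i) \<and> u' \<noteq> us' i"
  shows "ev r n d v z a (Y.fusion us k u) (Y.fusion us' k u')"
  using assms(2)
proof (induction k)
  case 0
  show ?case unfolding Y.fusion.simps map_rv by (rule ev_divided_difference[OF assms(1)])
next
  case (Suc k)
  have u: "has_value z a (us (Suc k)) (us' (Suc k))" "u' - us' (Suc k) \<noteq> 0" using Suc.prems[of "Suc k"] by auto
  show ?case unfolding Y.fusion.simps
    by (intro ev_mult[OF n] ev_add[OF n] ev_fgen[OF n] ev_fe[OF n] ev_fconst[OF n] has_value_inverse
        has_value_diff assms(1) u Suc) (use Suc.prems in auto)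
qed

text \<open>The arguments of the fusion functions after the first \<open>k\<close> evaluations.\<close>

definition uvals :: "nat \<Rightarrow> nat \<Rightarrow> 'k ratfun" where
  "uvals k i = (if i \<le> k then rconst (cont i) else rvar (UVar i))"

lemma fusion_scalar_hook_ratio:
  assumes k: "k < n"
  shows "Y.fusion_scalar wseq (Suc k) (rvar z)
    = (rvar z - rconst (cont (Suc k))) * hook_ratio d rv (\<theta> ` {1..k}) (\<theta> (Suc k)) (rvar z)"
proof -
  let ?D = "\<theta> ` {1..k}" and ?p = "node_pr (\<theta> (Suc k))" and ?u = "rvar z :: 'k ratfun"
  have inj: "inj_on \<theta> {1..k}" using growth_le[of k] k by (simp add: growth_def)
  have nz: "?u - rv m + of_int i \<noteq> 0" for m i
  proof
    assume "?u - rv m + of_int i = 0"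
    then have "?u = rconst (v m - of_int i)" by (simp add: rconst_diff rconst_of_int algebra_simps)
    then show False using rvar_neq_rconst by blast
  qed
  have "Y.pv ?u (map rv [1..<Suc d]) = (\<Prod>m\<in>{1..d}. ?u - rv m)"
    unfolding Y.pv_def map_map
    by (simp only: prod.distinct_set_conv_list[OF distinct_upt, symmetric] set_upt atLeastLessThanSuc_atLeastAtMost o_def)
  moreover have "(\<Prod>i\<in>{i\<in>{1..<Suc k}. snd (wseq i) = snd (wseq (Suc k))}. 1 - 1 / (?u - fst (wseq i))\<^sup>2)
    = (\<Prod>b\<in>{b\<in>?D. node_pr b = ?p}. 1 - 1 / (?u - node_content rv b)\<^sup>2)"
  proof -
    let ?I = "{i\<in>{1..k}. node_pr (\<theta> i) = ?p}"
    have I: "{i\<in>{1..<Suc k}. snd (wseq i) = snd (wseq (Suc k))} = ?I"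
      by (auto simp: wseq_def pos_theta)
    have im: "{b\<in>?D. node_pr b = ?p} = \<theta> ` ?I" by auto
    have "inj_on \<theta> ?I" using inj by (rule inj_on_subset) auto
    then show ?thesis unfolding I im
      by (simp add: prod.reindex wseq_def cont_theta node_content_rconst)
  qed
  moreover have "\<theta> (Suc k) \<in> addable r d ?D ?p"
    using growth_last_addable[OF growth_le[of "Suc k"]] k by simp
  ultimately show ?thesis
    unfolding Y.fusion_scalar_def
    using content_product_hook_ratio[OF shape_le[of k], of "\<theta> (Suc k)" ?p ?u rv] nz k
    by (simp add: node_content_rconst cont_theta)
qed

lemma hook_ratio_value:
  assumes k: "k < n"
  shows "has_value (UVar (Suc k)) (cont (Suc k))
    (hook_ratio d rv (\<theta> ` {1..k}) (\<theta> (Suc k)) (rvar (UVar (Suc k))))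
    (hook_ratio d rv (\<theta> ` {1..k}) (\<theta> (Suc k)) (rconst (cont (Suc k))))"
proof -
  let ?D = "\<theta> ` {1..k}" and ?p = "node_pr (\<theta> (Suc k))"
  obtain a b p l where e: "\<theta> (Suc k) = ((a, b), p, l)" by (metis surj_pair)
  have \<nu>: "((a, b), p, l) \<in> addable r d ?D p"
    using growth_last_addable[OF growth_le[of "Suc k"]] k e by simp
  have c: "rconst (cont (Suc k)) = node_content rv ((a, b), p, l)"
    by (simp only: cont_theta node_content_rconst e)
  note den = hook_ratio_denominators[OF shape_le \<nu> separated_rconst[OF sep]]
  have card: "card ?D \<le> n" using growth_card[OF growth_le[of k]] k by simp
  have k': "k \<le> n" using k by simp
  show ?thesis
    unfolding e hook_ratio_def hook_factor_def prod.case
    by (intro has_value_mult has_value_prod has_value_divide has_value_add has_value_diff has_value_of_nat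
        has_value_rconst has_value_1 has_value_var)
      (simp_all only: c den(3)[OF k' card] den(6)[OF k' card] not_False_eq_True)
qed

text \<open>
  On the summand with eigenvalue \<open>a\<close> the fusion function is \<open>(u - c) / (u - a) H(u)\<close>, where \<open>c\<close> is
  the content of \<open>k + 1\<close>. At \<open>u = c\<close> this vanishes unless \<open>a = c\<close>.
\<close>

lemma fusion_step:
  assumes k: "k < n"
  shows "ev r n d v (UVar (Suc k)) (cont (Suc k))
     (Y.fusion (uvals k) k (rvar (UVar (Suc k))) * partial_idem k)
     (fconst (hook_ratio d rv (\<theta> ` {1..k}) (\<theta> (Suc k)) (rconst (cont (Suc k)))) * partial_idem (Suc k))"
proof -
  let ?u = "rvar (UVar (Suc k)) :: 'k ratfun" and ?c = "rconst (cont (Suc k)) :: 'k ratfun" and ?z = "UVar (Suc k)"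
  let ?H = "hook_ratio d rv (\<theta> ` {1..k}) (\<theta> (Suc k))" and ?F = "Y.fusion (uvals k) k (rvar (UVar (Suc k)))"
  have w: "Y.wt k wseq (partial_idem k)" using wt_partial_idem k by simp
  obtain as y where as: "distinct as" "set as \<subseteq> node_content rv ` addable r d (\<theta> ` {1..k}) (node_pr (\<theta> (Suc k)))"
    and y: "Y.cg (partial_idem k) (\<Sum>a\<in>set as. y a)"
    "\<And>a. a \<in> set as \<Longrightarrow> Y.wt k wseq (y a) \<and> Y.cg (fx (Suc k) * y a) (fconst a * y a) \<and>
       ev r n d v ?z (cont (Suc k)) (y a) (y a)"
    using partial_idem_splits[OF k w, of ?z "cont (Suc k)"] by blast
  have S: "Y.cg (partial_idem (Suc k)) (if ?c \<in> set as then y ?c else 0)"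
    using y(2) by (intro partial_idem_Suc[OF k as y(1)]) auto
  have const: "\<exists>b. a = rconst b" if "a \<in> set as" for a
    using as(2) that by (auto simp: node_content_rconst)
  have Fy: "Y.cg (?F * y a) (fconst ((?u - ?c) * ?H ?u / (?u - a)) * y a)" if a: "a \<in> set as" for a
  proof -
    \<comment> \<open>The summand \<open>y a\<close> has the weight of the tableau up to \<open>k\<close>, and \<open>a\<close> at \<open>k + 1\<close>.\<close>
    let ?s = "wseq(Suc k := (a, snd (wseq (Suc k))))"
    have tw: "Y.twt ?s (y a)" using y(2)[OF a] by (auto simp: Y.wt_def Y.twt_def)
    have "Y.cg (fx j * y a) (fconst (fst (?s j)) * y a)" if "j \<in> {1..Suc k}" for j
      using y(2)[OF a] that by (cases "j = Suc k") (auto simp: Y.wt_def)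
    then have ws: "Y.wt (Suc k) ?s (y a)" using tw by (auto simp: Y.wt_def)
    have "Y.cg (?F * y a) (fconst (Y.fusion_scalar ?s (Suc k) ?u / (?u - fst (?s (Suc k)))) * y a)"
    proof (rule Y.fusion_eig[OF _ ws])
      show "?u \<noteq> fst (?s i)" if "i \<in> {1..Suc k}" for i
        using const[OF a] rvar_neq_rconst by (cases "i = Suc k") (auto simp: wseq_def)
      show "uvals k i = fst (?s i)" if "i \<in> {1..k}" for i
        using that by (auto simp: uvals_def wseq_def)
    qed (use k in simp)
    moreover have "Y.fusion_scalar ?s (Suc k) ?u = Y.fusion_scalar wseq (Suc k) ?u"
      unfolding Y.fusion_scalar_def by (auto intro!: prod.cong arg_cong2[of _ _ _ _ "(*)"])
    ultimately show ?thesis by (simp add: fusion_scalar_hook_ratio[OF k])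
  qed
  let ?R = "\<lambda>a. if a = ?c then fconst (?H ?c) * y a else 0"
  have step: "ev r n d v ?z (cont (Suc k)) (?F * y a) (?R a)" if a: "a \<in> set as" for a
  proof (cases "a = ?c")
    case True
    have "?u - ?c \<noteq> 0" using rvar_neq_rconst by auto
    then have "Y.cg (?F * y a) (fconst (?H ?u) * y a)" using Fy[OF a] True by simp
    moreover have "ev r n d v ?z (cont (Suc k)) (fconst (?H ?u) * y a) (fconst (?H ?c) * y a)"
      using y(2)[OF a] by (intro ev_mult[OF n] ev_fconst[OF n] hook_ratio_value k) auto
    ultimately show ?thesis using True ev_cong[OF n Y.cg_sym Y.cg_refl] by auto
  next
    case False
    obtain b where b: "a = rconst b" using const[OF a] by blast
    have "has_value ?z (cont (Suc k)) ((?u - ?c) * ?H ?u / (?u - a)) ((?c - ?c) * ?H ?c / (?c - a))"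
      unfolding b using False b
      by (intro has_value_divide has_value_mult has_value_diff has_value_var has_value_rconst hook_ratio_value k) auto
    then have "ev r n d v ?z (cont (Suc k)) (fconst ((?u - ?c) * ?H ?u / (?u - a)) * y a) (fconst 0 * y a)"
      using y(2)[OF a] by (intro ev_mult[OF n] ev_fconst[OF n]) auto
    then show ?thesis using False ev_cong[OF n Y.cg_sym[OF Fy[OF a]] Y.cg_refl] by simp
  qed
  have A: "Y.cg (\<Sum>a\<in>set as. ?F * y a) (?F * partial_idem k)"
    unfolding sum_distrib_left[symmetric] by (rule Y.cg_left[OF Y.cg_sym[OF y(1)]])
  have B: "Y.cg (\<Sum>a\<in>set as. ?R a) (fconst (?H ?c) * partial_idem (Suc k))"
  proof -
    have "(\<Sum>a\<in>set as. ?R a) = fconst (?H ?c) * (if ?c \<in> set as then y ?c else 0)"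
      by (simp add: sum.delta')
    then show ?thesis using Y.cg_left[OF Y.cg_sym[OF S], of "fconst (?H ?c)"] by simp
  qed
  have "ev r n d v ?z (cont (Suc k)) (\<Sum>a\<in>set as. ?F * y a) (\<Sum>a\<in>set as. ?R a)"
    by (rule ev_sum[OF n step])
  then show ?thesis by (rule ev_cong[OF n A B])
qed

abbreviation "cl \<equiv> cls r n d rv"

lemma cl_eqI: "Y.cg P Q \<Longrightarrow> cl P = cl Q"
  unfolding cls_eq_iff[OF n] Y.cg_def .

section \<open>Scalars\<close>

lemma pv_distinct: "distinct bs \<Longrightarrow> Y.pv c (map rconst bs) = (\<Prod>b\<in>set bs. c - rconst b)"
  by (simp add: Y.pv_def prod.distinct_set_conv_list o_def)

text \<open>
  The scalar in front of the remaining fusion functions when \<open>u\<^sub>1, \<dots>, u\<^sub>k\<close> have been evaluated.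
\<close>

definition alpha :: "nat \<Rightarrow> 'k ratfun" where
  "alpha k = rconst (1 / F_lam d v lam) * hook_product d rv (\<theta> ` {1..k})"

lemma alpha_const: "alpha k = rconst (1 / F_lam d v lam * hook_product d v (\<theta> ` {1..k}))"
  by (simp only: alpha_def hook_product_rconst rconst_mult)

lemma alpha_Suc:
  assumes k: "k < n"
  shows "alpha (Suc k) = alpha k * hook_ratio d rv (\<theta> ` {1..k}) (\<theta> (Suc k)) (rconst (cont (Suc k)))"
proof -
  have "{1..Suc k} = insert (Suc k) {1..k}" by auto
  then have i: "\<theta> ` {1..Suc k} = insert (\<theta> (Suc k)) (\<theta> ` {1..k})" by (simp only: image_insert)
  have kn: "k \<le> n" using k by simp
  have card: "card (\<theta> ` {1..k}) \<le> n" using growth_card[OF growth_le[OF kn]] kn by simp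
  have G: "growth r d (Suc k) \<theta>" using growth_le[of "Suc k"] k by simp
  have "node_content rv (\<theta> (Suc k)) = rconst (cont (Suc k))" by (simp only: node_content_rconst cont_theta)
  then show ?thesis
    unfolding alpha_def i
      hook_product_insert[OF shape_le[OF kn] growth_last_addable[OF G] separated_rconst[OF sep] card]
    by (simp only: mult.assoc)
qed

lemma F_lam_eq: "F_lam d v lam = hook_product d v (\<theta> ` {1..n})"
  using F_lam_hook_product[of r d lam v] shape_le[OF le_refl] by (simp only: image)

lemma F_lam_nonzero: "F_lam d v lam \<noteq> 0"
  unfolding F_lam_eq using growth_card[OF growth]
  by (intro hook_product_nonzero[OF shape_le[OF le_refl] sep]) simp

lemma alpha_0: "alpha 0 = rconst (1 / F_lam d v lam)"
  by (simp add: alpha_def hook_product_def)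

lemma alpha_n: "alpha n = 1"
  unfolding alpha_const F_lam_eq[symmetric] using F_lam_nonzero by simp

lemma F_T_eq: "F_T r \<zeta> lam = (\<Prod>i\<in>{1..n}. \<Prod>\<xi>\<in>set (other_roots i). zet i - \<xi>)"
proof -
  have inj: "inj_on \<theta> {1..n}" using growth by (simp add: growth_def)
  show ?thesis
    unfolding F_T_def image[symmetric] prod.reindex[OF inj] o_def other_roots(2) zet_def pos_theta ..
qed

lemma other_roots_prod_nonzero: "(\<Prod>\<xi>\<in>set (other_roots i). zet i - \<xi>) \<noteq> 0"
proof -
  have "zet i \<notin> set (other_roots i)" unfolding other_roots(2) by blast
  then show ?thesis unfolding prod_zero_iff[OF finite_set] right_minus_eq by blast
qed

lemma F_T_nonzero: "F_T r \<zeta> lam \<noteq> 0"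
  unfolding F_T_eq prod_zero_iff[OF finite_atLeastAtMost] using other_roots_prod_nonzero by blast

section \<open>The stages of the evaluation\<close>

definition fus :: "nat \<Rightarrow> nat \<Rightarrow> 'k ratfun falg" where
  "fus k m = Y.fusion (uvals k) (m - 1) (rvar (UVar m))"

text \<open>The element that is reached when \<open>u\<^sub>1, \<dots>, u\<^sub>k\<close> have been evaluated.\<close>

definition U_stage :: "nat \<Rightarrow> 'k ratfun falg" where
  "U_stage k = fconst (alpha k) * (prod_list (map (fus k) (rev [Suc k..<Suc n])) * partial_idem k)"

lemma mult_inverse_quotient: "(a :: 'k ratfun) \<noteq> 0 \<Longrightarrow> a * (1 / a) = 1"
  by simp

lemma ev_fus:
  assumes "m \<in> {Suc (Suc k)..n}"
  shows "ev r n d v (UVar (Suc k)) (cont (Suc k)) (fus k m) (fus (Suc k) m)"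
  unfolding fus_def
proof (rule ev_fusion)
  show "has_value (UVar (Suc k)) (cont (Suc k)) (rvar (UVar m)) (rvar (UVar m))"
    using assms by (intro has_value_other_var) auto
  fix i assume i: "i \<in> {1..m - 1}"
  consider "i \<le> k" | "i = Suc k" | "Suc k < i" by linarith
  then show "has_value (UVar (Suc k)) (cont (Suc k)) (uvals k i) (uvals (Suc k) i) \<and> rvar (UVar m) \<noteq> uvals (Suc k) i"
  proof cases
    case 1
    then show ?thesis by (simp add: uvals_def has_value_rconst rvar_neq_rconst)
  next
    case 2
    then show ?thesis by (simp add: uvals_def has_value_var rvar_neq_rconst)
  next
    case 3
    then have "rvar (UVar m) \<noteq> (rvar (UVar i) :: 'k ratfun)" using i by (intro rvar_neq) auto
    then show ?thesis using 3 by (simp add: uvals_def has_value_other_var)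
  qed
qed

lemma U_step:
  assumes k: "k < n"
  shows "ev r n d v (UVar (Suc k)) (cont (Suc k)) (U_stage k) (U_stage (Suc k))"
proof -
  let ?H = "hook_ratio d rv (\<theta> ` {1..k}) (\<theta> (Suc k)) (rconst (cont (Suc k)))"
  let ?ms = "rev [Suc (Suc k)..<Suc n]"
  have "[Suc k..<Suc n] = Suc k # [Suc (Suc k)..<Suc n]" using k by (intro upt_conv_Cons) simp
  then have "U_stage k = fconst (alpha k) * (prod_list (map (fus k) ?ms) * (fus k (Suc k) * partial_idem k))"
    unfolding U_stage_def by (simp add: mult.assoc del: upt_Suc)
  moreover have "U_stage (Suc k) = fconst (alpha k) * (prod_list (map (fus (Suc k)) ?ms) * (fconst ?H * partial_idem (Suc k)))"
    unfolding U_stage_def alpha_Suc[OF k]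
    by (simp only: Y.kap_left_commute[of "prod_list (map (fus (Suc k)) ?ms)"] Y.kap_kap)
  moreover have "ev r n d v (UVar (Suc k)) (cont (Suc k))
      (fconst (alpha k) * (prod_list (map (fus k) ?ms) * (fus k (Suc k) * partial_idem k)))
      (fconst (alpha k) * (prod_list (map (fus (Suc k)) ?ms) * (fconst ?H * partial_idem (Suc k))))"
  proof (rule ev_mult[OF n _ ev_mult[OF n]])
    show "ev r n d v (UVar (Suc k)) (cont (Suc k)) (fconst (alpha k)) (fconst (alpha k))"
      unfolding alpha_const by (intro ev_fconst[OF n] has_value_rconst)
    show "ev r n d v (UVar (Suc k)) (cont (Suc k)) (prod_list (map (fus k) ?ms)) (prod_list (map (fus (Suc k)) ?ms))"
      by (intro ev_prod_list[OF n] ev_fus) (auto simp del: upt_Suc)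
    show "ev r n d v (UVar (Suc k)) (cont (Suc k)) (fus k (Suc k) * partial_idem k) (fconst ?H * partial_idem (Suc k))"
      using fusion_step[OF k] by (simp only: fus_def diff_Suc_1)
  qed
  ultimately show ?thesis by (simp only:)
qed

text \<open>A factor of \<open>\<Gamma>\<close>, before and after its evaluation.\<close>

definition T_rational :: "nat \<Rightarrow> 'k ratfun falg" where
  "T_rational i = Y.divided_difference (rvar (VVar i)) (ft i) (map rconst (zet i # other_roots i))"

definition T_value :: "nat \<Rightarrow> 'k ratfun falg" where
  "T_value i = Y.pl (ft i) (map rconst (other_roots i))"

text \<open>The element that is reached when the first \<open>j\<close> underlined variables have been evaluated.\<close>

definition V_stage :: "nat \<Rightarrow> 'k ratfun falg" where
  "V_stage j = fconst (rconst (1 / (F_T r \<zeta> lam * F_lam d v lam))) *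
     (prod_list (map (fus 0) (rev [1..<Suc n])) *
      prod_list (map (\<lambda>i. if i \<le> j then T_value i else T_rational i) [1..<Suc n]))"

lemma V_step:
  shows "ev r n d v (VVar (Suc j)) (zet (Suc j)) (V_stage j) (V_stage (Suc j))"
  unfolding V_stage_def
proof (intro ev_mult[OF n] ev_prod_list[OF n])
  let ?z = "VVar (Suc j)" and ?a = "zet (Suc j)"
  show "ev r n d v ?z ?a (fconst (rconst (1 / (F_T r \<zeta> lam * F_lam d v lam)))) (fconst (rconst (1 / (F_T r \<zeta> lam * F_lam d v lam))))"
    by (intro ev_fconst[OF n] has_value_rconst)
  show "ev r n d v ?z ?a (fus 0 m) (fus 0 m)" if "m \<in> set (rev [1..<Suc n])" for m
    unfolding fus_def
  proof (rule ev_fusion)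
    show "has_value ?z ?a (rvar (UVar m)) (rvar (UVar m))" by (intro has_value_other_var) simp
    fix i assume i: "i \<in> {1..m - 1}"
    then have "rvar (UVar m) \<noteq> (rvar (UVar i) :: 'k ratfun)" by (intro rvar_neq) auto
    then show "has_value ?z ?a (uvals 0 i) (uvals 0 i) \<and> rvar (UVar m) \<noteq> uvals 0 i"
      using i by (simp add: uvals_def has_value_other_var)
  qed
  show "ev r n d v ?z ?a (if i \<le> j then T_value i else T_rational i) (if i \<le> Suc j then T_value i else T_rational i)" for i
  proof -
    consider "i \<le> j" | "i = Suc j" | "Suc j < i" by linarith
    then show ?thesis
    proof cases
      case 1
      then show ?thesis by (simp add: T_value_def ev_pl ev_fgen[OF n])
    next
      case 2
      have "ev r n d v ?z ?a (T_rational i) (Y.divided_difference (rconst ?a) (ft i) (map rconst (zet i # other_roots i)))"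
        unfolding T_rational_def using 2 by (intro ev_divided_difference) (simp add: has_value_var)
      moreover have "Y.divided_difference (rconst ?a) (ft i) (map rconst (zet i # other_roots i)) = T_value i"
        using 2 by (simp add: T_value_def)
      ultimately show ?thesis using 2 by simp
    next
      case 3
      then have "ev r n d v ?z ?a (T_rational i) (T_rational i)"
        unfolding T_rational_def by (intro ev_divided_difference has_value_other_var) simp
      then show ?thesis using 3 by simp
    qed
  qed
qed

lemma V_stage_last: "V_stage n = U_stage 0"
proof -
  have val: "T_value i = fconst (rconst (\<Prod>\<xi>\<in>set (other_roots i). zet i - \<xi>)) * extend_scalars (T_factor i)" for i
  proof -
    have pv: "Y.pv (rconst (zet i)) (map rconst (other_roots i)) = rconst (\<Prod>\<xi>\<in>set (other_roots i). zet i - \<xi>)"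
      by (simp only: pv_distinct[OF other_roots(1)] rconst_prod rconst_diff)
    have "rconst (\<Prod>\<xi>\<in>set (other_roots i). zet i - \<xi>) \<noteq> 0"
      unfolding rconst_eq_0_iff by (rule other_roots_prod_nonzero)
    then have "rconst (\<Prod>\<xi>\<in>set (other_roots i). zet i - \<xi>) * (1 / rconst (\<Prod>\<xi>\<in>set (other_roots i). zet i - \<xi>)) = 1"
      by (rule mult_inverse_quotient)
    then show ?thesis unfolding extend_T_factor pv Y.kap_kap T_value_def by (simp only: Y.kap_one mult_1)
  qed
  have "prod_list (map (\<lambda>i. if i \<le> n then T_value i else T_rational i) [1..<Suc n]) = prod_list (map T_value [1..<Suc n])"
    by (intro arg_cong[of _ _ prod_list] map_cong) auto
  also have "\<dots> = fconst (prod_list (map (\<lambda>i. rconst (\<Prod>\<xi>\<in>set (other_roots i). zet i - \<xi>)) [1..<Suc n])) * T_idem"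
    unfolding val Y.prod_list_scaled T_idem_def ..
  also have "prod_list (map (\<lambda>i. rconst (\<Prod>\<xi>\<in>set (other_roots i). zet i - \<xi>)) [1..<Suc n]) = rconst (F_T r \<zeta> lam)"
    unfolding F_T_eq rconst_prod
    by (simp only: prod.distinct_set_conv_list[OF distinct_upt, symmetric] set_upt atLeastLessThanSuc_atLeastAtMost)
  finally have "V_stage n = fconst (rconst (1 / (F_T r \<zeta> lam * F_lam d v lam))) *
      (prod_list (map (fus 0) (rev [1..<Suc n])) * (fconst (rconst (F_T r \<zeta> lam)) * T_idem))"
    unfolding V_stage_def by (simp only:)
  also have "\<dots> = fconst (rconst (1 / (F_T r \<zeta> lam * F_lam d v lam)) * rconst (F_T r \<zeta> lam)) *
      (prod_list (map (fus 0) (rev [1..<Suc n])) * T_idem)"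
    by (simp only: Y.kap_left_commute[of "prod_list (map (fus 0) (rev [1..<Suc n]))"] Y.kap_kap)
  also have "rconst (1 / (F_T r \<zeta> lam * F_lam d v lam)) * rconst (F_T r \<zeta> lam) = alpha 0"
    unfolding alpha_0 rconst_mult[symmetric] using F_T_nonzero by simp
  finally show ?thesis by (simp only: U_stage_def partial_idem.simps One_nat_def)
qed

theorem evaluations:
  "YH_evals r n d v
     (map (\<lambda>i. (VVar i, zet i)) [1..<Suc n] @ map (\<lambda>i. (UVar i, cont i)) [1..<Suc n]) (cl (V_stage 0))
   = Some (cl (U_stage n))"
proof -
  let ?zas = "map (\<lambda>i. (VVar i, zet i)) [1..<Suc n] @ map (\<lambda>i. (UVar i, cont i)) [1..<Suc n]"
  \<comment> \<open>The two sequences of stages meet in \<open>V_stage n = U_stage 0\<close>.\<close>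
  define P where "P i = (if i < n then V_stage i else U_stage (i - n))" for i
  have len: "length ?zas = n + n" by simp
  have "ev r n d v (fst (?zas ! i)) (snd (?zas ! i)) (P i) (P (Suc i))" if i: "i < length ?zas" for i
  proof (cases "i < n")
    case True
    have "?zas ! i = (VVar (Suc i), zet (Suc i))" using True by (simp add: nth_append del: upt_Suc)
    moreover have "P (Suc i) = V_stage (Suc i)" using True V_stage_last by (cases "Suc i = n") (auto simp: P_def)
    ultimately show ?thesis using V_step[of i] True by (simp add: P_def)
  next
    case False
    have "?zas ! i = (UVar (Suc (i - n)), cont (Suc (i - n)))"
      using False i len by (simp add: nth_append del: upt_Suc)
    moreover have "Suc i - n = Suc (i - n)" using False by simp
    ultimately show ?thesis using U_step[of "i - n"] False i len by (simp add: P_def)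
  qed
  from YH_evals_chain[OF n this] show ?thesis using n len by (simp add: P_def)
qed

section \<open>Initial and final elements\<close>

text \<open>
  Dividing \<open>f(u)\<close> by \<open>u - y\<close> where \<open>f(y) = 0\<close>: the divided difference is inverse to \<open>u - y\<close> up to the
  invertible scalar \<open>f(u)\<close>.
\<close>

lemma cl_divided_difference:
  assumes bs: "Y.cg (Y.pl y (map rconst bs)) 0" and u: "Y.pv u (map rconst bs) \<noteq> 0"
  shows "cl (fconst (Y.pv u (map rconst bs))) \<otimes>\<^bsub>YH r n d rv\<^esub> inv\<^bsub>YH r n d rv\<^esub> (cl (fconst u - y))
    = cl (Y.divided_difference u y (map rconst bs))"
proof -
  let ?R = "Y.divided_difference u y (map rconst bs)" and ?c = "Y.pv u (map rconst bs)"
  have "?R * (fconst u - y) - fconst ?c = - Y.pl y (map rconst bs)"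
    unfolding Y.divided_difference by simp
  moreover have "- Y.pl y (map rconst bs) \<in> null_ideal r n d rv"
    using Y.J_minus bs by (simp add: Y.cg_def)
  ultimately have A: "?R * (fconst u - y) - fconst ?c \<in> null_ideal r n d rv" by simp
  then have B: "(fconst u - y) * ?R - fconst ?c \<in> null_ideal r n d rv"
    unfolding Y.divided_difference_commute .
  have "fconst ?c * (fconst (1 / ?c) * ?R) = ?R"
    unfolding Y.kap_kap using u by simp
  then show ?thesis
    unfolding cls_inv[OF n B A u] cls_mult[OF n, symmetric] by simp
qed

lemma YH_rat_class_cl: "P \<in> carrier (free_algebra n) \<Longrightarrow> YH_rat_class r n d v P = cl P"
  by (simp add: YH_rat_class_def cls_YH_class)

lemma phi_cl:
  assumes "Suc k \<le> n" "\<And>l. u \<noteq> rv l"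
  shows "phi r n d v us (Suc k) u = cl (Y.fusion us k u)"
  using assms(1)
proof (induction k)
  case 0
  let ?vs = "map v [1..<Suc d]"
  have pv: "Y.pv u (map rconst ?vs) = (\<Prod>l\<in>{1..d}. u - rv l)"
    unfolding Y.pv_def map_map
    by (simp only: prod.distinct_set_conv_list[OF distinct_upt, symmetric] set_upt atLeastLessThanSuc_atLeastAtMost o_def)
  have nz: "Y.pv u (map rconst ?vs) \<noteq> 0" unfolding pv using assms(2) by (auto simp: prod_zero_iff)
  have "Y.cg (Y.pl (fx 1) (map rconst ?vs)) 0" using Y.cyclotomic[OF n] unfolding map_rv .
  from cl_divided_difference[OF this nz] show ?case
    unfolding pv phi.simps YH_rat_def Y.fusion.simps map_rv
    using n by (simp add: YH_rat_class_cl free_algebra_closed del: upt_Suc)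
next
  case (Suc k)
  have c: "fg (Suc k) + fconst (1 / (u - us (Suc k))) * fe r (Suc k) \<in> carrier (free_algebra n)"
    "fg (Suc k) \<in> carrier (free_algebra n)"
    using Suc.prems by (auto intro!: free_algebra_closed)
  have IH: "phi r n d v us (Suc k) u = cl (Y.fusion us k u)" using Suc by simp
  show ?case
    unfolding phi.simps IH g_rat_def YH_rat_class_cl[OF c(1)] YH_rat_class_cl[OF c(2)] YH_rat_def
      cls_mult[OF n, symmetric] Y.fusion.simps ..
qed

lemma initial_element:
  "YH_rat_class r n d v (fconst (rconst (1 / (F_T r \<zeta> lam * F_lam d v lam)))) \<otimes>\<^bsub>YH_rat r n d v\<^esub> Phi_fun r n d v \<zeta>
   = cl (V_stage 0)"
proof -
  have phi: "phi r n d v (\<lambda>i. rvar (UVar i)) k (rvar (UVar k)) = cl (fus 0 k)" if k: "k \<in> set (rev [1..<Suc n])" for k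
  proof -
    have "k \<in> {1..n}" using k by (simp only: set_rev set_upt atLeastLessThanSuc_atLeastAtMost)
    then obtain m where m: "k = Suc m" "Suc m \<le> n" by (cases k) auto
    have "phi r n d v (\<lambda>i. rvar (UVar i)) (Suc m) (rvar (UVar k)) = cl (Y.fusion (\<lambda>i. rvar (UVar i)) m (rvar (UVar k)))"
      by (rule phi_cl[OF m(2) rvar_neq_rconst])
    also have "Y.fusion (\<lambda>i. rvar (UVar i)) m (rvar (UVar k)) = fus 0 k"
      unfolding fus_def m(1) diff_Suc_1 by (rule Y.fusion_cong) (simp add: uvals_def)
    finally show ?thesis by (simp only: m(1))
  qed
  have G: "YH_rat_class r n d v (fconst (\<Prod>\<xi>\<in>root_set r \<zeta>. rvar (VVar i) - rconst \<xi>)) \<otimes>\<^bsub>YH_rat r n d v\<^esub>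
      inv\<^bsub>YH_rat r n d v\<^esub> (YH_rat_class r n d v (fconst (rvar (VVar i)) - ft i)) = cl (T_rational i)"
    if i: "i \<in> set [1..<Suc n]" for i
  proof -
    have i': "i \<in> {1..n}" using i by auto
    let ?bs = "zet i # other_roots i"
    have d: "distinct ?bs" "set ?bs = root_set r \<zeta>" using other_roots[of i] zet_root[OF i'] by auto
    have pv: "Y.pv (rvar (VVar i)) (map rconst ?bs) = (\<Prod>\<xi>\<in>root_set r \<zeta>. rvar (VVar i) - rconst \<xi>)"
      by (simp only: pv_distinct[OF d(1)] d(2))
    have fin: "finite (root_set r \<zeta>)" by (simp add: root_set_def)
    have nz: "Y.pv (rvar (VVar i)) (map rconst ?bs) \<noteq> 0"
      unfolding pv prod_zero_iff[OF fin] using rvar_neq_rconst by (metis eq_iff_diff_eq_0)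
    have c: "fconst (rvar (VVar i)) - ft i \<in> carrier (free_algebra n)" using i' by (intro free_algebra_closed)
    show ?thesis
      using cl_divided_difference[OF t_annihilated[OF i'] nz]
      unfolding pv YH_rat_def YH_rat_class_cl[OF c] YH_rat_class_cl[OF free_algebra_fconst] T_rational_def .
  qed
  have A: "map (\<lambda>k. phi r n d v (\<lambda>i. rvar (UVar i)) k (rvar (UVar k))) (rev [1..<Suc n]) = map (\<lambda>k. cl (fus 0 k)) (rev [1..<Suc n])"
    using phi by (intro map_cong refl)
  have B: "map (\<lambda>i. YH_rat_class r n d v (fconst (\<Prod>\<xi>\<in>root_set r \<zeta>. rvar (VVar i) - rconst \<xi>)) \<otimes>\<^bsub>YH_rat r n d v\<^esub>
      inv\<^bsub>YH_rat r n d v\<^esub> (YH_rat_class r n d v (fconst (rvar (VVar i)) - ft i))) [1..<Suc n] = map (\<lambda>i. cl (T_rational i)) [1..<Suc n]"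
    using G by (intro map_cong refl)
  have C: "map (\<lambda>i. if i \<le> 0 then T_value i else T_rational i) [1..<Suc n] = map T_rational [1..<Suc n]"
    by (intro map_cong refl) auto
  show ?thesis
    unfolding Phi_fun_def Gamma_fun_def A B unfolding YH_rat_def cls_ring_prod_list[OF n]
      YH_rat_class_cl[OF free_algebra_fconst] cls_mult[OF n, symmetric] V_stage_def C ..
qed

definition E_elem :: "'k falg" where
  "E_elem = prod_list (map (\<lambda>k. X_factor k * T_factor k) [1..<Suc n])"

lemma X_factor_carrier: "k \<in> {1..n} \<Longrightarrow> X_factor k \<in> carrier (free_algebra n)"
  unfolding X_factor_def by (intro free_algebra_prod_list free_algebra_closed)

lemma T_factor_carrier: "k \<in> {1..n} \<Longrightarrow> T_factor k \<in> carrier (free_algebra n)"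
  unfolding T_factor_def by (intro free_algebra_prod_list free_algebra_closed)

lemma E_elem_carrier: "E_elem \<in> carrier (free_algebra n)"
  unfolding E_elem_def
  by (intro free_algebra_prod_list free_algebra_mult X_factor_carrier T_factor_carrier) auto

lemma E_idem_cls: "E_idem r n d v \<zeta> lam t = cls r n d v E_elem"
proof -
  interpret I: ideal_mod "null_ideal r n d v" fconst by (rule ideal_mod_null_ideal[OF n])
  have X: "comm_prod (YH r n d v)
      (\<lambda>c. YH_class r n d v (fconst (1 / (tab_content v lam t k - c)) * (fx k - fconst c)))
      (content_set r n d v k - {tab_content v lam t k}) = cls r n d v (X_factor k)" if k: "k \<in> {1..n}" for k
  proof -
    have "(\<lambda>c. YH_class r n d v (fconst (1 / (cont k - c)) * (fx k - fconst c)))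
      = (\<lambda>c. cls r n d v (fconst (1 / (cont k - c)) * (fx k - fconst c)))"
      using k by (intro ext cls_YH_class free_algebra_closed)
    then show ?thesis
      unfolding cont_def[symmetric] other_contents(2)[OF k, symmetric] X_factor_def
      by (simp only: comm_prod_cls[OF n I.normalised_commute other_contents(1)[OF k]])
  qed
  have T: "comm_prod (YH r n d v)
      (\<lambda>c. YH_class r n d v (fconst (1 / (zeta_pow \<zeta> (tab_pos lam t k) - c)) * (ft k - fconst c)))
      (position_set r n d \<zeta> k - {zeta_pow \<zeta> (tab_pos lam t k)}) = cls r n d v (T_factor k)" if k: "k \<in> {1..n}" for k
  proof -
    have "(\<lambda>c. YH_class r n d v (fconst (1 / (zet k - c)) * (ft k - fconst c)))
      = (\<lambda>c. cls r n d v (fconst (1 / (zet k - c)) * (ft k - fconst c)))"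
      using k by (intro ext cls_YH_class free_algebra_closed)
    then show ?thesis
      unfolding zet_def[symmetric] position_set_eq[OF k d] other_roots(2)[symmetric] T_factor_def
      by (simp only: comm_prod_cls[OF n I.normalised_commute other_roots(1)])
  qed
  have "E_idem r n d v \<zeta> lam t = ring_prod_list (YH r n d v) (map (\<lambda>k. cls r n d v (X_factor k * T_factor k)) [1..<Suc n])"
    unfolding E_idem_def
  proof (intro arg_cong[of _ _ "ring_prod_list (YH r n d v)"] map_cong refl)
    fix k assume "k \<in> set [1..<Suc n]"
    then have k: "k \<in> {1..n}" by auto
    show "comm_prod (YH r n d v)
            (\<lambda>c. YH_class r n d v (fconst (1 / (tab_content v lam t k - c)) * (fx k - fconst c)))
            (content_set r n d v k - {tab_content v lam t k})
          \<otimes>\<^bsub>YH r n d v\<^esub>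
          comm_prod (YH r n d v)
            (\<lambda>c. YH_class r n d v (fconst (1 / (zeta_pow \<zeta> (tab_pos lam t k) - c)) * (ft k - fconst c)))
            (position_set r n d \<zeta> k - {zeta_pow \<zeta> (tab_pos lam t k)}) = cls r n d v (X_factor k * T_factor k)"
      unfolding X[OF k] T[OF k] cls_mult[OF n] ..
  qed
  then show ?thesis unfolding cls_ring_prod_list[OF n] E_elem_def .
qed

lemma partial_idem_product:
  "partial_idem k = prod_list (map (\<lambda>k. extend_scalars (X_factor k)) (rev [1..<Suc k])) * T_idem"
  by (induction k) (simp_all add: mult.assoc)

text \<open>
  The \<open>x\<close> and the \<open>t\<close> commute modulo the relations, so the factors of the idempotent may be
  rearranged.
\<close>

lemma partial_idem_E_elem: "Y.cg (extend_scalars E_elem) (partial_idem n)"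
proof -
  define A where "A k = extend_scalars (X_factor k)" for k
  define B where "B k = extend_scalars (T_factor k)" for k
  have xA: "Y.cg (fx j * A k) (A k * fx j)" if "j \<in> {1..n}" "k \<in> {1..n}" for j k
    unfolding A_def extend_X_factor using that by (intro Y.commute_kap_pl Y.x_x)
  have tA: "Y.cg (ft j * A k) (A k * ft j)" if "j \<in> {1..n}" "k \<in> {1..n}" for j k
    unfolding A_def extend_X_factor using that by (intro Y.commute_kap_pl Y.t_x)
  have AA: "Y.cg (A k * A j) (A j * A k)" if "j \<in> {1..n}" "k \<in> {1..n}" for j k
    unfolding A_def[of j] extend_X_factor by (intro Y.commute_kap_pl Y.cg_sym[OF xA] that)
  have AB: "Y.cg (A k * B j) (B j * A k)" if "j \<in> {1..n}" "k \<in> {1..n}" for j k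
    unfolding B_def extend_T_factor by (intro Y.commute_kap_pl Y.cg_sym[OF tA] that)
  have "Y.cg (prod_list (map (\<lambda>k. A k * B k) [1..<Suc m]))
      (prod_list (map A (rev [1..<Suc m])) * prod_list (map B [1..<Suc m]))" if "m \<le> n" for m
    using that
  proof (induction m)
    case (Suc m)
    let ?PA = "prod_list (map A (rev [1..<Suc m]))" and ?PB = "prod_list (map B [1..<Suc m])"
    let ?a = "A (Suc m)" and ?b = "B (Suc m)"
    have u: "[1..<Suc (Suc m)] = [1..<Suc m] @ [Suc m]" by simp
    have sm: "Suc m \<in> {1..n}" using Suc.prems by simp
    have "Y.cg (?a * (?PA * ?PB)) (?PA * ?PB * ?a)"
    proof (intro Y.commute_mult Y.commute_prod_list)
      show "Y.cg (?a * A i) (A i * ?a)" if "i \<in> set (rev [1..<Suc m])" for i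
        using that Suc.prems by (intro AA sm) auto
      show "Y.cg (?a * B i) (B i * ?a)" if "i \<in> set [1..<Suc m]" for i
        using that Suc.prems by (intro AB sm) auto
    qed
    from Y.cg_right[OF Y.cg_sym[OF this], of ?b]
    have 1: "Y.cg (?PA * ?PB * (?a * ?b)) (?a * ?PA * (?PB * ?b))" by (simp only: mult.assoc)
    have "Y.cg (prod_list (map (\<lambda>k. A k * B k) [1..<Suc m]) * (?a * ?b)) (?PA * ?PB * (?a * ?b))"
      using Suc by (intro Y.cg_right) simp
    from Y.cg_trans[OF this 1] show ?case
      unfolding u by (simp add: mult.assoc del: upt_Suc)
  qed simp
  from this[OF le_refl] show ?thesis
    unfolding partial_idem_product T_idem_def E_elem_def extend_scalars_prod_list extend_scalars_simps A_def B_def .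
qed

lemma final_element: "cl (U_stage n) = YH_const r n d v (E_idem r n d v \<zeta> lam t)"
proof -
  have "U_stage n = partial_idem n" by (simp add: U_stage_def alpha_n)
  then show ?thesis
    unfolding E_idem_cls YH_const_cls[OF n E_elem_carrier] using cl_eqI[OF partial_idem_E_elem] by simp
qed

end

section \<open>The fusion formula\<close>

theorem theorem3p6:
  fixes r d n p :: nat
    and v :: "nat \<Rightarrow> 'k::alg_closed_field"
    and \<zeta> :: 'k
    and lam :: rd_partition
    and t :: "node \<Rightarrow> nat"
  assumes "r \<ge> 1" and "d \<ge> 1" and "n \<ge> 1"
    and "CHAR('k) = p" and "p > 0" and "\<not> p dvd r"
    and "of_nat (fact n) *
           (\<Prod>(i, j)\<in>{(i, j). 1 \<le> i \<and> i < j \<and> j \<le> d}.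
              \<Prod>l\<in>{- int n<..<int n}. of_int l + v i - v j) \<noteq> 0"
    and "primitive_root_of_unity r \<zeta>"
    and "lam \<in> rd_partitions r d n"
    and "t \<in> std_tableaux n lam"
  shows "YH_evals r n d v
           (map (\<lambda>i. (VVar i, zeta_pow \<zeta> (tab_pos lam t i))) [1..<Suc n] @
            map (\<lambda>i. (UVar i, tab_content v lam t i)) [1..<Suc n])
           (YH_rat_class r n d v (fconst (rconst (1 / (F_T r \<zeta> lam * F_lam d v lam))))
            \<otimes>\<^bsub>YH_rat r n d v\<^esub> Phi_fun r n d v \<zeta>)
         = Some (YH_const r n d v (E_idem r n d v \<zeta> lam t))"
proof -
  interpret fusion_procedure r d n v \<zeta> lam t
  proof
    show "of_nat r \<noteq> (0 :: 'k)" using assms(4,6) by (simp add: of_nat_eq_0_iff_char_dvd)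
    show "separated n d v" using assms(7) by (rule separated_if_nonzero)
  qed (fact assms)+
  show ?thesis
    using evaluations unfolding initial_element final_element zet_def cont_def .
qed

end
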